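(* Let $(\kappa,G)$ be a chain digraph of the family $\mathcal F_1$, that is, $G=(V,E)$ is a forest consisting of two disjoint rooted trees, each directed from the leaves to the root, and $\kappa_{i,j}$ is even for every directed edge $(v_i,v_j)\in E$. Then the Lie algebra $\mathfrak g(\kappa,G)$ is symplectic. Moreover, if $v_1$ and $v_2$ are the roots of the two trees forming $G$, then the 2-form $$\sigma_G=v_1^*\wedge v_2^*+\sum_{(v_i,v_j)\in E}\sigma_{i,j},\qquad \sigma_{i,j}=\sum_{l=1}^{\kappa_{i,j}/2}(-1)^{l+1}\,(w_{i,j}^{l})^*\wedge (w_{i,j}^{\kappa_{i,j}+1-l})^*,$$ is a symplectic form on $\mathfrak g(\kappa,G)$.
   Context: All Lie algebras are finite-dimensional over a field $\mathbb{K}$ of characteristic zero. For a Lie algebra $\mathfrak g$, $d:\mathfrak g^*\to\Lambda^2\mathfrak g^*$ is the dual of the bracket $\Lambda^2\mathfrak g\to\mathfrak g$, extended by $d(\alpha\wedge\beta)=d\alpha\wedge\beta-\alpha\wedge d\beta$ for $\alpha,\beta\in\mathfrak g^*$. A symplectic form on a Lie algebra of dimension $2n$ is $\omega\in\Lambda^2\mathfrak g^*$ with $d\omega=0$ and $\omega^n\neq0$; $\mathfrak g$ is symplectic if it admits one. A digraph is a pair $G=(V,E)$ with $V=\{v_1,\dots,v_m\}$ finite, $E\subseteq V\times V$, such that $(u,v)\in E$ implies $(v,u)\notin E$ (in particular no loops). A tree with chosen root $v$ is directed from the leaves to the root if for every vertex $u\ne v$ there is a directed path from $u$ to $v$ (this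 orientation is unique). A chain digraph is a pair $(\kappa,G)$ with $G=(V,E)$ a digraph and $\kappa:E\to\mathbb{N}_{\ge2}$ a function; $\kappa_{i,j}=\kappa((v_i,v_j))$ and $k$ is the maximum value of $\kappa$. Let $L_{(k)}(m)$ be the free $k$-step nilpotent Lie algebra on $v_1,\dots,v_m$ and $\mathfrak g(k,G)=L_{(k)}(m)/I$, where $I$ is the ideal generated by all $[v_i,v_j]$ such that neither $(v_i,v_j)$ nor $(v_j,v_i)$ is in $E$. It is graded by $\mathbb{Z}_{\ge0}^m$ with $v_i$ in multidegree $e_i$; $V_d$ denotes the sum of the components of total degree $d$. For $(v_i,v_j)\in E$ and $1\le c\le k$, let $I_{i,j}^{c}$ be the sum of all multihomogeneous components of $\mathfrak g(k,G)$ whose multidegree is not in $\{e_j\}\cup\{e_i+(l-1)e_j:1\le l\le c\}$; it is an ideal. Put $I_\kappa=\big(\bigcap_{(v_i,v_j)\in E}I_{i,j}^{\kappa_{i,j}}\big)\cap(V_3\oplus\dots\oplus V_k)$ and $\mathfrak g(\kappa,G)=\mathfrak g(k,G)/I_\kappa$. If $E=\emptyset$, $\mathfrak g(\kappa,G)$ is the abelian Lie algebra with basis $V$. For $(v_i,v_j)\in E$ define $w_{i,j}^1=v_i$, $w_{i,j}^2=[v_i,v_j]$, $w_{i,j}^l=[w_{i,j}^{l-1},v_j]$ for $l\ge3$; the same symbols denote images in $\mathfrak g(\kappa,G)$. The standard basis of $\mathfrak g(\kappa,G)$ is $\{v_1,\dots,v_m\}\cup\{w_{i,j}^l:(v_i,v_j)\in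 E,\ 2\le l\le\kappa_{i,j}\}$, and the only nonzero brackets of basis elements, up to skew-symmetry, are $[w_{i,j}^l,v_j]=w_{i,j}^{l+1}$ for $(v_i,v_j)\in E$, $1\le l\le\kappa_{i,j}-1$. A superscript ${}^*$ denotes the element of the dual of the standard basis. *)

theory Defs
  imports
    "Jordan_Normal_Form.VS_Connect"
    "Graph_Theory.Digraph_Component"
    "HOL-Combinatorics.Permutations"
    "HOL-Algebra.QuotRing"
begin

hide_const (open) Multiset.mult Polynomial.smult Modules.module Topological_Spaces.connected
hide_fact (open) Multiset.mult_def

section \<open>Lie algebras\<close>

text \<open>A nonassociative algebra over a field \<open>'k\<close> is a HOL-Algebra \<open>module\<close> record over
  \<open>class_ring\<close> whose \<open>mult\<close> field carries the product.  In a Lie algebra \<open>x \<otimes> y\<close> is the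
  bracket \<open>[x, y]\<close>.  The field \<open>one\<close> of the record has no meaning here.\<close>

locale lie_algebra = vectorspace class_ring L
  for L :: "('k::field, 'a) module" (structure) +
  assumes bracket_closed: "\<lbrakk>x \<in> carrier L; y \<in> carrier L\<rbrakk> \<Longrightarrow> x \<otimes> y \<in> carrier L"
    and bracket_add_left: "\<lbrakk>x \<in> carrier L; y \<in> carrier L; z \<in> carrier L\<rbrakk>
          \<Longrightarrow> (x \<oplus> y) \<otimes> z = x \<otimes> z \<oplus> y \<otimes> z"
    and bracket_add_right: "\<lbrakk>x \<in> carrier L; y \<in> carrier L; z \<in> carrier L\<rbrakk>
          \<Longrightarrow> x \<otimes> (y \<oplus> z) = x \<otimes> y \<oplus> x \<otimes> z"
    and bracket_smult_left: "\<lbrakk>x \<in> carrier L; y \<in> carrier L\<rbrakk>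
          \<Longrightarrow> (c \<odot>\<^bsub>L\<^esub> x) \<otimes> y = c \<odot>\<^bsub>L\<^esub> (x \<otimes> y)"
    and bracket_smult_right: "\<lbrakk>x \<in> carrier L; y \<in> carrier L\<rbrakk>
          \<Longrightarrow> x \<otimes> (c \<odot>\<^bsub>L\<^esub> y) = c \<odot>\<^bsub>L\<^esub> (x \<otimes> y)"
    and bracket_self: "x \<in> carrier L \<Longrightarrow> x \<otimes> x = \<zero>"
    and jacobi: "\<lbrakk>x \<in> carrier L; y \<in> carrier L; z \<in> carrier L\<rbrakk>
          \<Longrightarrow> (x \<otimes> y) \<otimes> z \<oplus> (y \<otimes> z) \<otimes> x \<oplus> (z \<otimes> x) \<otimes> y = \<zero>"

abbreviation lspan :: "('k::field, 'a) module \<Rightarrow> 'a set \<Rightarrow> 'a set" where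
  "lspan L S \<equiv> LinearCombinations.module.span class_ring L S"

definition alg_ideal :: "('k::field, 'a) module \<Rightarrow> 'a set \<Rightarrow> bool" where
  "alg_ideal L I \<longleftrightarrow> LinearCombinations.submodule class_ring I L \<and>
     (\<forall>x\<in>carrier L. \<forall>y\<in>I. x \<otimes>\<^bsub>L\<^esub> y \<in> I \<and> y \<otimes>\<^bsub>L\<^esub> x \<in> I)"

definition ideal_gen :: "('k::field, 'a) module \<Rightarrow> 'a set \<Rightarrow> 'a set" where
  "ideal_gen L S = \<Inter>{I. alg_ideal L I \<and> S \<subseteq> I}"

text \<open>The quotient by an ideal, on cosets as for \<^const>\<open>FactRing\<close>; the class of \<open>x\<close> is
  \<open>I +>\<^bsub>L\<^esub> x\<close>.\<close>

definition quot_alg :: "('k::field, 'a) module \<Rightarrow> 'a set \<Rightarrow> ('k, 'a set) module" where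
  "quot_alg L I = \<lparr>carrier = a_rcosets\<^bsub>L\<^esub> I, mult = rcoset_mult L I, one = I,
     zero = I, add = set_add L, smult = (\<lambda>c X. \<Union>x\<in>X. I +>\<^bsub>L\<^esub> (c \<odot>\<^bsub>L\<^esub> x))\<rparr>"

text \<open>The lower central series, indexed from 0: \<open>lower_central L i\<close> is the \<open>(i+1)\<close>-st term,
  so that \<open>L\<close> is \<open>k\<close>-step nilpotent iff \<open>lower_central L k\<close> is zero.\<close>

primrec lower_central :: "('k::field, 'a) module \<Rightarrow> nat \<Rightarrow> 'a set" where
  "lower_central L 0 = carrier L"
| "lower_central L (Suc i) =
     lspan L {x \<otimes>\<^bsub>L\<^esub> y | x y. x \<in> carrier L \<and> y \<in> lower_central L i}"


section \<open>Free Lie algebras\<close>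

datatype (letters: 'v) magma = Gen 'v | Prod "'v magma" "'v magma"

primrec multideg :: "'v magma \<Rightarrow> 'v multiset" where
  "multideg (Gen v) = {#v#}"
| "multideg (Prod s t) = multideg s + multideg t"

primrec eval_magma :: "('k, 'a) module \<Rightarrow> ('v \<Rightarrow> 'a) \<Rightarrow> 'v magma \<Rightarrow> 'a" where
  "eval_magma L e (Gen v) = e v"
| "eval_magma L e (Prod s t) = eval_magma L e s \<otimes>\<^bsub>L\<^esub> eval_magma L e t"

text \<open>The free nonassociative algebra on \<open>V\<close>: formal \<open>'k\<close>-linear combinations of elements of the
  free magma on \<open>V\<close>.  Since \<^const>\<open>Prod\<close> is injective, the coefficient of \<open>Prod s t\<close> in a
  product \<open>f g\<close> is \<open>f s * g t\<close>.\<close>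

definition free_alg :: "'v set \<Rightarrow> ('k::field, 'v magma \<Rightarrow> 'k) module" where
  "free_alg V = \<lparr>carrier = {f. finite {t. f t \<noteq> 0} \<and> (\<forall>t. f t \<noteq> 0 \<longrightarrow> letters t \<subseteq> V)},
     mult = (\<lambda>f g t. case t of Gen v \<Rightarrow> 0 | Prod r s \<Rightarrow> f r * g s),
     one = (\<lambda>_. 0), zero = (\<lambda>_. 0), add = (\<lambda>f g t. f t + g t), smult = (\<lambda>c f t. c * f t)\<rparr>"

definition lie_relators :: "'v set \<Rightarrow> ('v magma \<Rightarrow> 'k::field) set" where
  "lie_relators V = (let A = free_alg V in
     {x \<otimes>\<^bsub>A\<^esub> x | x. x \<in> carrier A} \<union>
     {(x \<otimes>\<^bsub>A\<^esub> y) \<otimes>\<^bsub>A\<^esub> z \<oplus>\<^bsub>A\<^esub> (y \<otimes>\<^bsub>A\<^esub> z) \<otimes>\<^bsub>A\<^esub> x \<oplus>\<^bsub>A\<^esub> (z \<otimes>\<^bsub>A\<^esub> x) \<otimes>\<^bsub>A\<^esub> y | x y z.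
        x \<in> carrier A \<and> y \<in> carrier A \<and> z \<in> carrier A})"

definition free_lie :: "'v set \<Rightarrow> ('k::field, ('v magma \<Rightarrow> 'k) set) module" where
  "free_lie V = quot_alg (free_alg V) (ideal_gen (free_alg V) (lie_relators V))"

definition free_lie_gen :: "'v set \<Rightarrow> 'v \<Rightarrow> ('v magma \<Rightarrow> 'k::field) set" where
  "free_lie_gen V v =
     ideal_gen (free_alg V) (lie_relators V) +>\<^bsub>free_alg V\<^esub> (\<lambda>t. if t = Gen v then 1 else 0)"

text \<open>The free \<open>k\<close>-step nilpotent Lie algebra on \<open>V\<close>.\<close>

definition free_nilp :: "nat \<Rightarrow> 'v set \<Rightarrow> ('k::field, ('v magma \<Rightarrow> 'k) set set) module" where
  "free_nilp k V = quot_alg (free_lie V) (lower_central (free_lie V) k)"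

definition free_nilp_gen :: "nat \<Rightarrow> 'v set \<Rightarrow> 'v \<Rightarrow> ('v magma \<Rightarrow> 'k::field) set set" where
  "free_nilp_gen k V v = lower_central (free_lie V) k +>\<^bsub>free_lie V\<^esub> free_lie_gen V v"


section \<open>Chain digraphs and their Lie algebras\<close>

definition oriented_digraph :: "'v pair_pre_digraph \<Rightarrow> bool" where
  "oriented_digraph G \<longleftrightarrow> pair_fin_digraph G \<and>
     (\<forall>u v. (u, v) \<in> parcs G \<longrightarrow> (v, u) \<notin> parcs G)"

definition chain_digraph :: "('v \<times> 'v \<Rightarrow> nat) \<Rightarrow> 'v pair_pre_digraph \<Rightarrow> bool" where
  "chain_digraph \<kappa> G \<longleftrightarrow> oriented_digraph G \<and> (\<forall>e\<in>parcs G. 2 \<le> \<kappa> e)"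

definition non_edges :: "'v pair_pre_digraph \<Rightarrow> ('v \<times> 'v) set" where
  "non_edges G = {(u, v). u \<in> pverts G \<and> v \<in> pverts G \<and> (u, v) \<notin> parcs G \<and> (v, u) \<notin> parcs G}"

definition graph_ideal :: "nat \<Rightarrow> 'v pair_pre_digraph \<Rightarrow> ('v magma \<Rightarrow> 'k::field) set set set" where
  "graph_ideal k G = ideal_gen (free_nilp k (pverts G))
     ((\<lambda>(u, v). free_nilp_gen k (pverts G) u \<otimes>\<^bsub>free_nilp k (pverts G)\<^esub> free_nilp_gen k (pverts G) v)
        ` non_edges G)"

definition graph_lie ::
    "nat \<Rightarrow> 'v pair_pre_digraph \<Rightarrow> ('k::field, ('v magma \<Rightarrow> 'k) set set set) module" where
  "graph_lie k G = quot_alg (free_nilp k (pverts G)) (graph_ideal k G)"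

definition graph_lie_gen ::
    "nat \<Rightarrow> 'v pair_pre_digraph \<Rightarrow> 'v \<Rightarrow> ('v magma \<Rightarrow> 'k::field) set set set" where
  "graph_lie_gen k G v = graph_ideal k G +>\<^bsub>free_nilp k (pverts G)\<^esub> free_nilp_gen k (pverts G) v"

text \<open>The component of multidegree \<open>\<delta>\<close>.  A multidegree is a multiset of vertices: the unit vector
  \<open>e\<^sub>i\<close> is \<open>{#v\<^sub>i#}\<close> and the total degree is the size.\<close>

definition graph_comp ::
    "nat \<Rightarrow> 'v pair_pre_digraph \<Rightarrow> 'v multiset \<Rightarrow> ('v magma \<Rightarrow> 'k::field) set set set set" where
  "graph_comp k G \<delta> = lspan (graph_lie k G)
     {eval_magma (graph_lie k G) (graph_lie_gen k G) t | t. letters t \<subseteq> pverts G \<and> multideg t = \<delta>}"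

definition sum_comps ::
    "nat \<Rightarrow> 'v pair_pre_digraph \<Rightarrow> 'v multiset set \<Rightarrow> ('v magma \<Rightarrow> 'k::field) set set set set" where
  "sum_comps k G D = lspan (graph_lie k G) (\<Union>\<delta>\<in>D. graph_comp k G \<delta>)"

definition chain_degs :: "'v \<Rightarrow> 'v \<Rightarrow> nat \<Rightarrow> 'v multiset set" where
  "chain_degs i j c = {{#j#}} \<union> {{#i#} + replicate_mset (l - 1) j | l. 1 \<le> l \<and> l \<le> c}"

definition edge_ideal :: "nat \<Rightarrow> 'v pair_pre_digraph \<Rightarrow> 'v \<Rightarrow> 'v \<Rightarrow> nat \<Rightarrow>
    ('v magma \<Rightarrow> 'k::field) set set set set" where
  "edge_ideal k G i j c = sum_comps k G (- chain_degs i j c)"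

text \<open>The step is the maximum of \<open>\<kappa>\<close>.  The value 1 for a graph without edges makes
  \<open>chain_lie \<kappa> G\<close> the abelian Lie algebra with basis the vertices, as required in this case.\<close>

definition chain_step :: "('v \<times> 'v \<Rightarrow> nat) \<Rightarrow> 'v pair_pre_digraph \<Rightarrow> nat" where
  "chain_step \<kappa> G = (if parcs G = {} then 1 else Max (\<kappa> ` parcs G))"

definition chain_ideal :: "('v \<times> 'v \<Rightarrow> nat) \<Rightarrow> 'v pair_pre_digraph \<Rightarrow>
    ('v magma \<Rightarrow> 'k::field) set set set set" where
  "chain_ideal \<kappa> G = (\<Inter>(i, j)\<in>parcs G. edge_ideal (chain_step \<kappa> G) G i j (\<kappa> (i, j)))
     \<inter> sum_comps (chain_step \<kappa> G) G {\<delta>. 3 \<le> size \<delta> \<and> size \<delta> \<le> chain_step \<kappa> G}"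

type_synonym ('k, 'v) chain_elt = "('v magma \<Rightarrow> 'k) set set set set"

definition chain_lie ::
    "('v \<times> 'v \<Rightarrow> nat) \<Rightarrow> 'v pair_pre_digraph \<Rightarrow> ('k::field, ('k, 'v) chain_elt) module" where
  "chain_lie \<kappa> G = quot_alg (graph_lie (chain_step \<kappa> G) G) (chain_ideal \<kappa> G)"

definition chain_gen ::
    "('v \<times> 'v \<Rightarrow> nat) \<Rightarrow> 'v pair_pre_digraph \<Rightarrow> 'v \<Rightarrow> ('k::field, 'v) chain_elt" where
  "chain_gen \<kappa> G v =
     chain_ideal \<kappa> G +>\<^bsub>graph_lie (chain_step \<kappa> G) G\<^esub> graph_lie_gen (chain_step \<kappa> G) G v"

text \<open>\<open>chain_w \<kappa> G i j l\<close> is \<open>w\<^sub>i\<^sub>j\<^sup>l\<close>, for \<open>l \<ge> 1\<close>.\<close>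

definition chain_w ::
    "('v \<times> 'v \<Rightarrow> nat) \<Rightarrow> 'v pair_pre_digraph \<Rightarrow> 'v \<Rightarrow> 'v \<Rightarrow> nat \<Rightarrow> ('k::field, 'v) chain_elt" where
  "chain_w \<kappa> G i j l = ((\<lambda>x. x \<otimes>\<^bsub>chain_lie \<kappa> G\<^esub> chain_gen \<kappa> G j) ^^ (l - 1)) (chain_gen \<kappa> G i)"

definition standard_basis ::
    "('v \<times> 'v \<Rightarrow> nat) \<Rightarrow> 'v pair_pre_digraph \<Rightarrow> ('k::field, 'v) chain_elt set" where
  "standard_basis \<kappa> G = chain_gen \<kappa> G ` pverts G \<union>
     {chain_w \<kappa> G i j l | i j l. (i, j) \<in> parcs G \<and> 2 \<le> l \<and> l \<le> \<kappa> (i, j)}"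


section \<open>Rooted trees\<close>

text \<open>\<^const>\<open>tree\<close> and \<^const>\<open>forest\<close> of the graph library only exclude directed cycles, so
  acyclicity of the underlying undirected graph is spelled out.  In a symmetrised oriented
  digraph the cycles of length 2 are those that traverse an edge back and forth.\<close>

definition undirected_tree :: "'v pair_pre_digraph \<Rightarrow> bool" where
  "undirected_tree T \<longleftrightarrow> connected (with_proj T) \<and>
     \<not> (\<exists>p. pre_digraph.cycle (with_proj (mk_symmetric (with_proj T))) p \<and> 3 \<le> length p)"

definition rooted_tree :: "'v pair_pre_digraph \<Rightarrow> 'v \<Rightarrow> bool" where
  "rooted_tree T r \<longleftrightarrow> oriented_digraph T \<and> undirected_tree T \<and> r \<in> pverts T \<and>
     (\<forall>u\<in>pverts T. u \<rightarrow>\<^sup>*\<^bsub>with_proj T\<^esub> r)"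

definition two_rooted_trees :: "'v pair_pre_digraph \<Rightarrow> 'v \<Rightarrow> 'v \<Rightarrow> bool" where
  "two_rooted_trees G r\<^sub>1 r\<^sub>2 \<longleftrightarrow> (\<exists>T\<^sub>1 T\<^sub>2. rooted_tree T\<^sub>1 r\<^sub>1 \<and> rooted_tree T\<^sub>2 r\<^sub>2 \<and>
     pverts T\<^sub>1 \<inter> pverts T\<^sub>2 = {} \<and>
     G = \<lparr>pverts = pverts T\<^sub>1 \<union> pverts T\<^sub>2, parcs = parcs T\<^sub>1 \<union> parcs T\<^sub>2\<rparr>)"

definition family_F1 :: "('v \<times> 'v \<Rightarrow> nat) \<Rightarrow> 'v pair_pre_digraph \<Rightarrow> bool" where
  "family_F1 \<kappa> G \<longleftrightarrow> chain_digraph \<kappa> G \<and> (\<exists>r\<^sub>1 r\<^sub>2. two_rooted_trees G r\<^sub>1 r\<^sub>2) \<and>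
     (\<forall>e\<in>parcs G. even (\<kappa> e))"


section \<open>Exterior forms and symplectic forms\<close>

text \<open>Elements of \<open>\<Lambda>\<^sup>p L\<^sup>*\<close> are represented as alternating \<open>p\<close>-linear forms.  The arguments are
  passed as a sequence \<open>x :: nat \<Rightarrow> 'a\<close> of which only \<open>x 0, \<dots>, x (p - 1)\<close> matter.\<close>

definition dual_space :: "('k::field, 'a) module \<Rightarrow> ('a \<Rightarrow> 'k) set" where
  "dual_space L = {f. (\<forall>x\<in>carrier L. \<forall>y\<in>carrier L. f (x \<oplus>\<^bsub>L\<^esub> y) = f x + f y) \<and>
     (\<forall>c. \<forall>x\<in>carrier L. f (c \<odot>\<^bsub>L\<^esub> x) = c * f x)}"

definition alt_forms :: "('k::field, 'a) module \<Rightarrow> nat \<Rightarrow> ((nat \<Rightarrow> 'a) \<Rightarrow> 'k) set" where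
  "alt_forms L p = {\<omega>.
     (\<forall>x y. (\<forall>i<p. x i = y i) \<longrightarrow> \<omega> x = \<omega> y) \<and>
     (\<forall>x. range x \<subseteq> carrier L \<longrightarrow>
        (\<forall>i<p. (\<lambda>u. \<omega> (x(i := u))) \<in> dual_space L) \<and>
        (\<forall>i<p. \<forall>j<p. i \<noteq> j \<and> x i = x j \<longrightarrow> \<omega> x = 0))}"

definition one_form :: "('a \<Rightarrow> 'k) \<Rightarrow> (nat \<Rightarrow> 'a) \<Rightarrow> 'k" where
  "one_form f x = f (x 0)"

definition wedge :: "nat \<Rightarrow> nat \<Rightarrow> ((nat \<Rightarrow> 'a) \<Rightarrow> 'k) \<Rightarrow> ((nat \<Rightarrow> 'a) \<Rightarrow> 'k) \<Rightarrow>
    (nat \<Rightarrow> 'a) \<Rightarrow> 'k::field_char_0" where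
  "wedge p q \<alpha> \<beta> x = 1 / (fact p * fact q) *
     (\<Sum>\<pi> | \<pi> permutes {..<p + q}. of_int (sign \<pi>) * \<alpha> (\<lambda>i. x (\<pi> i)) * \<beta> (\<lambda>i. x (\<pi> (p + i))))"

primrec wedge_power :: "((nat \<Rightarrow> 'a) \<Rightarrow> 'k) \<Rightarrow> nat \<Rightarrow> (nat \<Rightarrow> 'a) \<Rightarrow> 'k::field_char_0" where
  "wedge_power \<omega> 0 = (\<lambda>x. 1)"
| "wedge_power \<omega> (Suc n) = wedge 2 (2 * n) \<omega> (wedge_power \<omega> n)"

text \<open>The differential on \<open>L\<^sup>*\<close> (the dual of the bracket, without a sign) and on \<open>\<Lambda>\<^sup>2 L\<^sup>*\<close>.
  The latter is the linear map determined by
  \<open>d (\<alpha> \<and> \<beta>) = d\<alpha> \<and> \<beta> - \<alpha> \<and> d\<beta>\<close>; see \<open>diff2_wedge\<close> below.\<close>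

definition diff1 :: "('k::field, 'a) module \<Rightarrow> ('a \<Rightarrow> 'k) \<Rightarrow> (nat \<Rightarrow> 'a) \<Rightarrow> 'k" where
  "diff1 L f x = f (x 0 \<otimes>\<^bsub>L\<^esub> x 1)"

definition diff2 :: "('k::field, 'a) module \<Rightarrow> ((nat \<Rightarrow> 'a) \<Rightarrow> 'k) \<Rightarrow> (nat \<Rightarrow> 'a) \<Rightarrow> 'k" where
  "diff2 L \<omega> x = (let \<omega>' = (\<lambda>u v. \<omega> (\<lambda>i. if i = 0 then u else v)) in
     \<omega>' (x 0 \<otimes>\<^bsub>L\<^esub> x 1) (x 2) + \<omega>' (x 1 \<otimes>\<^bsub>L\<^esub> x 2) (x 0) + \<omega>' (x 2 \<otimes>\<^bsub>L\<^esub> x 0) (x 1))"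

lemma wedge_1_1:
  "wedge 1 1 (one_form f) (one_form g) x = f (x 0) * g (x 1) - f (x 1) * g (x 0)"
proof -
  have A: "{..<2::nat} = {0, 1}" by auto
  have n0: "0 \<notin> {1::nat}" and n1: "1 \<notin> ({}::nat set)" by auto
  show ?thesis
    unfolding wedge_def one_form_def one_add_one A
      sum_over_permutations_insert[OF finite.insertI[OF finite.emptyI] n0]
      sum_over_permutations_insert[OF finite.emptyI n1]
    by (simp add: permutation_swap_id sign_compose sign_id sign_swap_id transpose_def)
qed

lemma sum_permutes_3:
  fixes F :: "(nat \<Rightarrow> nat) \<Rightarrow> 'b::comm_monoid_add"
  shows "(\<Sum>\<pi> | \<pi> permutes {..<3}. F \<pi>) =
    F id + F (transpose 1 2) + F (transpose 0 1) + F (transpose 0 1 \<circ> transpose 1 2) +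
    F (transpose 0 2) + F (transpose 0 2 \<circ> transpose 1 2)"
proof -
  have A: "{..<3::nat} = {0, 1, 2}" by auto
  have n0: "0 \<notin> {1, 2::nat}" and n1: "1 \<notin> {2::nat}" and n2: "2 \<notin> ({}::nat set)" by auto
  show ?thesis
    unfolding A sum_over_permutations_insert[OF finite.insertI[OF finite.insertI[OF finite.emptyI]] n0]
      sum_over_permutations_insert[OF finite.insertI[OF finite.emptyI] n1]
      sum_over_permutations_insert[OF finite.emptyI n2]
    by (simp add: ac_simps)
qed

lemma (in lie_algebra) dual_bracket_antisym:
  assumes f: "f \<in> dual_space L" and x: "x \<in> carrier L" and y: "y \<in> carrier L"
  shows "f (y \<otimes> x) = - f (x \<otimes> y)"
proof -
  note c = bracket_closed
  have add: "f (u \<oplus> v) = f u + f v" if "u \<in> carrier L" "v \<in> carrier L" for u v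
    using f that by (auto simp: dual_space_def)
  have "\<zero> \<oplus> \<zero> = \<zero>" by simp
  with add[of "\<zero>" "\<zero>"] have z: "f \<zero> = 0" by (metis M.zero_closed add_cancel_left_left)
  have "\<zero> = (x \<oplus> y) \<otimes> (x \<oplus> y)" using x y by (simp add: bracket_self)
  also have "\<dots> = (x \<otimes> x \<oplus> y \<otimes> x) \<oplus> (x \<otimes> y \<oplus> y \<otimes> y)"
    using x y by (simp add: bracket_add_left bracket_add_right)
  finally have "f \<zero> = f ((x \<otimes> x \<oplus> y \<otimes> x) \<oplus> (x \<otimes> y \<oplus> y \<otimes> y))" by simp
  also have "\<dots> = f (y \<otimes> x) + f (x \<otimes> y)"
    using x y by (simp add: add c bracket_self z)
  finally show ?thesis using z by (simp add: eq_neg_iff_add_eq_0)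
qed

lemma diff2_wedge:
  fixes L :: "('k::field_char_0, 'a) module"
  assumes "lie_algebra L" and f: "f \<in> dual_space L" and g: "g \<in> dual_space L"
    and x: "range x \<subseteq> carrier L"
  shows "diff2 L (wedge 1 1 (one_form f) (one_form g)) x =
    wedge 2 1 (diff1 L f) (one_form g) x - wedge 1 2 (one_form f) (diff1 L g) x"
proof -
  interpret lie_algebra L by fact
  have xc: "x i \<in> carrier L" for i using x by auto
  have anti: "h (x 1 \<otimes>\<^bsub>L\<^esub> x 0) = - h (x 0 \<otimes>\<^bsub>L\<^esub> x 1)" "h (x 2 \<otimes>\<^bsub>L\<^esub> x 0) = - h (x 0 \<otimes>\<^bsub>L\<^esub> x 2)"
    "h (x 2 \<otimes>\<^bsub>L\<^esub> x 1) = - h (x 1 \<otimes>\<^bsub>L\<^esub> x 2)" if "h \<in> dual_space L" for h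
    by (rule dual_bracket_antisym[OF that xc xc])+
  have s: "sign (transpose (0::nat) 1) = -1" "sign (transpose (1::nat) 2) = -1"
    "sign (transpose (0::nat) 2) = -1"
    "sign (transpose (0::nat) 1 \<circ> transpose 1 2) = 1" "sign (transpose (0::nat) 2 \<circ> transpose 1 2) = 1"
    by (auto simp: sign_swap_id sign_compose permutation_swap_id)
  have t: "2 + 1 = (3::nat)" "1 + 2 = (3::nat)" by auto
  have L: "wedge 2 1 (diff1 L f) (one_form g) x =
      f (x 0 \<otimes>\<^bsub>L\<^esub> x 1) * g (x 2) + f (x 1 \<otimes>\<^bsub>L\<^esub> x 2) * g (x 0) + f (x 2 \<otimes>\<^bsub>L\<^esub> x 0) * g (x 1)"
    unfolding wedge_def t sum_permutes_3 s diff1_def one_form_def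
    by (simp add: transpose_def anti[OF f, simplified] numeral_2_eq_2[symmetric] field_simps)
  have R: "wedge 1 2 (one_form f) (diff1 L g) x =
      f (x 0) * g (x 1 \<otimes>\<^bsub>L\<^esub> x 2) + f (x 1) * g (x 2 \<otimes>\<^bsub>L\<^esub> x 0) + f (x 2) * g (x 0 \<otimes>\<^bsub>L\<^esub> x 1)"
    unfolding wedge_def t sum_permutes_3 s diff1_def one_form_def
    by (simp add: transpose_def anti[OF g, simplified] numeral_2_eq_2[symmetric] field_simps)
  show ?thesis
    unfolding L R diff2_def Let_def wedge_1_1 by (simp add: algebra_simps)
qed

definition symplectic_form ::
    "('k::field_char_0, 'a) module \<Rightarrow> ((nat \<Rightarrow> 'a) \<Rightarrow> 'k) \<Rightarrow> bool" where
  "symplectic_form L \<omega> \<longleftrightarrow> lie_algebra L \<and> vectorspace.fin_dim class_ring L \<and>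
     \<omega> \<in> alt_forms L 2 \<and> (\<forall>x. range x \<subseteq> carrier L \<longrightarrow> diff2 L \<omega> x = 0) \<and>
     (\<exists>n. vectorspace.dim class_ring L = 2 * n \<and>
        (\<exists>x. range x \<subseteq> carrier L \<and> wedge_power \<omega> n x \<noteq> 0))"

definition symplectic :: "('k::field_char_0, 'a) module \<Rightarrow> bool" where
  "symplectic L \<longleftrightarrow> (\<exists>\<omega>. symplectic_form L \<omega>)"

text \<open>The element \<open>b\<^sup>*\<close> of the basis dual to \<open>B\<close>, as a 1-form.  When \<open>B\<close> is a basis the functional
  is unique on \<open>carrier L\<close>.\<close>

definition dual_elt :: "('k::field, 'a) module \<Rightarrow> 'a set \<Rightarrow> 'a \<Rightarrow> (nat \<Rightarrow> 'a) \<Rightarrow> 'k" where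
  "dual_elt L B b =
     one_form (SOME f. f \<in> dual_space L \<and> (\<forall>b'\<in>B. f b' = (if b' = b then 1 else 0)))"

abbreviation chain_dual :: "('v \<times> 'v \<Rightarrow> nat) \<Rightarrow> 'v pair_pre_digraph \<Rightarrow> ('k::field, 'v) chain_elt \<Rightarrow>
    (nat \<Rightarrow> ('k, 'v) chain_elt) \<Rightarrow> 'k" where
  "chain_dual \<kappa> G \<equiv> dual_elt (chain_lie \<kappa> G) (standard_basis \<kappa> G)"

definition sigma_edge :: "('v \<times> 'v \<Rightarrow> nat) \<Rightarrow> 'v pair_pre_digraph \<Rightarrow> 'v \<Rightarrow> 'v \<Rightarrow>
    (nat \<Rightarrow> ('k::field_char_0, 'v) chain_elt) \<Rightarrow> 'k" where
  "sigma_edge \<kappa> G i j x = (\<Sum>l = 1..\<kappa> (i, j) div 2. (-1) ^ (l + 1) *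
     wedge 1 1 (chain_dual \<kappa> G (chain_w \<kappa> G i j l))
       (chain_dual \<kappa> G (chain_w \<kappa> G i j (\<kappa> (i, j) + 1 - l))) x)"

definition sigma :: "('v \<times> 'v \<Rightarrow> nat) \<Rightarrow> 'v pair_pre_digraph \<Rightarrow> 'v \<Rightarrow> 'v \<Rightarrow>
    (nat \<Rightarrow> ('k::field_char_0, 'v) chain_elt) \<Rightarrow> 'k" where
  "sigma \<kappa> G r\<^sub>1 r\<^sub>2 x =
     wedge 1 1 (chain_dual \<kappa> G (chain_gen \<kappa> G r\<^sub>1)) (chain_dual \<kappa> G (chain_gen \<kappa> G r\<^sub>2)) x +
     (\<Sum>(i, j)\<in>parcs G. sigma_edge \<kappa> G i j x)"

end

theory Submission
  imports Defs
begin

text \<open>The proof never determines the graph algebra \<open>\<gg>(k, G)\<close> in full; it only compares it with very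
small Lie algebras.  Let \<open>F\<^sub>c\<close> be the filiform algebra with basis \<open>y, x\<^sub>1, \<dots>, x\<^sub>c\<close> and
\<open>[x\<^sub>l, y] = x\<^sub>l\<^sub>+\<^sub>1\<close> for \<open>l < c\<close>.  For an arc \<open>(i, j)\<close> put \<open>c = \<kappa>\<^sub>i\<^sub>j\<close> and send \<open>v\<^sub>i\<close> to \<open>x\<^sub>1\<close>, \<open>v\<^sub>j\<close> to \<open>y\<close>
and all other vertices to 0.  This assignment respects every relation that is imposed on the way
from the free nonassociative algebra to \<open>\<gg>(\<kappa>, G)\<close>, so it extends to a homomorphism
\<open>\<gg>(\<kappa>, G) \<rightarrow> F\<^sub>c\<close>.  Its coordinate functions are the dual basis elements \<open>(w\<^sub>i\<^sub>j\<^sup>l)\<^sup>*\<close>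
(and \<open>v\<^sub>j\<^sup>*\<close>); a homomorphism to an abelian algebra gives \<open>v\<^sup>*\<close> for a vertex \<open>v\<close>.  Hence the
standard basis is independent.  That it spans is a computation with monomials in the generators:
a monomial of degree at least 3 either has the multidegree of some \<open>w\<^sub>i\<^sub>j\<^sup>l\<close>, and then is a multiple
of it (\<open>eval_magma_chain\<close>), or it vanishes in \<open>\<gg>(\<kappa>, G)\<close>
(\<open>basis_spans\<close>).

Since each \<open>\<sigma>\<^sub>i\<^sub>j\<close> is the pullback of one 2-form on \<open>F\<^sub>c\<close>, closedness is a statement
about \<open>F\<^sub>c\<close>.  There \<open>d\<close> of the \<open>l\<close>-th summand is \<open>(-1)\<^sup>l\<^sup>+\<^sup>1 (U\<^sub>l\<^sub>-\<^sub>1 + U\<^sub>l)\<close> with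
\<open>U\<^sub>l = x\<^sub>l\<^sup>* \<and> y\<^sup>* \<and> x\<^sub>c\<^sub>-\<^sub>l\<^sup>*\<close> and \<open>x\<^sub>0\<^sup>* = 0\<close>.  For even \<open>c\<close> the sum telescopes to \<open>U\<^sub>0 = 0\<close> and to \<open>U\<^sub>c\<^sub>/\<^sub>2\<close>,
which is 0 because its two outer factors agree (\<open>chain_form_closed\<close>).

Nondegeneracy is where the trees enter.  In a tree directed to its root, every vertex but the root
has exactly one outgoing arc (\<open>rooted_tree_arcs\<close>), so apart from the two roots the vertices are
precisely the elements \<open>w\<^sub>i\<^sub>j\<^sup>1\<close>, one for each arc.  Therefore \<open>\<sigma>\<^sub>G\<close> pairs off the standard basis:
the two roots with each other, and \<open>w\<^sub>i\<^sub>j\<^sup>l\<close> with \<open>w\<^sub>i\<^sub>j\<^sup>c\<^sup>+\<^sup>1\<^sup>-\<^sup>l\<close>.  A 2-form that pairs off a basis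
has a nonzero top power (\<open>wedge_power_symplectic_basis\<close>, \<open>symplectic_form_of_pairing\<close>).\<close>

section \<open>Powers of a 2-form on a symplectic basis\<close>

lemma even_or_odd_of_pair:
  fixes a b :: nat
  assumes "a div 2 = b div 2" and "a \<noteq> b"
  obtains "even a" "odd b" "a = 2 * (a div 2)" "b = 2 * (a div 2) + 1"
  | "odd a" "even b" "a = 2 * (a div 2) + 1" "b = 2 * (a div 2)"
proof (cases "even a")
  case True
  moreover from this have "odd b" using assms by presburger
  ultimately show ?thesis using assms(1) by (intro that(1)) auto
next
  case False
  then have "even b" using assms by presburger
  have "a = 2 * (a div 2) + 1" "b = 2 * (a div 2)" using assms \<open>odd a\<close> by presburger+
  then show ?thesis using False \<open>even b\<close> by (intro that(2))
qed

text \<open>A permutation of the blocks \<open>{2i, 2i+1}\<close> alone is even, since every transposition of blocks is a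
product of two transpositions.  So the sign only counts the blocks that are reversed, which are
those whose first element lands on an odd number.  The induction moves the last block back to its
place by such an even permutation \<open>\<theta>\<close>, which also preserves parities, and then straightens it by
\<open>\<tau>\<close>.\<close>

lemma sign_pair_permutation:
  assumes "\<pi> permutes {..<2 * n}" and "\<forall>i<n. \<pi> (2 * i) div 2 = \<pi> (2 * i + 1) div 2"
  shows "sign \<pi> = (\<Prod>i<n. (-1) ^ \<pi> (2 * i))"
  using assms
proof (induction n arbitrary: \<pi>)
  case 0
  then show ?case by simp
next
  case (Suc n)
  note per = Suc.prems(1) and pair = Suc.prems(2)
  have inj: "inj \<pi>" using per by (rule permutes_inj)
  have lt: "\<pi> x < 2 * n + 2 \<longleftrightarrow> x < 2 * n + 2" for x
    using permutes_in_image[OF per, of x] by simp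
  define s where "s = \<pi> (2 * n) div 2"
  have s: "s \<le> n" using lt[of "2 * n"] by (simp add: s_def)
  define \<theta> where "\<theta> = transpose (2 * s) (2 * n) \<circ> transpose (2 * s + 1) (2 * n + 1)"
  have \<theta>_per: "\<theta> permutes {..<2 * Suc n}"
    unfolding \<theta>_def using s by (intro permutes_compose permutes_swap_id) auto
  have \<theta>_sign: "sign \<theta> = 1"
    unfolding \<theta>_def by (subst sign_compose) (auto simp: sign_swap_id permutation_swap_id)
  have \<theta>_val: "\<theta> x = (if x div 2 = s then 2 * n + x mod 2 else
      if x div 2 = n then 2 * s + x mod 2 else x)" for x
  proof -
    obtain q where "x = 2 * q \<or> x = Suc (2 * q)" by (metis evenE oddE Suc_eq_plus1)
    then show ?thesis
      by (auto simp: \<theta>_def transpose_def double_not_eq_Suc_double Suc_double_not_eq_double)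
  qed
  define \<tau> where "\<tau> = (if even (\<pi> (2 * n)) then id else transpose (2 * n) (2 * n + 1))"
  have \<tau>_per: "\<tau> permutes {..<2 * Suc n}"
    unfolding \<tau>_def by (auto intro!: permutes_swap_id simp: permutes_id)
  have \<tau>_sign: "sign \<tau> = (-1) ^ \<pi> (2 * n)"
    unfolding \<tau>_def by (auto simp: sign_swap_id)
  define \<rho> where "\<rho> = \<tau> \<circ> (\<theta> \<circ> \<pi>)"
  have \<rho>_per: "\<rho> permutes {..<2 * Suc n}"
    unfolding \<rho>_def using per \<theta>_per \<tau>_per by (intro permutes_compose)
  have fin: "finite {..<2 * Suc n}" by simp
  note pm = permutes_imp_permutation[OF fin]
  have \<rho>_sign: "sign \<rho> = (-1) ^ \<pi> (2 * n) * sign \<pi>"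
    unfolding \<rho>_def using per \<theta>_per \<tau>_per
    by (simp add: sign_compose pm permutes_compose \<theta>_sign \<tau>_sign)
  have pn: "\<pi> (2 * n + 1) div 2 = s" using pair s_def by auto
  have ne: "\<pi> (2 * n + 1) \<noteq> \<pi> (2 * n)" using injD[OF inj, of "2 * n + 1" "2 * n"] by auto
  have div2: "\<pi> (2 * n + 1) mod 2 \<noteq> \<pi> (2 * n) mod 2"
    using ne pn s_def by (metis div_mult_mod_eq)
  have f0: "\<rho> (2 * n) = 2 * n"
    by (auto simp: \<rho>_def \<theta>_val s_def[symmetric] \<tau>_def transpose_def mod_2_eq_odd)
  have f1: "\<rho> (2 * n + 1) = 2 * n + 1"
  proof -
    have "\<theta> (\<pi> (2 * n + 1)) = 2 * n + \<pi> (2 * n + 1) mod 2"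
      by (simp only: \<theta>_val pn if_True simp_thms)
    moreover have "even (\<pi> (2 * n + 1)) \<longleftrightarrow> odd (\<pi> (2 * n))"
    proof (rule even_or_odd_of_pair)
      show "\<pi> (2 * n + 1) div 2 = \<pi> (2 * n) div 2" using pn by (simp add: s_def)
    qed (use ne in auto)
    ultimately show ?thesis
      by (auto simp: \<rho>_def \<tau>_def transpose_def mod_2_eq_odd)
  qed
  have \<rho>_small: "\<rho> permutes {..<2 * n}"
  proof (rule permutes_superset[OF \<rho>_per])
    fix x assume "x \<in> {..<2 * Suc n} - {..<2 * n}"
    then have "x = 2 * n \<or> x = 2 * n + 1" by auto
    then show "\<rho> x = x" using f0 f1 by auto
  qed
  have notin: "\<pi> x div 2 \<noteq> s" if "x < 2 * n" for x
  proof
    assume a: "\<pi> x div 2 = s"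
    have mod2: "a mod 2 = b mod 2 \<or> a mod 2 = c mod 2" if "c mod 2 \<noteq> b mod 2" for a b c :: nat
      using that by (cases "even a"; cases "even b"; cases "even c") (simp_all add: mod_2_eq_odd)
    have eqI: "k = l" if "k div 2 = l div 2" "k mod 2 = l mod 2" for k l :: nat
      using that by (metis div_mult_mod_eq)
    have "\<pi> x div 2 = \<pi> (2 * n) div 2" "\<pi> x div 2 = \<pi> (2 * n + 1) div 2"
      using a pn by (simp_all only: s_def)
    with mod2[OF div2, of "\<pi> x"] have "\<pi> x = \<pi> (2 * n) \<or> \<pi> x = \<pi> (2 * n + 1)"
      using eqI by blast
    then show False
      using that injD[OF inj, of x "2 * n"] injD[OF inj, of x "2 * n + 1"] by auto
  qed
  have val: "\<rho> x = \<theta> (\<pi> x)" if "x < 2 * n" for x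
  proof -
    have "\<theta> (\<pi> x) div 2 \<noteq> n"
      using notin[OF that] by (auto simp: \<theta>_val)
    then have "\<theta> (\<pi> x) \<noteq> 2 * n" "\<theta> (\<pi> x) \<noteq> 2 * n + 1" by auto
    then show ?thesis by (simp add: \<rho>_def \<tau>_def transpose_def)
  qed
  have par: "even (\<rho> x) = even (\<pi> x)" if "x < 2 * n" for x
    by (simp add: val[OF that] \<theta>_val mod_2_eq_odd)
  have "sign \<rho> = (\<Prod>i<n. (-1) ^ \<rho> (2 * i))"
  proof (rule Suc.IH[OF \<rho>_small], intro allI impI)
    fix i assume "i < n"
    then have "\<pi> (2 * i) div 2 = \<pi> (2 * i + 1) div 2" using pair by auto
    then show "\<rho> (2 * i) div 2 = \<rho> (2 * i + 1) div 2"
      using \<open>i < n\<close> by (simp add: val \<theta>_val)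
  qed
  also have "\<dots> = (\<Prod>i<n. (-1) ^ \<pi> (2 * i))"
    by (rule prod.cong) (auto simp: minus_one_power_iff par)
  finally have prod: "(-1) ^ \<pi> (2 * n) * sign \<pi> = (\<Prod>i<n. (-1) ^ \<pi> (2 * i))"
    using \<rho>_sign by (simp only:)
  have "sign \<pi> = (-1) ^ \<pi> (2 * n) * ((-1) ^ \<pi> (2 * n) * sign \<pi>)"
    by (simp add: minus_one_power_iff)
  also have "\<dots> = (\<Prod>i<Suc n. (-1) ^ \<pi> (2 * i))"
    by (simp only: prod prod.lessThan_Suc) (rule mult.commute)
  finally show ?case .
qed

text \<open>The recursion for the power permutes the arguments anew in each step.  A permutation of the last
\<open>2n\<close> arguments can be absorbed into the outer one without changing signs, so all \<open>(2n)!\<close> of them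
contribute the same, and only the factor \<open>1/2\<close> of each step survives.\<close>

lemma wedge_power_eq_sum_permutations:
  fixes Q :: "'a \<Rightarrow> 'a \<Rightarrow> 'k::field_char_0"
  shows "wedge_power (\<lambda>x. Q (x 0) (x 1)) n x =
    (\<Sum>\<pi> | \<pi> permutes {..<2 * n}. of_int (sign \<pi>) * (\<Prod>i<n. Q (x (\<pi> (2 * i))) (x (\<pi> (2 * i + 1))))) / 2 ^ n"
proof (induction n arbitrary: x)
  case 0
  then show ?case by simp
next
  case (Suc n)
  let ?A = "{..<2 * n}" and ?B = "{..<2 * Suc n}"
  define F where "F \<pi> = of_int (sign \<pi>) * (\<Prod>i<Suc n. Q (x (\<pi> (2 * i))) (x (\<pi> (2 * i + 1))))" for \<pi>
  \<comment> \<open>The permutation \<open>\<rho>\<close>, acting on the last \<open>2n\<close> of \<open>2n + 2\<close> arguments.\<close>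
  define sh where "sh \<rho> = map_permutation ?A ((+) 2) \<rho>" for \<rho> :: "nat \<Rightarrow> nat"
  have sh: "sh \<rho> permutes ?B" "sign (sh \<rho>) = sign \<rho>" "sh \<rho> 0 = 0" "sh \<rho> (Suc 0) = Suc 0"
    "\<And>i. i < 2 * n \<Longrightarrow> sh \<rho> (2 + i) = 2 + \<rho> i"
    if \<rho>: "\<rho> permutes ?A" for \<rho>
  proof -
    have b: "bij_betw ((+) 2) ?A {2..<2 * Suc n}"
      by (rule bij_betwI[where g = "\<lambda>i. i - 2"]) auto
    have p: "sh \<rho> permutes {2..<2 * Suc n}" unfolding sh_def by (rule map_permutation_permutes[OF b \<rho>])
    show "sh \<rho> permutes ?B" by (rule permutes_subset[OF p]) auto
    show "sign (sh \<rho>) = sign \<rho>"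
      unfolding sh_def by (rule sign_map_permutation[OF _ \<rho>]) auto
    show "sh \<rho> 0 = 0" "sh \<rho> (Suc 0) = Suc 0" using p by (auto simp: permutes_not_in)
    show "sh \<rho> (2 + i) = 2 + \<rho> i" if "i < 2 * n" for i
      unfolding sh_def using map_permutation_apply[of "(+) 2" ?A i \<rho>] that by simp
  qed
  have F_eq: "of_int (sign \<pi>) * Q (x (\<pi> 0)) (x (\<pi> 1)) *
      (of_int (sign \<rho>) * (\<Prod>i<n. Q (x (\<pi> (2 + \<rho> (2 * i)))) (x (\<pi> (2 + \<rho> (2 * i + 1)))))) = F (\<pi> \<circ> sh \<rho>)"
    if \<pi>: "\<pi> permutes ?B" and \<rho>: "\<rho> permutes ?A" for \<pi> \<rho>
  proof -
    have sg: "sign (\<pi> \<circ> sh \<rho>) = sign \<pi> * sign \<rho>"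
      using sign_compose[OF permutes_imp_permutation[OF _ \<pi>] permutes_imp_permutation[OF _ sh(1)[OF \<rho>]]]
      by (simp add: sh(2)[OF \<rho>])
    have "(\<Prod>i<Suc n. Q (x ((\<pi> \<circ> sh \<rho>) (2 * i))) (x ((\<pi> \<circ> sh \<rho>) (2 * i + 1)))) =
      Q (x (\<pi> 0)) (x (\<pi> 1)) * (\<Prod>i<n. Q (x (\<pi> (2 + \<rho> (2 * i)))) (x (\<pi> (2 + \<rho> (2 * i + 1)))))"
    proof -
      have "sh \<rho> (2 * Suc i) = 2 + \<rho> (2 * i)" "sh \<rho> (2 * Suc i + 1) = 2 + \<rho> (2 * i + 1)"
        if "i < n" for i
        using sh(5)[OF \<rho>, of "2 * i"] sh(5)[OF \<rho>, of "2 * i + 1"] that by auto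
      then have "(\<Prod>i<n. Q (x (\<pi> (sh \<rho> (2 * Suc i)))) (x (\<pi> (sh \<rho> (2 * Suc i + 1))))) =
        (\<Prod>i<n. Q (x (\<pi> (2 + \<rho> (2 * i)))) (x (\<pi> (2 + \<rho> (2 * i + 1)))))"
        by (intro prod.cong) (simp_all only: lessThan_iff)
      then show ?thesis
        by (simp only: prod.lessThan_Suc_shift o_apply mult_0_right add_0 sh(3,4)[OF \<rho>] One_nat_def)
    qed
    then show ?thesis unfolding F_def sg by (simp only: of_int_mult mult_ac)
  qed
  have t: "2 + 2 * n = 2 * Suc n" by simp
  have IH: "wedge_power (\<lambda>x. Q (x 0) (x 1)) n (\<lambda>i. x (\<pi> (2 + i))) =
     (\<Sum>\<rho> | \<rho> permutes ?A. of_int (sign \<rho>) *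
       (\<Prod>i<n. Q (x (\<pi> (2 + \<rho> (2 * i)))) (x (\<pi> (2 + \<rho> (2 * i + 1)))))) / 2 ^ n" for \<pi>
    by (rule Suc.IH)
  have "wedge_power (\<lambda>x. Q (x 0) (x 1)) (Suc n) x = 1 / (fact 2 * fact (2 * n)) *
     (\<Sum>\<pi> | \<pi> permutes ?B. \<Sum>\<rho> | \<rho> permutes ?A. F (\<pi> \<circ> sh \<rho>) / 2 ^ n)"
    unfolding wedge_power.simps wedge_def t IH
    unfolding sum_divide_distrib sum_distrib_left
    by (intro arg_cong[where f = "(*) _"] sum.cong refl) (subst F_eq[symmetric]; simp)
  also have "\<dots> = 1 / (2 * fact (2 * n)) *
     (\<Sum>\<rho> | \<rho> permutes ?A. \<Sum>\<pi> | \<pi> permutes ?B. F (\<pi> \<circ> sh \<rho>) / 2 ^ n)"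
    by (subst sum.swap) simp
  also have "(\<Sum>\<rho> | \<rho> permutes ?A. \<Sum>\<pi> | \<pi> permutes ?B. F (\<pi> \<circ> sh \<rho>) / 2 ^ n) =
     (\<Sum>\<rho> | \<rho> permutes ?A. (\<Sum>\<pi> | \<pi> permutes ?B. F \<pi>) / 2 ^ n)"
  proof (rule sum.cong[OF refl])
    fix \<rho> assume "\<rho> \<in> {\<rho>. \<rho> permutes ?A}"
    then have "sh \<rho> permutes ?B" using sh(1) by simp
    from sum_permutations_compose_right[OF this, of F]
    show "(\<Sum>\<pi> | \<pi> permutes ?B. F (\<pi> \<circ> sh \<rho>) / 2 ^ n) = (\<Sum>\<pi> | \<pi> permutes ?B. F \<pi>) / 2 ^ n"
      by (simp add: sum_divide_distrib)
  qed
  also have "\<dots> = fact (2 * n) * ((\<Sum>\<pi> | \<pi> permutes ?B. F \<pi>) / 2 ^ n)"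
    by (simp add: card_permutations)
  finally show ?case by (simp add: F_def field_simps)
qed

text \<open>A permutation contributes only if it maps blocks to blocks.  By \<open>sign_pair_permutation\<close> its sign
then cancels against the signs that arise from reversed blocks, so all nonzero terms equal the one
of the identity, and in characteristic 0 they cannot cancel.\<close>

lemma wedge_power_symplectic_basis:
  fixes Q :: "'a \<Rightarrow> 'a \<Rightarrow> 'k::field_char_0"
  assumes zero: "\<And>a b. a < 2 * n \<Longrightarrow> b < 2 * n \<Longrightarrow> a div 2 \<noteq> b div 2 \<Longrightarrow> Q (x a) (x b) = 0"
    and skew: "\<And>i. i < n \<Longrightarrow> Q (x (2 * i + 1)) (x (2 * i)) = - Q (x (2 * i)) (x (2 * i + 1))"
    and nz: "\<And>i. i < n \<Longrightarrow> Q (x (2 * i)) (x (2 * i + 1)) \<noteq> 0"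
  shows "wedge_power (\<lambda>x. Q (x 0) (x 1)) n x \<noteq> 0"
proof -
  let ?P = "{\<pi>. \<pi> permutes {..<2 * n}}"
  define C where "C = (\<Prod>i<n. Q (x (2 * i)) (x (2 * i + 1)))"
  define H where "H = {\<pi> \<in> ?P. \<forall>i<n. \<pi> (2 * i) div 2 = \<pi> (2 * i + 1) div 2}"
  define F where "F \<pi> = of_int (sign \<pi>) * (\<Prod>i<n. Q (x (\<pi> (2 * i))) (x (\<pi> (2 * i + 1))))" for \<pi>
  have fin: "finite ?P" by (rule finite_permutations) simp
  have FH: "F \<pi> = C" if "\<pi> \<in> H" for \<pi>
  proof -
    have per: "\<pi> permutes {..<2 * n}" and pair: "\<forall>i<n. \<pi> (2 * i) div 2 = \<pi> (2 * i + 1) div 2"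
      using that by (auto simp: H_def)
    have inj: "inj \<pi>" using per by (rule permutes_inj)
    define s where "s i = \<pi> (2 * i) div 2" for i
    have lt: "\<pi> j < 2 * n" if "j < 2 * n" for j
      using permutes_in_image[OF per, of j] that by simp
    have s_lt: "s i < n" if "i < n" for i
      using lt[of "2 * i"] that by (simp add: s_def)
    have s_inj: "inj_on s {..<n}"
    proof (rule inj_onI, rule ccontr)
      fix i j assume ij: "i \<in> {..<n}" "j \<in> {..<n}" "s i = s j" "i \<noteq> j"
      then have "\<pi> (2 * j) div 2 = \<pi> (2 * i) div 2" "\<pi> (2 * i + 1) div 2 = \<pi> (2 * i) div 2"
        using pair by (auto simp: s_def)
      then have "\<pi> (2 * j) = \<pi> (2 * i) \<or> \<pi> (2 * j) = \<pi> (2 * i + 1) \<or> \<pi> (2 * i) = \<pi> (2 * i + 1)"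
        by (metis even_or_odd_of_pair)
      then have "2 * j = 2 * i \<or> 2 * j = 2 * i + 1 \<or> 2 * i = 2 * i + 1" using injD[OF inj] by blast
      then show False using ij(4) by presburger
    qed
    then have s_bij: "bij_betw s {..<n} {..<n}"
      using endo_inj_surj[of "{..<n}" s] s_lt by (auto simp: bij_betw_def)
    have pairval: "Q (x (\<pi> (2 * i))) (x (\<pi> (2 * i + 1))) =
       (-1) ^ \<pi> (2 * i) * Q (x (2 * s i)) (x (2 * s i + 1))" if "i < n" for i
    proof -
      have ne: "\<pi> (2 * i) \<noteq> \<pi> (2 * i + 1)" using injD[OF inj, of "2 * i" "2 * i + 1"] by auto
      have e: "\<pi> (2 * i + 1) div 2 = s i" using pair that by (auto simp: s_def)
      from e have e': "\<pi> (2 * i) div 2 = \<pi> (2 * i + 1) div 2" by (simp add: s_def)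
      from e' ne consider
          "even (\<pi> (2 * i))" "\<pi> (2 * i) = 2 * s i" "\<pi> (2 * i + 1) = 2 * s i + 1"
        | "odd (\<pi> (2 * i))" "\<pi> (2 * i) = 2 * s i + 1" "\<pi> (2 * i + 1) = 2 * s i"
        unfolding s_def by (rule even_or_odd_of_pair)
      then show ?thesis
      proof cases
        case 1
        show ?thesis unfolding 1(2,3) by simp
      next
        case 2
        show ?thesis unfolding 2(2,3) using skew[OF s_lt[OF that]] by simp
      qed
    qed
    have "F \<pi> = of_int (sign \<pi>) * (\<Prod>i<n. (-1) ^ \<pi> (2 * i)) * (\<Prod>i<n. Q (x (2 * s i)) (x (2 * s i + 1)))"
      unfolding F_def by (simp add: pairval prod.distrib del: One_nat_def add_Suc_right Suc_eq_plus1)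
    also have "(\<Prod>i<n. Q (x (2 * s i)) (x (2 * s i + 1))) = C"
      unfolding C_def by (rule prod.reindex_bij_betw[OF s_bij])
    also have "(\<Prod>i<n. (-1) ^ \<pi> (2 * i)) = (of_int (sign \<pi>) :: 'k)"
      unfolding sign_pair_permutation[OF per pair] by simp
    also have "of_int (sign \<pi>) * of_int (sign \<pi>) = (1 :: 'k)"
      by (metis of_int_1 of_int_mult sign_idempotent)
    finally show ?thesis by simp
  qed
  have FN: "F \<pi> = 0" if \<pi>: "\<pi> \<in> ?P - H" for \<pi>
  proof -
    have per: "\<pi> permutes {..<2 * n}" using \<pi> by auto
    obtain i where i: "i < n" "\<pi> (2 * i) div 2 \<noteq> \<pi> (2 * i + 1) div 2"
      using \<pi> by (auto simp: H_def)
    have "\<pi> (2 * i) < 2 * n" "\<pi> (2 * i + 1) < 2 * n"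
      using permutes_in_image[OF per, of "2 * i"] permutes_in_image[OF per, of "2 * i + 1"] i(1) by auto
    then have "Q (x (\<pi> (2 * i))) (x (\<pi> (2 * i + 1))) = 0" using zero i(2) by blast
    then show ?thesis using i(1) unfolding F_def by auto
  qed
  have "(\<Sum>\<pi>\<in>?P. F \<pi>) = (\<Sum>\<pi>\<in>H. F \<pi>)"
    using fin FN by (intro sum.mono_neutral_right) (auto simp: H_def)
  also have "\<dots> = of_nat (card H) * C" using FH by simp
  finally have eq: "wedge_power (\<lambda>x. Q (x 0) (x 1)) n x = of_nat (card H) * C / 2 ^ n"
    unfolding wedge_power_eq_sum_permutations F_def by simp
  have "id \<in> H" by (simp add: H_def permutes_id)
  moreover have "finite H" using fin by (simp add: H_def)
  ultimately have "card H \<noteq> 0" by auto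
  moreover have "C \<noteq> 0" using nz by (simp add: C_def)
  ultimately show ?thesis unfolding eq by simp
qed

section \<open>Arcs of a rooted tree\<close>

text \<open>A path from \<open>a\<close> to \<open>u\<close> in the underlying undirected graph that avoids the arc \<open>(u, a)\<close> closes up
with this arc to a cycle.  It is not one of the back-and-forth cycles because the path has at
least two steps.\<close>

lemma cycle_through_arc:
  assumes G: "oriented_digraph G" and arc: "(u, a) \<in> parcs G"
    and ret: "(a, u) \<in> ((parcs G - {(u, a)}) \<union> (parcs G - {(u, a)})\<inverse>)\<^sup>*"
  shows "\<exists>p. pre_digraph.cycle (with_proj (mk_symmetric (with_proj G))) p \<and> 3 \<le> length p"
proof -
  define S where "S = (parcs G - {(u, a)}) \<union> (parcs G - {(u, a)})\<inverse>"
  interpret G: pair_fin_digraph G using G by (simp add: oriented_digraph_def)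
  define H where "H = \<lparr>pverts = pverts G, parcs = S\<rparr>"
  interpret H: pair_wf_digraph H
    by unfold_locales (auto simp: H_def S_def dest: G.arc_fst_in_verts G.arc_snd_in_verts)
  have H_sel: "pverts H = pverts G" "parcs H = S" by (simp_all add: H_def)
  interpret M: pair_wf_digraph "mk_symmetric (with_proj G)" by (rule G.wellformed_mk_symmetric)
  have M_arcs: "parcs (mk_symmetric (with_proj G)) = parcs G \<union> (parcs G)\<inverse>"
    by (auto simp: parcs_mk_symmetric)
  have uv: "u \<in> pverts G" "a \<in> pverts G"
    using arc G.arc_fst_in_verts G.arc_snd_in_verts by fastforce+
  have "(a, u) \<in> rtrancl_on (pverts G) S"
    using ret[folded S_def]
  proof (induction rule: rtrancl_induct)
    case base
    show ?case using uv by auto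
  next
    case (step y z)
    have "z \<in> pverts G"
      using step.hyps(2) by (auto simp: S_def dest: G.arc_fst_in_verts G.arc_snd_in_verts)
    then show ?case using step by (meson rtrancl_on_into_rtrancl_on)
  qed
  then have "a \<rightarrow>\<^sup>*\<^bsub>with_proj H\<^esub> u" 
    by (simp add: reachable_def H_sel arcs_ends_def arc_to_ends_def)
  then obtain p where p: "H.apath a p u" using H.reachable_apath by blast
  then have w: "H.awalk a p u" and dist: "distinct (H.awalk_verts a p)"
    by (auto simp: H.apath_def)
  have cas: "pre_digraph.cas (with_proj X) x q y = H.cas x q y" for X x q y
    by (induction q arbitrary: x) (auto simp: pre_digraph.cas.simps)
  have verts: "pre_digraph.awalk_verts (with_proj X) x q = H.awalk_verts x q" for X x q
    by (induction q arbitrary: x) (auto simp: pre_digraph.awalk_verts.simps)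
  have sub: "set p \<subseteq> S" using w by (auto simp: H.awalk_def H_sel)
  have "M.awalk u ((u, a) # p) u"
    using w arc sub uv by (auto simp: M.awalk_def H.awalk_def M_arcs cas S_def H_sel)
  then have "M.cycle ((u, a) # p)"
    unfolding M.cycle_def verts using dist by (intro exI[of _ u]) auto
  moreover have "2 \<le> length p"
  proof (rule ccontr)
    assume "\<not> 2 \<le> length p"
    then consider "p = []" | e where "p = [e]" by (cases p; cases "tl p") auto
    then show False
    proof cases
      case 1
      then have "(u, u) \<in> parcs G" using w arc by (auto simp: H.awalk_def)
      then show False using G by (auto simp: oriented_digraph_def)
    next
      case 2
      then have "e = (a, u)" using w by (auto simp: H.awalk_def)
      then show False using sub 2 G arc by (auto simp: S_def oriented_digraph_def)
    qed
  qed
  ultimately show ?thesis by (intro exI[of _ "(u, a) # p"]) auto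
qed

text \<open>Whenever the path uses an arc into its own starting point, everything up to then can be dropped.\<close>

lemma rtrancl_avoid_arc_into_start:
  assumes "(a, x) \<in> R\<^sup>*"
  shows "(a, x) \<in> (R - {(u, a)})\<^sup>*"
  using assms
proof (induction rule: rtrancl_induct)
  case (step y z)
  then show ?case by (cases "(y, z) = (u, a)") (auto intro: rtrancl_into_rtrancl)
qed auto

text \<open>Follow the path up to its first use of the arc.\<close>

lemma rtrancl_avoid_or_reach_tail:
  assumes "(b, x) \<in> R\<^sup>*"
  shows "(b, x) \<in> (R - {(u, a)})\<^sup>* \<or> (b, u) \<in> (R - {(u, a)})\<^sup>*"
  using assms
proof (induction rule: rtrancl_induct)
  case (step y z)
  then show ?case by (cases "(y, z) = (u, a)") (auto intro: rtrancl_into_rtrancl)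
qed auto

text \<open>Both claims come from \<open>cycle_through_arc\<close>.  A directed cycle would be a cycle, so the root,
which every vertex reaches, has no outgoing arc.  If \<open>u\<close> had two outgoing arcs, to \<open>a\<close> and to \<open>b\<close>,
then one could walk from \<open>a\<close> to the root and from there back against the arcs via \<open>b\<close> to \<open>u\<close>.\<close>

lemma rooted_tree_arcs:
  assumes T: "rooted_tree T r"
  shows "inj_on fst (parcs T)" and "fst ` parcs T = pverts T - {r}"
proof -
  have ori: "oriented_digraph T" and r: "r \<in> pverts T"
    and reach: "\<And>u. u \<in> pverts T \<Longrightarrow> u \<rightarrow>\<^sup>*\<^bsub>with_proj T\<^esub> r"
    using T by (auto simp: rooted_tree_def)
  interpret pair_fin_digraph T using ori by (simp add: oriented_digraph_def)
  let ?R = "parcs T"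
  have reach': "(u, r) \<in> ?R\<^sup>*" if "u \<in> pverts T" for u
    using reach[OF that] reachable_rtranclI by (fastforce simp: arcs_ends_def)
  have verts: "u \<in> pverts T" "v \<in> pverts T" if "(u, v) \<in> ?R" for u v
    using that arc_fst_in_verts arc_snd_in_verts by fastforce+
  have no_cycle: "(a, u) \<notin> ((?R - {(u, a)}) \<union> (?R - {(u, a)})\<inverse>)\<^sup>*" if "(u, a) \<in> ?R" for u a
    using cycle_through_arc[OF ori that] T by (auto simp: rooted_tree_def undirected_tree_def)
  have S_mono: "(?R - {e})\<^sup>* \<subseteq> ((?R - {e}) \<union> (?R - {e})\<inverse>)\<^sup>*"
    "((?R - {e})\<inverse>)\<^sup>* \<subseteq> ((?R - {e}) \<union> (?R - {e})\<inverse>)\<^sup>*" for e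
    by (intro rtrancl_mono; blast)+
  have acyclic: "(a, u) \<notin> ?R\<^sup>*" if "(u, a) \<in> ?R" for u a
    using rtrancl_avoid_arc_into_start[of a u ?R u] no_cycle[OF that] S_mono by blast
  have unique: "a = b" if ua: "(u, a) \<in> ?R" and ub: "(u, b) \<in> ?R" for u a b
  proof (rule ccontr)
    assume ne: "a \<noteq> b"
    let ?S = "?R - {(u, a)}"
    have ub': "(u, b) \<in> ?S" using ub ne by auto
    have ar: "(a, r) \<in> ?S\<^sup>*"
      by (rule rtrancl_avoid_arc_into_start) (use reach' verts ua in blast)
    have "(b, u) \<notin> ?S\<^sup>*" using acyclic[OF ub] rtrancl_mono[of ?S ?R] by auto
    then have br: "(b, r) \<in> ?S\<^sup>*"
      using rtrancl_avoid_or_reach_tail[of b r ?R u a] reach' verts ub by blast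
    have rb: "(r, b) \<in> (?S\<inverse>)\<^sup>*" using br by (simp add: rtrancl_converse)
    have "(a, u) \<in> (?S \<union> ?S\<inverse>)\<^sup>*"
    proof (rule rtrancl_into_rtrancl)
      show "(a, b) \<in> (?S \<union> ?S\<inverse>)\<^sup>*"
        using ar rb S_mono by (meson rtrancl_trans subsetD)
      show "(b, u) \<in> ?S \<union> ?S\<inverse>" using ub' by auto
    qed
    then show False using no_cycle[OF ua] by blast
  qed
  show "inj_on fst ?R"
    by (rule inj_onI) (auto dest: unique)
  show "fst ` ?R = pverts T - {r}"
  proof (intro equalityI subsetI)
    fix u assume "u \<in> fst ` ?R"
    then obtain a where ua: "(u, a) \<in> ?R" by auto
    have "(a, r) \<in> ?R\<^sup>*" using reach' verts ua by blast
    then show "u \<in> pverts T - {r}" using acyclic[OF ua] verts[OF ua] by auto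
  next
    fix u assume u: "u \<in> pverts T - {r}"
    then have "(u, r) \<in> ?R\<^sup>*" "u \<noteq> r" using reach' by auto
    then obtain a where "(u, a) \<in> ?R" by (meson converse_rtranclE)
    then show "u \<in> fst ` ?R" by force
  qed
qed

lemma two_rooted_trees_arcs:
  assumes "two_rooted_trees G r\<^sub>1 r\<^sub>2"
  shows "r\<^sub>1 \<noteq> r\<^sub>2" and "r\<^sub>1 \<in> pverts G" and "r\<^sub>2 \<in> pverts G"
    and "inj_on fst (parcs G)" and "fst ` parcs G = pverts G - {r\<^sub>1, r\<^sub>2}"
proof -
  obtain T\<^sub>1 T\<^sub>2 where T: "rooted_tree T\<^sub>1 r\<^sub>1" "rooted_tree T\<^sub>2 r\<^sub>2"
    and disj: "pverts T\<^sub>1 \<inter> pverts T\<^sub>2 = {}"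
    and G: "G = \<lparr>pverts = pverts T\<^sub>1 \<union> pverts T\<^sub>2, parcs = parcs T\<^sub>1 \<union> parcs T\<^sub>2\<rparr>"
    using assms by (auto simp: two_rooted_trees_def)
  have r: "r\<^sub>1 \<in> pverts T\<^sub>1" "r\<^sub>2 \<in> pverts T\<^sub>2" using T by (auto simp: rooted_tree_def)
  show "r\<^sub>1 \<noteq> r\<^sub>2" "r\<^sub>1 \<in> pverts G" "r\<^sub>2 \<in> pverts G" using r disj G by auto
  note a1 = rooted_tree_arcs[OF T(1)] and a2 = rooted_tree_arcs[OF T(2)]
  show "inj_on fst (parcs G)"
    using a1 a2 disj unfolding G by (simp add: inj_on_Un) blast
  show "fst ` parcs G = pverts G - {r\<^sub>1, r\<^sub>2}"
    using a1(2) a2(2) r disj unfolding G by (simp add: image_Un) blast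
qed

section \<open>Nonassociative algebras and their quotients\<close>

text \<open>The free algebra is not a Lie algebra yet, so quotients are studied for arbitrary bilinear
products.\<close>

locale bilinear_algebra = vectorspace class_ring L
  for L :: "('k::field, 'a) module" (structure) +
  assumes mult_closed: "\<lbrakk>x \<in> carrier L; y \<in> carrier L\<rbrakk> \<Longrightarrow> x \<otimes> y \<in> carrier L"
    and mult_add_left: "\<lbrakk>x \<in> carrier L; y \<in> carrier L; z \<in> carrier L\<rbrakk>
          \<Longrightarrow> (x \<oplus> y) \<otimes> z = x \<otimes> z \<oplus> y \<otimes> z"
    and mult_add_right: "\<lbrakk>x \<in> carrier L; y \<in> carrier L; z \<in> carrier L\<rbrakk>
          \<Longrightarrow> x \<otimes> (y \<oplus> z) = x \<otimes> y \<oplus> x \<otimes> z"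
    and mult_smult_left: "\<lbrakk>x \<in> carrier L; y \<in> carrier L\<rbrakk>
          \<Longrightarrow> (c \<odot>\<^bsub>L\<^esub> x) \<otimes> y = c \<odot>\<^bsub>L\<^esub> (x \<otimes> y)"
    and mult_smult_right: "\<lbrakk>x \<in> carrier L; y \<in> carrier L\<rbrakk>
          \<Longrightarrow> x \<otimes> (c \<odot>\<^bsub>L\<^esub> y) = c \<odot>\<^bsub>L\<^esub> (x \<otimes> y)"

sublocale lie_algebra \<subseteq> bilinear_algebra
  by unfold_locales (fact bracket_closed bracket_add_left bracket_add_right
    bracket_smult_left bracket_smult_right)+

lemma bilinear_algebraI:
  fixes L :: "('k::field, 'a) module" (structure)
  assumes "Module.module class_ring L"
    and "\<And>x y. x \<in> carrier L \<Longrightarrow> y \<in> carrier L \<Longrightarrow> x \<otimes> y \<in> carrier L"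
    and "\<And>x y z. x \<in> carrier L \<Longrightarrow> y \<in> carrier L \<Longrightarrow> z \<in> carrier L \<Longrightarrow>
      (x \<oplus> y) \<otimes> z = x \<otimes> z \<oplus> y \<otimes> z"
    and "\<And>x y z. x \<in> carrier L \<Longrightarrow> y \<in> carrier L \<Longrightarrow> z \<in> carrier L \<Longrightarrow>
      x \<otimes> (y \<oplus> z) = x \<otimes> y \<oplus> x \<otimes> z"
    and "\<And>c x y. x \<in> carrier L \<Longrightarrow> y \<in> carrier L \<Longrightarrow> (c \<odot>\<^bsub>L\<^esub> x) \<otimes> y = c \<odot>\<^bsub>L\<^esub> (x \<otimes> y)"
    and "\<And>c x y. x \<in> carrier L \<Longrightarrow> y \<in> carrier L \<Longrightarrow> x \<otimes> (c \<odot>\<^bsub>L\<^esub> y) = c \<odot>\<^bsub>L\<^esub> (x \<otimes> y)"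
  shows "bilinear_algebra L"
proof -
  interpret Module.module class_ring L by fact
  interpret F: field "class_ring :: 'k ring" by (rule class_field)
  show ?thesis by unfold_locales (fact assms(2-6))+
qed

context bilinear_algebra
begin

lemma smult_in [simp, intro]: "x \<in> carrier L \<Longrightarrow> c \<odot>\<^bsub>L\<^esub> x \<in> carrier L"
  by simp

lemma minus_eq_smult: "x \<in> carrier L \<Longrightarrow> \<ominus> x = (- 1) \<odot>\<^bsub>L\<^esub> x"
  using smult_minus_1[of x] by (simp add: class_ring_simps)

lemma add_cancel: "x \<in> carrier L \<Longrightarrow> x \<oplus> (- 1) \<odot>\<^bsub>L\<^esub> x = \<zero>"
  using minus_eq_smult[of x] M.r_neg[of x] by simp

lemma zero_smult [simp]: "x \<in> carrier L \<Longrightarrow> 0 \<odot>\<^bsub>L\<^esub> x = \<zero>"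
  using lmult_0[of x] by (simp add: class_ring_simps)

lemma one_smult [simp]: "x \<in> carrier L \<Longrightarrow> 1 \<odot>\<^bsub>L\<^esub> x = x"
  using smult_one[of x] by (simp add: class_ring_simps)

lemma scale_add_left: "x \<in> carrier L \<Longrightarrow> (a + b) \<odot>\<^bsub>L\<^esub> x = a \<odot>\<^bsub>L\<^esub> x \<oplus> b \<odot>\<^bsub>L\<^esub> x"
  using smult_l_distr[of a b x] by simp

lemma scale_add_right:
  "x \<in> carrier L \<Longrightarrow> y \<in> carrier L \<Longrightarrow> a \<odot>\<^bsub>L\<^esub> (x \<oplus> y) = a \<odot>\<^bsub>L\<^esub> x \<oplus> a \<odot>\<^bsub>L\<^esub> y"
  using smult_r_distr[of a x y] by simp

lemma scale_scale: "x \<in> carrier L \<Longrightarrow> (a * b) \<odot>\<^bsub>L\<^esub> x = a \<odot>\<^bsub>L\<^esub> (b \<odot>\<^bsub>L\<^esub> x)"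
  using smult_assoc1[of a b x] by simp

lemma smult_zero [simp]: "c \<odot>\<^bsub>L\<^esub> \<zero> = \<zero>"
  using rmult_0[of c] by simp

lemma mult_zero_left [simp]: "x \<in> carrier L \<Longrightarrow> \<zero> \<otimes> x = \<zero>"
  using mult_smult_left[of "\<zero>" x 0] by (simp add: mult_closed)

lemma mult_zero_right [simp]: "x \<in> carrier L \<Longrightarrow> x \<otimes> \<zero> = \<zero>"
  using mult_smult_right[of x "\<zero>" 0] by (simp add: mult_closed)

lemma submoduleI:
  assumes "N \<subseteq> carrier L" and "\<zero> \<in> N" and "\<And>x y. x \<in> N \<Longrightarrow> y \<in> N \<Longrightarrow> x \<oplus> y \<in> N"
    and "\<And>c x. x \<in> N \<Longrightarrow> c \<odot>\<^bsub>L\<^esub> x \<in> N"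
  shows "submodule class_ring N L"
  using assms module_axioms by (simp add: submodule_def)

lemma alg_idealI:
  assumes "N \<subseteq> carrier L" and "\<zero> \<in> N" and "\<And>x y. x \<in> N \<Longrightarrow> y \<in> N \<Longrightarrow> x \<oplus> y \<in> N"
    and "\<And>c x. x \<in> N \<Longrightarrow> c \<odot>\<^bsub>L\<^esub> x \<in> N"
    and "\<And>x y. x \<in> carrier L \<Longrightarrow> y \<in> N \<Longrightarrow> x \<otimes> y \<in> N"
    and "\<And>x y. x \<in> carrier L \<Longrightarrow> y \<in> N \<Longrightarrow> y \<otimes> x \<in> N"
  shows "alg_ideal L N"
  unfolding alg_ideal_def by (intro conjI ballI submoduleI assms)

lemma alg_idealD:
  assumes "alg_ideal L N"
  shows "N \<subseteq> carrier L" and "\<zero> \<in> N" and "\<And>x y. x \<in> N \<Longrightarrow> y \<in> N \<Longrightarrow> x \<oplus> y \<in> N"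
    and "\<And>c x. x \<in> N \<Longrightarrow> c \<odot>\<^bsub>L\<^esub> x \<in> N"
    and "\<And>x y. x \<in> carrier L \<Longrightarrow> y \<in> N \<Longrightarrow> x \<otimes> y \<in> N"
    and "\<And>x y. x \<in> carrier L \<Longrightarrow> y \<in> N \<Longrightarrow> y \<otimes> x \<in> N"
  using assms unfolding alg_ideal_def submodule_def by auto

lemma alg_ideal_carrier: "alg_ideal L (carrier L)"
  by (rule alg_idealI) (auto simp: mult_closed)

lemma alg_ideal_Inter:
  assumes "\<And>I. I \<in> F \<Longrightarrow> alg_ideal L I" and "F \<noteq> {}"
  shows "alg_ideal L (\<Inter>F)"
proof (rule alg_idealI)
  note D = alg_idealD[OF assms(1)]
  show "\<Inter>F \<subseteq> carrier L" using assms(2) D(1) by blast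
  show "\<zero> \<in> \<Inter>F" using D(2) by blast
  show "x \<oplus> y \<in> \<Inter>F" if "x \<in> \<Inter>F" "y \<in> \<Inter>F" for x y using D(3) that by blast
  show "c \<odot>\<^bsub>L\<^esub> x \<in> \<Inter>F" if "x \<in> \<Inter>F" for c x using D(4) that by blast
  show "x \<otimes> y \<in> \<Inter>F" if "x \<in> carrier L" "y \<in> \<Inter>F" for x y using D(5) that by blast
  show "y \<otimes> x \<in> \<Inter>F" if "x \<in> carrier L" "y \<in> \<Inter>F" for x y using D(6) that by blast
qed

lemma alg_ideal_gen:
  assumes "S \<subseteq> carrier L"
  shows "alg_ideal L (ideal_gen L S)" and "S \<subseteq> ideal_gen L S"
proof -
  show "alg_ideal L (ideal_gen L S)"
    unfolding ideal_gen_def using alg_ideal_carrier assms by (intro alg_ideal_Inter) auto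
qed (auto simp: ideal_gen_def)

lemma span_carrier: "S \<subseteq> carrier L \<Longrightarrow> lspan L S \<subseteq> carrier L"
  by (rule span_is_subset2)

lemma span_closed:
  assumes "S \<subseteq> carrier L"
  shows "\<zero> \<in> lspan L S" and "\<And>x y. x \<in> lspan L S \<Longrightarrow> y \<in> lspan L S \<Longrightarrow> x \<oplus> y \<in> lspan L S"
    and "\<And>c x. x \<in> lspan L S \<Longrightarrow> c \<odot>\<^bsub>L\<^esub> x \<in> lspan L S"
  using span_is_submodule[OF assms] by (auto simp: submodule_def)

lemma span_induct [consumes 2, case_names zero gen add smult]:
  assumes "x \<in> lspan L S" and S: "S \<subseteq> carrier L" and "P \<zero>" and "\<And>s. s \<in> S \<Longrightarrow> P s"
    and "\<And>x y. x \<in> carrier L \<Longrightarrow> y \<in> carrier L \<Longrightarrow> P x \<Longrightarrow> P y \<Longrightarrow> P (x \<oplus> y)"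
    and "\<And>c x. x \<in> carrier L \<Longrightarrow> P x \<Longrightarrow> P (c \<odot>\<^bsub>L\<^esub> x)"
  shows "P x"
proof -
  have "lspan L S \<subseteq> {x \<in> carrier L. P x}"
    by (rule span_is_subset, use S assms(4) in blast, rule submoduleI) (use assms(3,5,6) in auto)
  then show ?thesis using assms(1) by auto
qed

text \<open>By bilinearity, first in one factor and then in the other.\<close>

lemma span_alg_idealI:
  assumes S: "S \<subseteq> carrier L" and T: "T \<subseteq> carrier L" and gen: "carrier L \<subseteq> lspan L T"
    and l: "\<And>t s. t \<in> T \<Longrightarrow> s \<in> S \<Longrightarrow> t \<otimes> s \<in> lspan L S"
    and r: "\<And>t s. t \<in> T \<Longrightarrow> s \<in> S \<Longrightarrow> s \<otimes> t \<in> lspan L S"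
  shows "alg_ideal L (lspan L S)"
proof -
  note sc = span_closed[OF S] and sub = span_carrier[OF S]
  have 1: "x \<otimes> s \<in> lspan L S \<and> s \<otimes> x \<in> lspan L S" if x: "x \<in> carrier L" and s: "s \<in> S" for x s
  proof -
    have sL: "s \<in> carrier L" using s S by auto
    have "x \<in> lspan L T" using gen x by auto
    from this T show ?thesis
    proof (induction rule: span_induct)
      case zero then show ?case using sL sc by simp
    next
      case (gen t) then show ?case using l r s by blast
    next
      case (add x y) then show ?case using sL sc by (simp add: mult_add_left mult_add_right)
    next
      case (smult c x) then show ?case using sL sc by (simp add: mult_smult_left mult_smult_right)
    qed
  qed
  have 2: "x \<otimes> y \<in> lspan L S \<and> y \<otimes> x \<in> lspan L S" if x: "x \<in> carrier L" and "y \<in> lspan L S" for x y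
    using that(2) S
  proof (induction rule: span_induct)
    case zero then show ?case using x sc by simp
  next
    case (gen t) then show ?case using 1 x by blast
  next
    case (add y z) then show ?case using x sc by (simp add: mult_add_left mult_add_right)
  next
    case (smult c y) then show ?case using x sc by (simp add: mult_smult_left mult_smult_right)
  qed
  show ?thesis by (rule alg_idealI) (use sub sc 2 in auto)
qed

end

text \<open>Epimorphisms transport the axioms: the target is an algebra, or a Lie algebra, as soon as the
source is one.  All four quotients on the way to the chain algebra are accessed through
this notion.\<close>

definition alg_epi :: "('k::field, 'a) module \<Rightarrow> ('k, 'b) module \<Rightarrow> ('a \<Rightarrow> 'b) \<Rightarrow> bool" where
  "alg_epi L Q p \<longleftrightarrow> carrier Q = p ` carrier L \<and> \<zero>\<^bsub>Q\<^esub> = p \<zero>\<^bsub>L\<^esub> \<and>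
     (\<forall>x\<in>carrier L. \<forall>y\<in>carrier L. p x \<oplus>\<^bsub>Q\<^esub> p y = p (x \<oplus>\<^bsub>L\<^esub> y)) \<and>
     (\<forall>x\<in>carrier L. \<forall>y\<in>carrier L. p x \<otimes>\<^bsub>Q\<^esub> p y = p (x \<otimes>\<^bsub>L\<^esub> y)) \<and>
     (\<forall>c. \<forall>x\<in>carrier L. c \<odot>\<^bsub>Q\<^esub> p x = p (c \<odot>\<^bsub>L\<^esub> x))"

lemma alg_epiD:
  assumes "alg_epi L Q p"
  shows "carrier Q = p ` carrier L" and "\<zero>\<^bsub>Q\<^esub> = p \<zero>\<^bsub>L\<^esub>"
    and "\<And>x. x \<in> carrier L \<Longrightarrow> p x \<in> carrier Q"
    and "\<And>x y. x \<in> carrier L \<Longrightarrow> y \<in> carrier L \<Longrightarrow> p x \<oplus>\<^bsub>Q\<^esub> p y = p (x \<oplus>\<^bsub>L\<^esub> y)"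
    and "\<And>x y. x \<in> carrier L \<Longrightarrow> y \<in> carrier L \<Longrightarrow> p x \<otimes>\<^bsub>Q\<^esub> p y = p (x \<otimes>\<^bsub>L\<^esub> y)"
    and "\<And>c x. x \<in> carrier L \<Longrightarrow> c \<odot>\<^bsub>Q\<^esub> p x = p (c \<odot>\<^bsub>L\<^esub> x)"
  using assms by (auto simp: alg_epi_def)

lemma bilinear_algebra_epi:
  fixes L :: "('k::field, 'a) module" and Q :: "('k, 'b) module"
  assumes L: "bilinear_algebra L" and p: "alg_epi L Q p"
  shows "bilinear_algebra Q"
proof -
  interpret bilinear_algebra L by fact
  note e = alg_epiD(2,4-6)[OF p]
  have ex: "\<exists>u\<in>carrier L. x = p u" if "x \<in> carrier Q" for x
    using that unfolding alg_epiD(1)[OF p] by auto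
  note Qc = alg_epiD(1)[OF p]
  have im: "p u \<in> carrier Q" if "u \<in> carrier L" for u
    using that unfolding alg_epiD(1)[OF p] by auto
  show ?thesis
  proof (rule bilinear_algebraI)
    show "Module.module class_ring Q"
    proof (rule module_criteria)
      show "cring (class_ring :: 'k ring)" ..
      show "\<forall>v\<in>carrier Q. \<exists>n\<in>carrier Q. v \<oplus>\<^bsub>Q\<^esub> n = \<zero>\<^bsub>Q\<^esub>"
      proof
        fix v assume "v \<in> carrier Q"
        then obtain u where u: "u \<in> carrier L" "v = p u" using ex by blast
        then show "\<exists>n\<in>carrier Q. v \<oplus>\<^bsub>Q\<^esub> n = \<zero>\<^bsub>Q\<^esub>"
          by (intro bexI[of _ "p (\<ominus>\<^bsub>L\<^esub> u)"]) (simp_all add: e im M.r_neg)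
      qed
    qed (auto simp: Qc e M.a_ac scale_add_left scale_add_right scale_scale)
  qed (auto simp: Qc e mult_closed mult_add_left mult_add_right mult_smult_left mult_smult_right)
qed

lemma lie_algebra_epi:
  assumes L: "lie_algebra L" and p: "alg_epi L Q p"
  shows "lie_algebra Q"
proof -
  interpret lie_algebra L by fact
  interpret Q: bilinear_algebra Q
    by (rule bilinear_algebra_epi[OF _ p]) unfold_locales
  note e = alg_epiD(2,4-6)[OF p]
  have ex: "\<exists>u\<in>carrier L. x = p u" if "x \<in> carrier Q" for x
    using that unfolding alg_epiD(1)[OF p] by auto
  show ?thesis
  proof (unfold_locales; (fact Q.mult_closed Q.mult_add_left Q.mult_add_right Q.mult_smult_left
        Q.mult_smult_right)?)
    show "x \<otimes>\<^bsub>Q\<^esub> x = \<zero>\<^bsub>Q\<^esub>" if x: "x \<in> carrier Q" for x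
      using ex[OF x] by (auto simp: e bracket_self)
    fix x y z assume "x \<in> carrier Q" "y \<in> carrier Q" "z \<in> carrier Q"
    then obtain u v w where "x = p u" "y = p v" "z = p w"
      and uvw: "u \<in> carrier L" "v \<in> carrier L" "w \<in> carrier L" using ex by meson
    then show "x \<otimes>\<^bsub>Q\<^esub> y \<otimes>\<^bsub>Q\<^esub> z \<oplus>\<^bsub>Q\<^esub> y \<otimes>\<^bsub>Q\<^esub> z \<otimes>\<^bsub>Q\<^esub> x \<oplus>\<^bsub>Q\<^esub> z \<otimes>\<^bsub>Q\<^esub> x \<otimes>\<^bsub>Q\<^esub> y = \<zero>\<^bsub>Q\<^esub>"
      using jacobi[OF uvw] by (simp add: e bracket_closed)
  qed
qed

lemma (in bilinear_algebra) quot_alg_epi: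
  assumes I: "alg_ideal L I"
  shows "alg_epi L (quot_alg L I) (a_r_coset L I)"
    and "\<And>x. x \<in> carrier L \<Longrightarrow> I +> x = \<zero>\<^bsub>quot_alg L I\<^esub> \<longleftrightarrow> x \<in> I"
proof -
  note D = alg_idealD[OF I]
  have sub: "I \<subseteq> carrier L" by (rule D(1))
  have "additive_subgroup I L"
  proof (rule additive_subgroupI, rule M.add.subgroupI)
    fix x assume "x \<in> I"
    then show "\<ominus> x \<in> I"
      using D(4)[of x "-1"] minus_eq_smult[of x] sub by auto
  qed (use D(1-3) in auto)
  then interpret abelian_subgroup I L
    using abelian_subgroupI3 M.abelian_group_axioms by blast
  have coset: "I +> (i \<oplus> x) = I +> x" if "i \<in> I" "x \<in> carrier L" for i x
  proof -
    have "i \<oplus> x \<in> I +> x" using that unfolding a_r_coset_def' by auto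
    then show ?thesis using a_repr_independence' that(2) by (metis sub)
  qed
  have mem: "\<exists>i\<in>I. u = i \<oplus> x" if "u \<in> I +> x" for u x using that unfolding a_r_coset_def' by auto
  have self: "x \<in> I +> x" if "x \<in> carrier L" for x using a_rcos_self that by auto
  have mult: "rcoset_mult L I (I +> x) (I +> y) = I +> (x \<otimes> y)" if x: "x \<in> carrier L" and y: "y \<in> carrier L" for x y
  proof -
    have "I +> (u \<otimes> v) = I +> (x \<otimes> y)" if u: "u \<in> I +> x" and v: "v \<in> I +> y" for u v
    proof -
      obtain i j where ij: "i \<in> I" "u = i \<oplus> x" "j \<in> I" "v = j \<oplus> y" using mem u v by meson
      have c: "i \<in> carrier L" "j \<in> carrier L" using ij sub by auto
      have "u \<otimes> v = (i \<otimes> (j \<oplus> y) \<oplus> x \<otimes> j) \<oplus> x \<otimes> y"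
        using ij c x y by (simp add: mult_add_left mult_add_right mult_closed M.a_ac)
      moreover have "i \<otimes> (j \<oplus> y) \<oplus> x \<otimes> j \<in> I" using ij c x y D by auto
      ultimately show ?thesis using coset x y by (simp add: mult_closed)
    qed
    then show ?thesis unfolding rcoset_mult_def using self[OF x] self[OF y] by blast
  qed
  have smult: "(\<Union>u\<in>I +> x. I +> (c \<odot>\<^bsub>L\<^esub> u)) = I +> (c \<odot>\<^bsub>L\<^esub> x)" if x: "x \<in> carrier L" for c x
  proof -
    have "I +> (c \<odot>\<^bsub>L\<^esub> u) = I +> (c \<odot>\<^bsub>L\<^esub> x)" if u: "u \<in> I +> x" for u
    proof -
      obtain i where i: "i \<in> I" "u = i \<oplus> x" using mem u by meson
      have "c \<odot>\<^bsub>L\<^esub> u = c \<odot>\<^bsub>L\<^esub> i \<oplus> c \<odot>\<^bsub>L\<^esub> x" using i sub x by (auto simp: smult_r_distr)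
      then show ?thesis using coset D(4) i x by auto
    qed
    then show ?thesis using self[OF x] by blast
  qed
  show "alg_epi L (quot_alg L I) (a_r_coset L I)"
    unfolding alg_epi_def quot_alg_def
    using a_rcos_sum mult smult by (auto simp: A_RCOSETS_def' sub)
  show "I +> x = \<zero>\<^bsub>quot_alg L I\<^esub> \<longleftrightarrow> x \<in> I" if x: "x \<in> carrier L" for x
    using self[OF x] a_coset_join2[OF x] additive_subgroup.a_subgroup[OF additive_subgroup_axioms] x
    by (auto simp: quot_alg_def)
qed

section \<open>Homomorphisms and monomials\<close>

definition alg_hom :: "('k::field, 'a) module \<Rightarrow> ('k, 'b) module \<Rightarrow> ('a \<Rightarrow> 'b) \<Rightarrow> bool" where
  "alg_hom L B h \<longleftrightarrow> (\<forall>x\<in>carrier L. h x \<in> carrier B) \<and>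
     (\<forall>x\<in>carrier L. \<forall>y\<in>carrier L. h (x \<oplus>\<^bsub>L\<^esub> y) = h x \<oplus>\<^bsub>B\<^esub> h y) \<and>
     (\<forall>x\<in>carrier L. \<forall>y\<in>carrier L. h (x \<otimes>\<^bsub>L\<^esub> y) = h x \<otimes>\<^bsub>B\<^esub> h y) \<and>
     (\<forall>c. \<forall>x\<in>carrier L. h (c \<odot>\<^bsub>L\<^esub> x) = c \<odot>\<^bsub>B\<^esub> h x)"

lemma alg_homD:
  assumes "alg_hom L B h"
  shows "\<And>x. x \<in> carrier L \<Longrightarrow> h x \<in> carrier B"
    and "\<And>x y. x \<in> carrier L \<Longrightarrow> y \<in> carrier L \<Longrightarrow> h (x \<oplus>\<^bsub>L\<^esub> y) = h x \<oplus>\<^bsub>B\<^esub> h y"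
    and "\<And>x y. x \<in> carrier L \<Longrightarrow> y \<in> carrier L \<Longrightarrow> h (x \<otimes>\<^bsub>L\<^esub> y) = h x \<otimes>\<^bsub>B\<^esub> h y"
    and "\<And>c x. x \<in> carrier L \<Longrightarrow> h (c \<odot>\<^bsub>L\<^esub> x) = c \<odot>\<^bsub>B\<^esub> h x"
  using assms by (auto simp: alg_hom_def)

lemma (in bilinear_algebra) lower_central_closed: "lower_central L i \<subseteq> carrier L"
proof (induction i)
  case (Suc i)
  have "{x \<otimes> y | x y. x \<in> carrier L \<and> y \<in> lower_central L i} \<subseteq> carrier L"
    using Suc by (auto simp: mult_closed)
  then show ?case unfolding lower_central.simps by (rule span_carrier)
qed simp

locale alg_hom_pair = L: bilinear_algebra L + B: bilinear_algebra B
  for L :: "('k::field, 'a) module" and B :: "('k, 'b) module" and h +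
  assumes hom: "alg_hom L B h"
begin

lemmas hom_simps = alg_homD[OF hom]

lemma hom_zero: "h \<zero>\<^bsub>L\<^esub> = \<zero>\<^bsub>B\<^esub>"
  using hom_simps(4)[of "\<zero>\<^bsub>L\<^esub>" 0] hom_simps(1)[of "\<zero>\<^bsub>L\<^esub>"] by simp

lemma alg_ideal_kernel: "alg_ideal L {x \<in> carrier L. h x = \<zero>\<^bsub>B\<^esub>}"
  by (rule L.alg_idealI) (auto simp: hom_zero hom_simps L.mult_closed)

lemma hom_vanishes_on_ideal_gen:
  assumes S: "S \<subseteq> carrier L" and "\<And>s. s \<in> S \<Longrightarrow> h s = \<zero>\<^bsub>B\<^esub>" and x: "x \<in> ideal_gen L S"
  shows "h x = \<zero>\<^bsub>B\<^esub>"
proof -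
  have "ideal_gen L S \<subseteq> {x \<in> carrier L. h x = \<zero>\<^bsub>B\<^esub>}"
    unfolding ideal_gen_def using alg_ideal_kernel assms(1,2) by (intro Inter_lower) auto
  then show ?thesis using x by auto
qed

lemma hom_lower_central: "x \<in> lower_central L i \<Longrightarrow> x \<in> carrier L \<and> h x \<in> lower_central B i"
proof (induction i arbitrary: x)
  case 0
  then show ?case by (simp add: hom_simps)
next
  case (Suc i)
  let ?S = "{x \<otimes>\<^bsub>L\<^esub> y | x y. x \<in> carrier L \<and> y \<in> lower_central L i}"
  let ?T = "{x \<otimes>\<^bsub>B\<^esub> y | x y. x \<in> carrier B \<and> y \<in> lower_central B i}"
  have S: "?S \<subseteq> carrier L" using Suc.IH by (auto simp: L.mult_closed)
  have T: "?T \<subseteq> carrier B" using B.lower_central_closed[of i] by (auto simp: B.mult_closed)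
  note Tc = B.span_closed[OF T]
  have "x \<in> lspan L ?S" using Suc.prems by simp
  from this S have "h x \<in> lspan B ?T"
  proof (induction rule: L.span_induct)
    case (gen s)
    then obtain u v where "s = u \<otimes>\<^bsub>L\<^esub> v" "u \<in> carrier L" "v \<in> lower_central L i" by auto
    then have "h s \<in> ?T" using Suc.IH hom_simps by blast
    then show ?case using B.in_own_span[OF T] by blast
  qed (use Tc in \<open>auto simp: hom_zero hom_simps\<close>)
  then show ?case using Suc.prems L.span_carrier[OF S] by auto
qed

lemma hom_eval_magma:
  assumes "g ` V \<subseteq> carrier L" and "letters t \<subseteq> V"
  shows "eval_magma L g t \<in> carrier L" and "h (eval_magma L g t) = eval_magma B (\<lambda>v. h (g v)) t"
  using assms(2)
proof (induction t)
  case (Gen v)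
  { case 1 then show ?case using assms(1) by auto }
  { case 2 then show ?case by simp }
next
  case (Prod r s)
  { case 1 then show ?case using Prod by (auto simp: L.mult_closed) }
  { case 2 then show ?case using Prod by (auto simp: hom_simps) }
qed

text \<open>The universal property of a quotient.\<close>

lemma hom_lift:
  assumes p: "alg_epi L Q p"
    and ker: "\<And>x. x \<in> carrier L \<Longrightarrow> p x = \<zero>\<^bsub>Q\<^esub> \<Longrightarrow> h x = \<zero>\<^bsub>B\<^esub>"
  obtains h' where "alg_hom Q B h'" and "\<And>x. x \<in> carrier L \<Longrightarrow> h' (p x) = h x"
proof -
  interpret Q: bilinear_algebra Q using bilinear_algebra_epi[OF L.bilinear_algebra_axioms p] .
  note e = alg_epiD[OF p]
  define h' where "h' X = h (SOME x. x \<in> carrier L \<and> p x = X)" for X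
  have h': "h' (p x) = h x" if x: "x \<in> carrier L" for x
  proof -
    define y where "y = (SOME y. y \<in> carrier L \<and> p y = p x)"
    have y: "y \<in> carrier L" "p y = p x"
      unfolding y_def using someI[of "\<lambda>y. y \<in> carrier L \<and> p y = p x" x] x by auto
    have "p (y \<oplus>\<^bsub>L\<^esub> (- 1) \<odot>\<^bsub>L\<^esub> x) = p x \<oplus>\<^bsub>Q\<^esub> (- 1) \<odot>\<^bsub>Q\<^esub> p x"
      using x y by (simp add: e(4)[symmetric] e(6)[symmetric])
    then have "p (y \<oplus>\<^bsub>L\<^esub> (- 1) \<odot>\<^bsub>L\<^esub> x) = \<zero>\<^bsub>Q\<^esub>" using Q.add_cancel[OF e(3)[OF x]] by simp
    then have "h (y \<oplus>\<^bsub>L\<^esub> (- 1) \<odot>\<^bsub>L\<^esub> x) = \<zero>\<^bsub>B\<^esub>" by (intro ker) (simp_all add: x y(1))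
    then have "h y \<oplus>\<^bsub>B\<^esub> \<ominus>\<^bsub>B\<^esub> h x = \<zero>\<^bsub>B\<^esub>" using x y(1) by (simp add: hom_simps B.minus_eq_smult)
    then have "h y = h x"
      using B.M.minus_equality[of "h y" "\<ominus>\<^bsub>B\<^esub> h x"] hom_simps(1)[OF x] hom_simps(1)[OF y(1)]
      by simp
    then show ?thesis by (simp add: h'_def y_def)
  qed
  show ?thesis
  proof (rule that)
    show "alg_hom Q B h'"
      unfolding alg_hom_def e(1) ball_simps
      by (auto simp: h' e(4-6) hom_simps L.mult_closed)
  qed (rule h')
qed

end

lemma alg_hom_pairI:
  "bilinear_algebra L \<Longrightarrow> bilinear_algebra B \<Longrightarrow> alg_hom L B h \<Longrightarrow> alg_hom_pair L B h"
  by (simp add: alg_hom_pair_def alg_hom_pair_axioms_def)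

lemma alg_epi_imp_hom:
  assumes "bilinear_algebra L" and "alg_epi L Q p"
  shows "alg_hom_pair L Q p"
  using assms bilinear_algebra_epi[OF assms] alg_epiD[OF assms(2)]
  by (intro alg_hom_pairI) (auto simp: alg_hom_def)

text \<open>The monomials in the generators span.  Unlike generation as an algebra, this is an equality of
subspaces, hence directly usable in inductions over spans.\<close>

definition magma_spans :: "('k::field, 'a) module \<Rightarrow> 'v set \<Rightarrow> ('v \<Rightarrow> 'a) \<Rightarrow> bool" where
  "magma_spans L V g \<longleftrightarrow> g ` V \<subseteq> carrier L \<and>
     carrier L \<subseteq> lspan L {eval_magma L g t | t. letters t \<subseteq> V}"

lemma magma_spans_gens: "magma_spans L V g \<Longrightarrow> g ` V \<subseteq> carrier L"
  by (simp add: magma_spans_def)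

lemma magma_spans_gen: "magma_spans L V g \<Longrightarrow> v \<in> V \<Longrightarrow> g v \<in> carrier L"
  by (auto simp: magma_spans_def)

lemma (in bilinear_algebra) eval_magma_closed:
  assumes "g ` V \<subseteq> carrier L" and "letters t \<subseteq> V"
  shows "eval_magma L g t \<in> carrier L"
  using assms(2) by (induction t) (use assms(1) in \<open>auto simp: mult_closed\<close>)

lemma magma_spans_epi:
  assumes L: "bilinear_algebra L" and p: "alg_epi L Q p" and sp: "magma_spans L V g"
  shows "magma_spans Q V (\<lambda>v. p (g v))"
proof -
  interpret alg_hom_pair L Q p by (rule alg_epi_imp_hom[OF L p])
  have gV: "g ` V \<subseteq> carrier L" and gen: "carrier L \<subseteq> lspan L {eval_magma L g t | t. letters t \<subseteq> V}"
    using sp by (auto simp: magma_spans_def)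
  have pV: "(\<lambda>v. p (g v)) ` V \<subseteq> carrier Q" using gV hom_simps by auto
  let ?S = "{eval_magma L g t | t. letters t \<subseteq> V}"
  let ?T = "{eval_magma Q (\<lambda>v. p (g v)) t | t. letters t \<subseteq> V}"
  have S: "?S \<subseteq> carrier L" using L.eval_magma_closed[OF gV] by auto
  have T: "?T \<subseteq> carrier Q" using B.eval_magma_closed[OF pV] by auto
  have "p x \<in> lspan Q ?T" if "x \<in> carrier L" for x
  proof -
    have "x \<in> lspan L ?S" using gen that by auto
    from this S show ?thesis
    proof (induction rule: L.span_induct)
      case (gen s)
      then have "p s \<in> ?T" using hom_eval_magma[OF gV] by auto
      then show ?case using B.in_own_span[OF T] by blast
    qed (use B.span_closed[OF T] in \<open>auto simp: hom_zero hom_simps\<close>)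
  qed
  then show ?thesis using pV by (auto simp: magma_spans_def alg_epiD(1)[OF p])
qed

section \<open>The free Lie algebra\<close>

lemma free_alg_sel:
  "carrier (free_alg V) = {f. finite {t. f t \<noteq> 0} \<and> (\<forall>t. f t \<noteq> 0 \<longrightarrow> letters t \<subseteq> V)}"
  "f \<otimes>\<^bsub>free_alg V\<^esub> g = (\<lambda>t. case t of Gen v \<Rightarrow> 0 | Prod r s \<Rightarrow> f r * g s)"
  "f \<oplus>\<^bsub>free_alg V\<^esub> g = (\<lambda>t. f t + g t)" "c \<odot>\<^bsub>free_alg V\<^esub> f = (\<lambda>t. c * f t)"
  "\<zero>\<^bsub>free_alg V\<^esub> = (\<lambda>_. 0)"
  by (simp_all add: free_alg_def)

lemma bilinear_algebra_free_alg: "bilinear_algebra (free_alg V :: ('k::field, 'v magma \<Rightarrow> 'k) module)"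
proof (rule bilinear_algebraI)
  have add: "(\<lambda>t. f t + g t) \<in> carrier (free_alg V)"
    if "f \<in> carrier (free_alg V)" "g \<in> carrier (free_alg V)" for f g :: "'v magma \<Rightarrow> 'k"
  proof -
    have "{t. f t + g t \<noteq> 0} \<subseteq> {t. f t \<noteq> 0} \<union> {t. g t \<noteq> 0}" by auto
    then show ?thesis using that by (auto simp: free_alg_sel intro: finite_subset)
  qed
  have smult: "(\<lambda>t. c * f t) \<in> carrier (free_alg V)" if "f \<in> carrier (free_alg V)" for f :: "'v magma \<Rightarrow> 'k" and c
  proof -
    have "{t. c * f t \<noteq> 0} \<subseteq> {t. f t \<noteq> 0}" by auto
    then show ?thesis using that by (auto simp: free_alg_sel intro: finite_subset)
  qed
  show "Module.module class_ring (free_alg V :: ('k, 'v magma \<Rightarrow> 'k) module)"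
  proof (rule module_criteria)
    show "cring (class_ring :: 'k ring)" ..
    show "\<forall>v\<in>carrier (free_alg V). \<exists>n\<in>carrier (free_alg V). v \<oplus>\<^bsub>free_alg V\<^esub> n = \<zero>\<^bsub>free_alg V :: ('k, 'v magma \<Rightarrow> 'k) module\<^esub>"
    proof
      fix v :: "'v magma \<Rightarrow> 'k" assume "v \<in> carrier (free_alg V)"
      then show "\<exists>n\<in>carrier (free_alg V). v \<oplus>\<^bsub>free_alg V\<^esub> n = \<zero>\<^bsub>free_alg V\<^esub>"
        using smult[of v "-1"] by (intro bexI[of _ "\<lambda>t. - 1 * v t"]) (simp_all add: free_alg_sel(3-5))
    qed
    show "\<zero>\<^bsub>free_alg V\<^esub> \<in> carrier (free_alg V :: ('k, 'v magma \<Rightarrow> 'k) module)" by (simp add: free_alg_sel)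
  qed (auto simp: add smult free_alg_sel(3-5) algebra_simps)
  show "f \<otimes>\<^bsub>free_alg V\<^esub> g \<in> carrier (free_alg V)"
    if "f \<in> carrier (free_alg V)" "g \<in> carrier (free_alg V)" for f g :: "'v magma \<Rightarrow> 'k"
  proof -
    let ?h = "f \<otimes>\<^bsub>free_alg V\<^esub> g"
    let ?P = "(\<lambda>(r, s). Prod r s) ` ({t. f t \<noteq> 0} \<times> {t. g t \<noteq> 0})"
    have "t \<in> ?P" if "?h t \<noteq> 0" for t
      using that by (cases t) (auto simp: free_alg_sel)
    then have "{t. ?h t \<noteq> 0} \<subseteq> ?P" by blast
    moreover have "finite ?P" using that by (auto simp: free_alg_sel)
    ultimately have "finite {t. ?h t \<noteq> 0}" by (rule finite_subset)
    moreover have "letters t \<subseteq> V" if "?h t \<noteq> 0" for t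
      using that \<open>f \<in> _\<close> \<open>g \<in> _\<close> by (cases t) (auto simp: free_alg_sel)
    ultimately show ?thesis by (simp add: free_alg_sel(1))
  qed
qed (auto simp: free_alg_sel fun_eq_iff algebra_simps split: magma.splits)

definition magma_unit :: "'v magma \<Rightarrow> 'v magma \<Rightarrow> 'k::field" where
  "magma_unit t s = (if s = t then 1 else 0)"

lemma magma_unit_closed: "letters t \<subseteq> V \<Longrightarrow> magma_unit t \<in> carrier (free_alg V)"
  by (auto simp: free_alg_sel magma_unit_def)

lemma eval_magma_free_alg:
  "eval_magma (free_alg V) (\<lambda>v. magma_unit (Gen v)) t = magma_unit t"
  by (induction t) (auto simp: free_alg_sel magma_unit_def fun_eq_iff split: magma.splits)

lemma magma_spans_free_alg: "magma_spans (free_alg V) V (\<lambda>v. magma_unit (Gen v))"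
proof -
  interpret bilinear_algebra "free_alg V" by (rule bilinear_algebra_free_alg)
  let ?S = "{magma_unit t | t. letters t \<subseteq> V}"
  have S: "?S \<subseteq> carrier (free_alg V)" using magma_unit_closed by auto
  have "f \<in> lspan (free_alg V) ?S" if "finite A" "f \<in> carrier (free_alg V)" "{t. f t \<noteq> 0} \<subseteq> A" for f A
    using that
  proof (induction A arbitrary: f rule: finite_induct)
    case empty
    then have "f = \<zero>\<^bsub>free_alg V\<^esub>" by (auto simp: free_alg_sel)
    then show ?case using span_closed(1)[OF S] by simp
  next
    case (insert t A)
    show ?case
    proof (cases "f t = 0")
      case True
      then show ?thesis using insert by (metis (mono_tags, lifting) insert_iff mem_Collect_eq subset_iff)
    next
      case False
      let ?f = "f(t := 0)"
      have t: "letters t \<subseteq> V" using insert.prems False by (auto simp: free_alg_sel)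
      have "{s. ?f s \<noteq> 0} \<subseteq> {s. f s \<noteq> 0}" by auto
      then have "?f \<in> carrier (free_alg V)"
        using insert.prems(1) by (auto simp: free_alg_sel intro: finite_subset)
      moreover have "{s. ?f s \<noteq> 0} \<subseteq> A" using insert.prems(2) by auto
      ultimately have a: "?f \<in> lspan (free_alg V) ?S" by (rule insert.IH)
      have b: "f t \<odot>\<^bsub>free_alg V\<^esub> magma_unit t \<in> lspan (free_alg V) ?S"
        using span_closed(3)[OF S] in_own_span[OF S] t by blast
      have c: "f = ?f \<oplus>\<^bsub>free_alg V\<^esub> f t \<odot>\<^bsub>free_alg V\<^esub> magma_unit t"
        by (auto simp: free_alg_sel magma_unit_def)
      show ?thesis by (subst c) (rule span_closed(2)[OF S a b])
    qed
  qed
  then have "f \<in> lspan (free_alg V) ?S" if "f \<in> carrier (free_alg V)" for f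
    using that by (auto simp: free_alg_sel(1))
  then show ?thesis
    unfolding magma_spans_def eval_magma_free_alg by (auto intro!: magma_unit_closed)
qed

lemma lie_relators_closed: "lie_relators V \<subseteq> carrier (free_alg V)"
proof -
  interpret bilinear_algebra "free_alg V" by (rule bilinear_algebra_free_alg)
  show ?thesis by (auto simp: lie_relators_def Let_def mult_closed)
qed

abbreviation free_lie_proj :: "'v set \<Rightarrow> ('v magma \<Rightarrow> 'k::field) \<Rightarrow> ('v magma \<Rightarrow> 'k) set" where
  "free_lie_proj V \<equiv> a_r_coset (free_alg V) (ideal_gen (free_alg V) (lie_relators V))"

lemma free_lie_epi:
  "alg_epi (free_alg V) (free_lie V) (free_lie_proj V)"
  "x \<in> carrier (free_alg V) \<Longrightarrow>
    free_lie_proj V x = \<zero>\<^bsub>free_lie V\<^esub> \<longleftrightarrow> x \<in> ideal_gen (free_alg V) (lie_relators V)"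
proof -
  interpret bilinear_algebra "free_alg V" by (rule bilinear_algebra_free_alg)
  note I = alg_ideal_gen(1)[OF lie_relators_closed]
  show "alg_epi (free_alg V) (free_lie V) (free_lie_proj V)"
    unfolding free_lie_def by (rule quot_alg_epi(1)[OF I])
  show "free_lie_proj V x = \<zero>\<^bsub>free_lie V\<^esub> \<longleftrightarrow> x \<in> ideal_gen (free_alg V) (lie_relators V)"
    if "x \<in> carrier (free_alg V)"
    unfolding free_lie_def by (rule quot_alg_epi(2)[OF I that])
qed

lemma lie_algebra_free_lie:
  "lie_algebra (free_lie V :: ('k::field, ('a magma \<Rightarrow> 'k) set) module)"
proof -
  let ?A = "free_alg V :: ('k, 'a magma \<Rightarrow> 'k) module" and ?p = "free_lie_proj V"
  interpret A: bilinear_algebra ?A by (rule bilinear_algebra_free_alg)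
  interpret F: bilinear_algebra "free_lie V :: ('k, ('a magma \<Rightarrow> 'k) set) module"
    by (rule bilinear_algebra_epi[OF A.bilinear_algebra_axioms free_lie_epi(1)])
  note e = alg_epiD[OF free_lie_epi(1)]
  have rel: "?p x = \<zero>\<^bsub>free_lie V\<^esub>" if "x \<in> lie_relators V" for x :: "'a magma \<Rightarrow> 'k"
    using that free_lie_epi(2)[of x V] A.alg_ideal_gen(2)[OF lie_relators_closed] lie_relators_closed[of V] by blast
  show ?thesis
  proof (unfold_locales; (fact F.mult_closed F.mult_add_left F.mult_add_right F.mult_smult_left
        F.mult_smult_right)?)
    show "X \<otimes>\<^bsub>free_lie V\<^esub> X = \<zero>\<^bsub>free_lie V\<^esub>" if X: "X \<in> carrier (free_lie V)" for X :: "('a magma \<Rightarrow> 'k) set"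
    proof -
      obtain x where x: "x \<in> carrier ?A" "X = ?p x" using X by (auto simp: e(1))
      then have "x \<otimes>\<^bsub>?A\<^esub> x \<in> lie_relators V" by (auto simp: lie_relators_def Let_def)
      then show ?thesis using rel x by (simp add: e(5))
    qed
    fix X Y Z :: "('a magma \<Rightarrow> 'k) set"
    assume "X \<in> carrier (free_lie V)" "Y \<in> carrier (free_lie V)" "Z \<in> carrier (free_lie V)"
    then obtain x y z where xyz: "X = ?p x" "Y = ?p y" "Z = ?p z"
      and c: "x \<in> carrier ?A" "y \<in> carrier ?A" "z \<in> carrier ?A" by (auto simp: e(1))
    then have "(x \<otimes>\<^bsub>?A\<^esub> y) \<otimes>\<^bsub>?A\<^esub> z \<oplus>\<^bsub>?A\<^esub> (y \<otimes>\<^bsub>?A\<^esub> z) \<otimes>\<^bsub>?A\<^esub> x \<oplus>\<^bsub>?A\<^esub> (z \<otimes>\<^bsub>?A\<^esub> x) \<otimes>\<^bsub>?A\<^esub> y \<in> lie_relators V"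
      by (auto simp: lie_relators_def Let_def)
    from rel[OF this]
    show "X \<otimes>\<^bsub>free_lie V\<^esub> Y \<otimes>\<^bsub>free_lie V\<^esub> Z \<oplus>\<^bsub>free_lie V\<^esub> Y \<otimes>\<^bsub>free_lie V\<^esub> Z \<otimes>\<^bsub>free_lie V\<^esub> X
        \<oplus>\<^bsub>free_lie V\<^esub> Z \<otimes>\<^bsub>free_lie V\<^esub> X \<otimes>\<^bsub>free_lie V\<^esub> Y = \<zero>\<^bsub>free_lie V\<^esub>"
      using c by (simp add: xyz e(4,5) A.mult_closed)
  qed
qed

lemma free_lie_gen_conv: "free_lie_gen V v = free_lie_proj V (magma_unit (Gen v))"
  by (simp add: free_lie_gen_def magma_unit_def[abs_def])

lemma magma_spans_free_lie: "magma_spans (free_lie V) V (free_lie_gen V)"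
  unfolding free_lie_gen_conv[abs_def]
  by (rule magma_spans_epi[OF bilinear_algebra_free_alg free_lie_epi(1) magma_spans_free_alg])

section \<open>Filiform Lie algebras\<close>

text \<open>The index 0 is the coordinate of \<open>y\<close>, and \<open>l \<ge> 1\<close> that of \<open>x\<^sub>l\<close>, where \<open>[x\<^sub>l, y] = x\<^sub>l\<^sub>+\<^sub>1\<close> for
\<open>l < c\<close>.  Coordinates beyond \<open>c\<close> are central and never occur in a bracket; admitting them lets all
sequences be elements.\<close>

definition filiform_alg :: "nat \<Rightarrow> ('k::field, nat \<Rightarrow> 'k) module" where
  "filiform_alg c = \<lparr>carrier = UNIV,
     mult = (\<lambda>f g l. if 2 \<le> l \<and> l \<le> c then f (l - 1) * g 0 - g (l - 1) * f 0 else 0),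
     one = (\<lambda>_. 0), zero = (\<lambda>_. 0), add = (\<lambda>f g l. f l + g l), smult = (\<lambda>a f l. a * f l)\<rparr>"

lemma filiform_sel [simp]:
  "carrier (filiform_alg c) = UNIV"
  "(f \<otimes>\<^bsub>filiform_alg c\<^esub> g) = (\<lambda>l. if 2 \<le> l \<and> l \<le> c then f (l - 1) * g 0 - g (l - 1) * f 0 else 0)"
  "f \<oplus>\<^bsub>filiform_alg c\<^esub> g = (\<lambda>l. f l + g l)" "a \<odot>\<^bsub>filiform_alg c\<^esub> f = (\<lambda>l. a * f l)"
  "\<zero>\<^bsub>filiform_alg c\<^esub> = (\<lambda>_. 0)"
  by (simp_all add: filiform_alg_def)

lemma lie_algebra_filiform: "lie_algebra (filiform_alg c :: ('k::field, nat \<Rightarrow> 'k) module)"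
proof -
  interpret bilinear_algebra "filiform_alg c :: ('k, nat \<Rightarrow> 'k) module"
  proof (rule bilinear_algebraI)
    show "Module.module class_ring (filiform_alg c :: ('k, nat \<Rightarrow> 'k) module)"
    proof (rule module_criteria)
      show "cring (class_ring :: 'k ring)" ..
      have "v \<oplus>\<^bsub>filiform_alg c\<^esub> (\<lambda>l. - v l) = \<zero>\<^bsub>filiform_alg c\<^esub>" for v :: "nat \<Rightarrow> 'k" by simp
      then show "\<forall>v\<in>carrier (filiform_alg c). \<exists>n\<in>carrier (filiform_alg c).
          v \<oplus>\<^bsub>filiform_alg c\<^esub> n = \<zero>\<^bsub>filiform_alg c :: ('k, nat \<Rightarrow> 'k) module\<^esub>"
        by (metis filiform_sel(1) UNIV_I)
    qed (simp_all add: algebra_simps)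
  qed (simp_all add: fun_eq_iff algebra_simps)
  show ?thesis
    by (unfold_locales; (fact mult_closed mult_add_left mult_add_right mult_smult_left
          mult_smult_right)?) (auto simp: fun_eq_iff algebra_simps)
qed

lemma lower_central_filiform:
  "1 \<le> i \<Longrightarrow> lower_central (filiform_alg c) i \<subseteq> {f :: nat \<Rightarrow> 'k::field. \<forall>l. l \<le> i \<or> c < l \<longrightarrow> f l = 0}"
proof (induction i rule: nat_induct_at_least)
  interpret lie_algebra "filiform_alg c :: ('k, nat \<Rightarrow> 'k) module" by (rule lie_algebra_filiform)
  { case base
    show ?case
      unfolding One_nat_def lower_central.simps
      by (rule span_is_subset, force, rule submoduleI) auto
  next
    case (Suc i)
    show ?case
      unfolding lower_central.simps
    proof (rule span_is_subset, safe)
      fix f g :: "nat \<Rightarrow> 'k" and l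
      assume g: "g \<in> lower_central (filiform_alg c) i" and l: "l \<le> Suc i" 
      have "\<forall>l. l \<le> i \<or> c < l \<longrightarrow> g l = 0" using g Suc.IH by auto
      then show "(f \<otimes>\<^bsub>filiform_alg c\<^esub> g) l = 0" using l by simp
    next
      show "submodule class_ring {f :: nat \<Rightarrow> 'k. \<forall>l. l \<le> Suc i \<or> c < l \<longrightarrow> f l = 0} (filiform_alg c)"
        by (rule submoduleI) auto
    qed auto
  }
qed

text \<open>The linear extension of \<open>M\<close> from monomials to the free algebra.\<close>

definition magma_sum :: "('v magma \<Rightarrow> nat \<Rightarrow> 'k) \<Rightarrow> ('v magma \<Rightarrow> 'k::field) \<Rightarrow> nat \<Rightarrow> 'k" where
  "magma_sum M f l = (\<Sum>t | f t \<noteq> 0. f t * M t l)"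

lemma magma_sum_superset:
  assumes "finite A" and "{t. f t \<noteq> 0} \<subseteq> A"
  shows "magma_sum M f l = (\<Sum>t\<in>A. f t * M t l)"
  unfolding magma_sum_def using assms by (intro sum.mono_neutral_left) auto

lemma free_alg_universal:
  fixes e :: "'v \<Rightarrow> nat \<Rightarrow> 'k::field" and c :: nat
  defines "M \<equiv> eval_magma (filiform_alg c) e"
  shows "alg_hom (free_alg V) (filiform_alg c) (magma_sum M)"
    and "magma_sum M (magma_unit t) = M t"
proof -
  have fin: "finite {t. f t \<noteq> 0}" if "f \<in> carrier (free_alg V)" for f :: "'v magma \<Rightarrow> 'k"
    using that by (simp add: free_alg_sel)
  have add: "magma_sum M (\<lambda>t. f t + g t) l = magma_sum M f l + magma_sum M g l"
    if f: "f \<in> carrier (free_alg V)" and g: "g \<in> carrier (free_alg V)" for f g l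
  proof -
    let ?A = "{t. f t \<noteq> 0} \<union> {t. g t \<noteq> 0}"
    have A: "finite ?A" using fin f g by blast
    have "magma_sum M f l = (\<Sum>t\<in>?A. f t * M t l)" "magma_sum M g l = (\<Sum>t\<in>?A. g t * M t l)"
      "magma_sum M (\<lambda>t. f t + g t) l = (\<Sum>t\<in>?A. (f t + g t) * M t l)"
      by (rule magma_sum_superset[OF A]; force)+
    then show ?thesis by (simp add: sum.distrib distrib_right)
  qed
  have smult: "magma_sum M (\<lambda>t. a * f t) l = a * magma_sum M f l"
    if f: "f \<in> carrier (free_alg V)" for f a l
    by (subst magma_sum_superset[OF fin[OF f]]) (auto simp: magma_sum_def sum_distrib_left mult.assoc)
  have mult: "magma_sum M (f \<otimes>\<^bsub>free_alg V\<^esub> g) l = (magma_sum M f \<otimes>\<^bsub>filiform_alg c\<^esub> magma_sum M g) l"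
    if f: "f \<in> carrier (free_alg V)" and g: "g \<in> carrier (free_alg V)" for f g l
  proof -
    let ?F = "{t. f t \<noteq> 0}" and ?G = "{t. g t \<noteq> 0}" and ?P = "\<lambda>(r, s). Prod r s"
    have FG: "finite (?F \<times> ?G)" using fin f g by blast
    have "t \<in> ?P ` (?F \<times> ?G)" if "(f \<otimes>\<^bsub>free_alg V\<^esub> g) t \<noteq> 0" for t
      using that by (cases t) (auto simp: free_alg_sel)
    then have "magma_sum M (f \<otimes>\<^bsub>free_alg V\<^esub> g) l = (\<Sum>t\<in>?P ` (?F \<times> ?G). (f \<otimes>\<^bsub>free_alg V\<^esub> g) t * M t l)"
      using FG by (intro magma_sum_superset) auto
    also have "\<dots> = (\<Sum>(r, s)\<in>?F \<times> ?G. (f r * g s) * M (Prod r s) l)"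
      by (subst sum.reindex) (auto simp: inj_on_def free_alg_sel intro!: sum.cong)
    also have "\<dots> = (magma_sum M f \<otimes>\<^bsub>filiform_alg c\<^esub> magma_sum M g) l"
    proof (cases "2 \<le> l \<and> l \<le> c")
      case True
      have "(\<Sum>(r, s)\<in>?F \<times> ?G. (f r * g s) * M (Prod r s) l) =
          (\<Sum>r\<in>?F. \<Sum>s\<in>?G. (f r * M r (l - 1)) * (g s * M s 0) - (f r * M r 0) * (g s * M s (l - 1)))"
        using True by (auto simp: M_def sum.cartesian_product algebra_simps intro!: sum.cong)
      also have "\<dots> = (\<Sum>r\<in>?F. f r * M r (l - 1)) * (\<Sum>s\<in>?G. g s * M s 0) -
          (\<Sum>r\<in>?F. f r * M r 0) * (\<Sum>s\<in>?G. g s * M s (l - 1))"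
        by (simp only: sum_subtractf sum_product)
      finally show ?thesis using True by (simp add: magma_sum_def mult.commute)
    next
      case False
      then show ?thesis by (auto simp: M_def intro!: sum.neutral)
    qed
    finally show ?thesis .
  qed
  show "alg_hom (free_alg V) (filiform_alg c) (magma_sum M)"
    unfolding alg_hom_def by (auto simp: free_alg_sel(3,4) add smult mult fun_eq_iff simp del: filiform_sel(2))
  show "magma_sum M (magma_unit t) = M t"
    by (rule ext, subst magma_sum_superset[of "{t}"]) (auto simp: magma_unit_def)
qed

text \<open>Every assignment of the generators extends, because the relators of the free Lie algebra hold in
the filiform algebra.\<close>

lemma free_lie_universal:
  fixes e :: "'v \<Rightarrow> nat \<Rightarrow> 'k::field"
  obtains h where "alg_hom (free_lie V) (filiform_alg c) h" and "\<And>v. v \<in> V \<Longrightarrow> h (free_lie_gen V v) = e v"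
proof -
  interpret B: lie_algebra "filiform_alg c :: ('k, nat \<Rightarrow> 'k) module" by (rule lie_algebra_filiform)
  define h where "h = magma_sum (eval_magma (filiform_alg c) e)"
  interpret alg_hom_pair "free_alg V" "filiform_alg c" h
    unfolding h_def
    by (intro alg_hom_pairI bilinear_algebra_free_alg B.bilinear_algebra_axioms free_alg_universal)
  have rel: "h s = \<zero>\<^bsub>filiform_alg c\<^esub>" if "s \<in> lie_relators V" for s
    using that unfolding lie_relators_def Let_def
    by (auto simp: hom_simps L.mult_closed B.bracket_self B.jacobi simp del: filiform_sel(2,3))
  have ker: "h x = \<zero>\<^bsub>filiform_alg c\<^esub>" if "x \<in> carrier (free_alg V)" "free_lie_proj V x = \<zero>\<^bsub>free_lie V\<^esub>" for x
    using hom_vanishes_on_ideal_gen[OF lie_relators_closed rel] that free_lie_epi(2) by blast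
  obtain h' where hom': "alg_hom (free_lie V) (filiform_alg c) h'"
    and h': "\<And>x. x \<in> carrier (free_alg V) \<Longrightarrow> h' (free_lie_proj V x) = h x"
    using hom_lift[OF free_lie_epi(1) ker] by blast
  show ?thesis
    by (rule that[OF hom']) (simp add: free_lie_gen_conv h' magma_unit_closed h_def free_alg_universal(2))
qed

section \<open>The lower central series\<close>

context lie_algebra
begin

lemma bracket_antisym:
  assumes x: "x \<in> carrier L" and y: "y \<in> carrier L"
  shows "y \<otimes> x = (- 1) \<odot>\<^bsub>L\<^esub> (x \<otimes> y)"
proof -
  have "\<zero> = (x \<oplus> y) \<otimes> (x \<oplus> y)" using x y by (simp add: bracket_self)
  also have "\<dots> = (x \<otimes> x \<oplus> y \<otimes> x) \<oplus> (x \<otimes> y \<oplus> y \<otimes> y)"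
    using x y by (simp add: bracket_add_left bracket_add_right)
  also have "\<dots> = y \<otimes> x \<oplus> x \<otimes> y" using x y by (simp add: bracket_self bracket_closed)
  finally have "\<ominus> (x \<otimes> y) = y \<otimes> x" using x y by (intro M.minus_equality) (simp_all add: bracket_closed)
  then show ?thesis using x y by (simp add: minus_eq_smult bracket_closed)
qed

lemma jacobi_left:
  assumes x: "x \<in> carrier L" and y: "y \<in> carrier L" and z: "z \<in> carrier L"
  shows "(x \<otimes> y) \<otimes> z = x \<otimes> (y \<otimes> z) \<oplus> (- 1) \<odot>\<^bsub>L\<^esub> (y \<otimes> (x \<otimes> z))"
proof -
  note c = bracket_closed x y z
  have 1: "(y \<otimes> z) \<otimes> x = (- 1) \<odot>\<^bsub>L\<^esub> (x \<otimes> (y \<otimes> z))"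
    by (rule bracket_antisym) (simp_all add: c)
  have 2: "(z \<otimes> x) \<otimes> y = y \<otimes> (x \<otimes> z)"
    using bracket_antisym[of y "z \<otimes> x"] bracket_antisym[of x z]
    by (simp add: c bracket_smult_right scale_scale[symmetric])
  have "(x \<otimes> y) \<otimes> z \<oplus> ((- 1) \<odot>\<^bsub>L\<^esub> (x \<otimes> (y \<otimes> z)) \<oplus> y \<otimes> (x \<otimes> z)) = \<zero>"
    using jacobi[OF x y z] by (simp add: 1 2 c M.a_assoc)
  then have "(x \<otimes> y) \<otimes> z = \<ominus> ((- 1) \<odot>\<^bsub>L\<^esub> (x \<otimes> (y \<otimes> z)) \<oplus> y \<otimes> (x \<otimes> z))"
    by (intro M.minus_equality[symmetric]) (simp_all add: c)
  then show ?thesis by (simp add: minus_eq_smult scale_add_right scale_scale[symmetric] c)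
qed

lemma lower_central_Suc_gens:
  "{x \<otimes> y | x y. x \<in> carrier L \<and> y \<in> lower_central L i} \<subseteq> carrier L"
  using lower_central_closed[of i] by (auto simp: bracket_closed)

lemma bracket_lower_central_right:
  "x \<in> carrier L \<Longrightarrow> y \<in> lower_central L i \<Longrightarrow> x \<otimes> y \<in> lower_central L (Suc i)"
  unfolding lower_central.simps
  by (rule subsetD[OF in_own_span[OF lower_central_Suc_gens]]) auto

lemma alg_ideal_lower_central: "alg_ideal L (lower_central L i)"
proof (induction i)
  case 0
  show ?case using alg_ideal_carrier by simp
next
  case (Suc i)
  note D = alg_idealD[OF Suc]
  note sc = span_closed[OF lower_central_Suc_gens[of i]]
  let ?S = "{x \<otimes> y | x y. x \<in> carrier L \<and> y \<in> lower_central L i}"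
  have sub: "lower_central L (Suc i) \<subseteq> lower_central L i"
    unfolding lower_central.simps
    by (rule span_is_subset, use D(5) in blast) (use Suc in \<open>simp add: alg_ideal_def\<close>)
  have r: "x \<otimes> y \<in> lower_central L (Suc i)" if "x \<in> carrier L" "y \<in> lower_central L (Suc i)" for x y
    using bracket_lower_central_right that sub by blast
  show ?case
  proof (rule alg_idealI)
    show "y \<otimes> x \<in> lower_central L (Suc i)" if "x \<in> carrier L" "y \<in> lower_central L (Suc i)" for x y
      using r[OF that] sc(3) bracket_antisym[of x y] that lower_central_closed[of "Suc i"]
      by (auto simp del: One_nat_def)
  qed (use r lower_central_closed[of "Suc i"] sc in auto)
qed

text \<open>Write a generator of the first term as \<open>[u, v]\<close> and use
\<open>[[u, v], y] = [u, [v, y]] - [v, [u, y]]\<close>: both summands involve \<open>v\<close>, which lies one step higher.\<close>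

lemma bracket_lower_central:
  "x \<in> lower_central L i \<Longrightarrow> y \<in> lower_central L j \<Longrightarrow> x \<otimes> y \<in> lower_central L (Suc (i + j))"
proof (induction i arbitrary: x y j)
  case 0
  then show ?case using bracket_lower_central_right by simp
next
  case (Suc i)
  note D = alg_idealD[OF alg_ideal_lower_central]
  note lc = lower_central_closed[THEN subsetD]
  let ?S = "{x \<otimes> y | x y. x \<in> carrier L \<and> y \<in> lower_central L i}"
  have y: "y \<in> carrier L" using Suc.prems lc by blast
  have "x \<in> lspan L ?S" using Suc.prems by simp
  from this lower_central_Suc_gens show ?case
  proof (induction rule: span_induct)
    case zero
    show ?case unfolding mult_zero_left[OF y] by (rule D(2))
  next
    case (gen s)
    then obtain u v where s: "s = u \<otimes> v" and u: "u \<in> carrier L" and v: "v \<in> lower_central L i" by auto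
    have 1: "u \<otimes> (v \<otimes> y) \<in> lower_central L (Suc (Suc i + j))"
      using bracket_lower_central_right[OF u Suc.IH[OF v Suc.prems(2)]] by (simp only: add_Suc)
    have "u \<otimes> y \<in> lower_central L (Suc j)" using bracket_lower_central_right[OF u Suc.prems(2)] .
    from Suc.IH[OF v this] have 2: "v \<otimes> (u \<otimes> y) \<in> lower_central L (Suc (Suc i + j))"
      by (simp only: add_Suc add_Suc_right)
    show ?case
      unfolding s jacobi_left[OF u lc[OF v] y] by (intro D(3,4) 1 2)
  next
    case (add x z)
    then show ?case unfolding bracket_add_left[OF add(1,2) y] by (intro D(3))
  next
    case (smult c x)
    then show ?case unfolding bracket_smult_left[OF smult(1) y] by (intro D(4))
  qed
qed

text \<open>Arbitrarily bracketed monomials are deep in the lower central series.  The definition gives this for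
right-normed ones only.\<close>

lemma eval_magma_lower_central:
  assumes g: "g ` V \<subseteq> carrier L" and "letters t \<subseteq> V" and "Suc i \<le> size (multideg t)"
  shows "eval_magma L g t \<in> lower_central L i"
  using assms(2,3)
proof (induction t arbitrary: i)
  case (Gen v)
  then show ?case using g by auto
next
  case (Prod r s)
  have pos: "0 < size (multideg t)" for t :: "'b magma" by (induction t) auto
  show ?case
  proof (cases i)
    case 0
    then show ?thesis using eval_magma_closed[OF g Prod.prems(1)] by simp
  next
    case (Suc i')
    \<comment> \<open>The two factors share the depth \<open>i - 1\<close>; \<open>r\<close> takes as much as its degree permits.\<close>
    define a where "a = min (size (multideg r) - 1) i'"
    have "Suc a \<le> size (multideg r)" "Suc (i' - a) \<le> size (multideg s)" "Suc (a + (i' - a)) = i"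
      using Suc Prod.prems(2) pos[of r] pos[of s] by (auto simp: a_def)
    then show ?thesis
      using bracket_lower_central[OF Prod.IH(1)[of a] Prod.IH(2)[of "i' - a"]] Prod.prems(1) by simp
  qed
qed

end

section \<open>Monomials of chain type\<close>

lemma size_multideg_pos: "0 < size (multideg t)"
  by (induction t) auto

lemma set_mset_multideg: "set_mset (multideg t) = letters t"
  by (induction t) auto

lemma size_multideg_1: "size (multideg t) = 1 \<Longrightarrow> \<exists>v. t = Gen v"
proof (cases t)
  case (Prod r s)
  assume "size (multideg t) = 1"
  then show ?thesis using Prod size_multideg_pos[of r] size_multideg_pos[of s] by simp
qed auto

lemma multideg_single: "multideg t = {#v#} \<Longrightarrow> t = Gen v"
  using size_multideg_1[of t] by auto

lemma union_eq_replicate: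
  assumes "A + B = replicate_mset n j"
  shows "A = replicate_mset (size A) j" and "B = replicate_mset (size B) j" and "size A + size B = n"
proof -
  have "set_mset (A + B) \<subseteq> {j}" unfolding assms by auto
  then show "A = replicate_mset (size A) j" "B = replicate_mset (size B) j"
    by (auto intro!: set_mset_subset_singletonD)
  show "size A + size B = n" using arg_cong[OF assms, of size] by simp
qed

lemma union_eq_add_replicate:
  assumes "A + B = add_mset i (replicate_mset n j)"
  obtains a b where "a + b = n" "A = add_mset i (replicate_mset a j)" "B = replicate_mset b j"
  | a b where "a + b = n" "A = replicate_mset a j" "B = add_mset i (replicate_mset b j)"
proof -
  have "i \<in># A + B" unfolding assms by simp
  then consider A' where "A = add_mset i A'" | B' where "B = add_mset i B'"
    by (meson mset_add union_iff)
  then show thesis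
  proof cases
    case (1 A')
    then have "A' + B = replicate_mset n j" using assms by simp
    from union_eq_replicate[OF this] show ?thesis using that(1) 1 by metis
  next
    case (2 B')
    then have "A + B' = replicate_mset n j" using assms by simp
    from union_eq_replicate[OF this] show ?thesis using that(2) 2 by metis
  qed
qed

context lie_algebra
begin

text \<open>A monomial in the single letter \<open>j\<close> contains the factor \<open>[v\<^sub>j, v\<^sub>j]\<close> unless it is the letter.\<close>

lemma eval_magma_repeated:
  assumes g: "g ` V \<subseteq> carrier L" and "letters t \<subseteq> V"
    and "multideg t = replicate_mset n j" and "n \<noteq> 1"
  shows "eval_magma L g t = \<zero>"
  using assms(2-4)
proof (induction t arbitrary: n)
  case (Gen v)
  then have "size {#v#} = n" by (metis multideg.simps(1) size_replicate_mset)
  then show ?case using Gen by simp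
next
  case (Prod r s)
  have "multideg r + multideg s = replicate_mset n j" using Prod.prems by simp
  note d = union_eq_replicate[OF this]
  have V: "letters r \<subseteq> V" "letters s \<subseteq> V" using Prod.prems by auto
  note c = eval_magma_closed[OF g V(1)] eval_magma_closed[OF g V(2)]
  consider "size (multideg r) \<noteq> 1" | "size (multideg s) \<noteq> 1"
    | "size (multideg r) = 1" "size (multideg s) = 1" by blast
  then show ?case
  proof cases
    case 1
    then show ?thesis using Prod.IH(1)[OF V(1) d(1)] c by simp
  next
    case 2
    then show ?thesis using Prod.IH(2)[OF V(2) d(2)] c by simp
  next
    case 3
    then have "multideg r = {#j#}" "multideg s = {#j#}" using d(1,2) by simp_all
    then have "r = Gen j" "s = Gen j" by (simp_all add: multideg_single)
    then show ?thesis using c by (simp add: bracket_self)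
  qed
qed

text \<open>In a product of degree \<open>e\<^sub>i + n e\<^sub>j\<close>, the factor without \<open>v\<^sub>i\<close> is a monomial in \<open>v\<^sub>j\<close> alone, so
it must be \<open>v\<^sub>j\<close> itself.  Up to sign the monomial is therefore built from \<open>v\<^sub>i\<close> by repeated
bracketing with \<open>v\<^sub>j\<close>.\<close>

lemma eval_magma_chain:
  assumes g: "g ` V \<subseteq> carrier L" and "letters t \<subseteq> V" and ij: "i \<noteq> j"
    and "multideg t = add_mset i (replicate_mset n j)"
  shows "\<exists>a. eval_magma L g t = a \<odot>\<^bsub>L\<^esub> ((\<lambda>x. x \<otimes> g j) ^^ n) (g i)"
  using assms(2,4)
proof (induction t arbitrary: n)
  case (Gen v)
  then have "n = 0" "v = i" by (metis multideg.simps(1) size_add_mset size_replicate_mset size_single nat.inject One_nat_def,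
      metis add_mset_eq_single multideg.simps(1))
  then show ?case using g Gen by (intro exI[of _ 1]) auto
next
  case (Prod r s)
  have V: "letters r \<subseteq> V" "letters s \<subseteq> V" using Prod.prems by auto
  note c = eval_magma_closed[OF g V(1)] eval_magma_closed[OF g V(2)]
  have iV: "g j \<in> carrier L" "g i \<in> carrier L" if "0 < n"
  proof -
    have "set_mset (add_mset i (replicate_mset n j)) \<subseteq> V"
      using Prod.prems by (metis set_mset_multideg)
    then have "i \<in> V" "j \<in> V" using that by auto
    then show "g j \<in> carrier L" "g i \<in> carrier L" using g by auto
  qed
  have key: "\<exists>a. x \<otimes> y = a \<odot>\<^bsub>L\<^esub> ((\<lambda>x. x \<otimes> g j) ^^ n) (g i)"
    if "a + b = n" and x: "x \<in> carrier L" "\<exists>a'. x = a' \<odot>\<^bsub>L\<^esub> ((\<lambda>x. x \<otimes> g j) ^^ a) (g i)"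
      and u: "multideg u = replicate_mset b j" "letters u \<subseteq> V" "y = eval_magma L g u" for x y a b u
  proof (cases "b = 1")
    case True
    then have n: "n = Suc a" using that by simp
    have y: "y = g j" using u True multideg_single[of u j] by simp
    have W: "((\<lambda>x. x \<otimes> g j) ^^ m) (g i) \<in> carrier L" for m
      using iV n by (induction m) (auto simp: bracket_closed)
    obtain a' where a': "x = a' \<odot>\<^bsub>L\<^esub> ((\<lambda>x. x \<otimes> g j) ^^ a) (g i)" using x by auto
    show ?thesis using iV n W[of a] unfolding y a' by (intro exI[of _ a']) (simp add: bracket_smult_left)
  next
    case False
    then have "y = \<zero>" using eval_magma_repeated[OF g u(2) u(1)] u(3) by simp
    moreover have "((\<lambda>x. x \<otimes> g j) ^^ m) (g i) \<in> carrier L" if "0 < n" for m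
      using iV that by (induction m) (auto simp: bracket_closed)
    moreover have "0 < n"
      using False that(1) size_multideg_pos[of u] u(1) by simp
    ultimately show ?thesis using x by (intro exI[of _ 0]) simp
  qed
  have "multideg r + multideg s = add_mset i (replicate_mset n j)" using Prod.prems by simp
  then show ?case
  proof (cases rule: union_eq_add_replicate)
    case (1 a b)
    show ?thesis
      using key[OF 1(1) c(1) Prod.IH(1)[OF V(1) 1(2)] 1(3) V(2) refl] by simp
  next
    case (2 a b)
    have ba: "b + a = n" using 2 by simp
    obtain a' where a': "eval_magma L g s \<otimes> eval_magma L g r = a' \<odot>\<^bsub>L\<^esub> ((\<lambda>x. x \<otimes> g j) ^^ n) (g i)"
      using key[OF ba c(2) Prod.IH(2)[OF V(2) 2(3)] 2(2) V(1) refl] by blast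
    have "0 < n" using 2(1,2) size_multideg_pos[of r] by simp
    then have W: "((\<lambda>x. x \<otimes> g j) ^^ m) (g i) \<in> carrier L" for m
      using iV by (induction m) (auto simp: bracket_closed)
    show ?thesis
      using bracket_antisym[OF c(2,1)] W[of n] unfolding a'
      by (intro exI[of _ "- a'"]) (simp add: scale_scale[symmetric])
  qed
qed

end

section \<open>The free nilpotent algebra and the graph algebra\<close>

abbreviation free_nilp_proj ::
    "nat \<Rightarrow> 'v set \<Rightarrow> ('v magma \<Rightarrow> 'k::field) set \<Rightarrow> ('v magma \<Rightarrow> 'k) set set" where
  "free_nilp_proj k V \<equiv> a_r_coset (free_lie V) (lower_central (free_lie V) k)"

lemma free_nilp_epi:
  "alg_epi (free_lie V) (free_nilp k V) (free_nilp_proj k V)"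
  "x \<in> carrier (free_lie V) \<Longrightarrow>
    free_nilp_proj k V x = \<zero>\<^bsub>free_nilp k V\<^esub> \<longleftrightarrow> x \<in> lower_central (free_lie V) k"
proof -
  interpret lie_algebra "free_lie V" by (rule lie_algebra_free_lie)
  note I = alg_ideal_lower_central[of k]
  show "alg_epi (free_lie V) (free_nilp k V) (free_nilp_proj k V)"
    unfolding free_nilp_def by (rule quot_alg_epi(1)[OF I])
  show "free_nilp_proj k V x = \<zero>\<^bsub>free_nilp k V\<^esub> \<longleftrightarrow> x \<in> lower_central (free_lie V) k"
    if "x \<in> carrier (free_lie V)"
    unfolding free_nilp_def by (rule quot_alg_epi(2)[OF I that])
qed

lemma lie_algebra_free_nilp: "lie_algebra (free_nilp k V)"
  by (rule lie_algebra_epi[OF lie_algebra_free_lie free_nilp_epi(1)])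

lemma magma_spans_free_nilp: "magma_spans (free_nilp k V) V (free_nilp_gen k V)"
proof -
  interpret lie_algebra "free_lie V" by (rule lie_algebra_free_lie)
  show ?thesis
    unfolding free_nilp_gen_def[abs_def]
    by (rule magma_spans_epi[OF bilinear_algebra_axioms free_nilp_epi(1) magma_spans_free_lie])
qed

lemma eval_magma_free_nilp:
  assumes "letters t \<subseteq> V" and "k < size (multideg t)"
  shows "eval_magma (free_nilp k V :: ('k::field, ('v magma \<Rightarrow> 'k) set set) module) (free_nilp_gen k V) t = \<zero>\<^bsub>free_nilp k V\<^esub>"
proof -
  interpret lie_algebra "free_lie V :: ('k, ('v magma \<Rightarrow> 'k) set) module" by (rule lie_algebra_free_lie)
  interpret alg_hom_pair "free_lie V :: ('k, ('v magma \<Rightarrow> 'k) set) module" "free_nilp k V" "free_nilp_proj k V"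
    by (rule alg_epi_imp_hom[OF bilinear_algebra_axioms free_nilp_epi(1)])
  have gV: "free_lie_gen V ` V \<subseteq> carrier (free_lie V :: ('k, ('v magma \<Rightarrow> 'k) set) module)"
    by (rule magma_spans_gens[OF magma_spans_free_lie])
  have "free_nilp_proj k V (eval_magma (free_lie V :: ('k, ('v magma \<Rightarrow> 'k) set) module) (free_lie_gen V) t) = \<zero>\<^bsub>free_nilp k V\<^esub>"
    using eval_magma_lower_central[OF gV assms(1)] assms(2) eval_magma_closed[OF gV assms(1)]
    by (simp add: free_nilp_epi(2))
  then show ?thesis
    using hom_eval_magma(2)[OF gV assms(1)] by (simp add: free_nilp_gen_def[abs_def])
qed

text \<open>For \<open>c \<le> k\<close> the filiform algebra is \<open>k\<close>-step nilpotent.\<close>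

lemma free_nilp_universal:
  fixes e :: "'v \<Rightarrow> nat \<Rightarrow> 'k::field"
  assumes "1 \<le> k" and "c \<le> k"
  obtains h where "alg_hom (free_nilp k V) (filiform_alg c) h"
    and "\<And>v. v \<in> V \<Longrightarrow> h (free_nilp_gen k V v) = e v"
proof -
  interpret B: lie_algebra "filiform_alg c :: ('k, nat \<Rightarrow> 'k) module" by (rule lie_algebra_filiform)
  interpret F: lie_algebra "free_lie V" by (rule lie_algebra_free_lie)
  obtain h where h: "alg_hom (free_lie V) (filiform_alg c) h"
    and hv: "\<And>v. v \<in> V \<Longrightarrow> h (free_lie_gen V v) = e v" using free_lie_universal[of V c e] by blast
  interpret alg_hom_pair "free_lie V" "filiform_alg c" h
    by (intro alg_hom_pairI h B.bilinear_algebra_axioms F.bilinear_algebra_axioms)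
  have ker: "h x = \<zero>\<^bsub>filiform_alg c\<^esub>"
    if "x \<in> carrier (free_lie V)" "free_nilp_proj k V x = \<zero>\<^bsub>free_nilp k V\<^esub>" for x
  proof -
    have "x \<in> lower_central (free_lie V) k" using that by (simp add: free_nilp_epi(2))
    then have "h x \<in> lower_central (filiform_alg c) k" using hom_lower_central by blast
    then have "\<forall>l. l \<le> k \<or> c < l \<longrightarrow> h x l = 0" using lower_central_filiform[OF assms(1)] by blast
    then have "h x l = 0" for l using assms(2) by (cases "l \<le> k") auto
    then show ?thesis by auto
  qed
  obtain h' where hom': "alg_hom (free_nilp k V) (filiform_alg c) h'"
    and h': "\<And>x. x \<in> carrier (free_lie V) \<Longrightarrow> h' (free_nilp_proj k V x) = h x"
    using hom_lift[OF free_nilp_epi(1) ker] by blast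
  show ?thesis
    by (rule that[OF hom']) (simp add: free_nilp_gen_def h' hv magma_spans_gen[OF magma_spans_free_lie])
qed

abbreviation graph_proj :: "nat \<Rightarrow> 'v pair_pre_digraph \<Rightarrow> ('v magma \<Rightarrow> 'k::field) set set \<Rightarrow>
    ('v magma \<Rightarrow> 'k) set set set" where
  "graph_proj k G \<equiv> a_r_coset (free_nilp k (pverts G)) (graph_ideal k G)"

lemma graph_relators_closed:
  "(\<lambda>(u, v). free_nilp_gen k (pverts G) u \<otimes>\<^bsub>free_nilp k (pverts G)\<^esub> free_nilp_gen k (pverts G) v) ` non_edges G
    \<subseteq> carrier (free_nilp k (pverts G))"
proof -
  interpret lie_algebra "free_nilp k (pverts G)" by (rule lie_algebra_free_nilp)
  show ?thesis
    by (auto simp: non_edges_def intro!: bracket_closed magma_spans_gen[OF magma_spans_free_nilp])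
qed

lemma graph_epi:
  "alg_epi (free_nilp k (pverts G)) (graph_lie k G) (graph_proj k G)"
  "x \<in> carrier (free_nilp k (pverts G)) \<Longrightarrow>
    graph_proj k G x = \<zero>\<^bsub>graph_lie k G\<^esub> \<longleftrightarrow> x \<in> graph_ideal k G"
proof -
  interpret lie_algebra "free_nilp k (pverts G)" by (rule lie_algebra_free_nilp)
  have I: "alg_ideal (free_nilp k (pverts G)) (graph_ideal k G)"
    unfolding graph_ideal_def by (rule alg_ideal_gen(1)[OF graph_relators_closed])
  show "alg_epi (free_nilp k (pverts G)) (graph_lie k G) (graph_proj k G)"
    unfolding graph_lie_def by (rule quot_alg_epi(1)[OF I])
  show "graph_proj k G x = \<zero>\<^bsub>graph_lie k G\<^esub> \<longleftrightarrow> x \<in> graph_ideal k G"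
    if "x \<in> carrier (free_nilp k (pverts G))"
    unfolding graph_lie_def by (rule quot_alg_epi(2)[OF I that])
qed

lemma lie_algebra_graph: "lie_algebra (graph_lie k G)"
  by (rule lie_algebra_epi[OF lie_algebra_free_nilp graph_epi(1)])

lemma magma_spans_graph: "magma_spans (graph_lie k G) (pverts G) (graph_lie_gen k G)"
proof -
  interpret lie_algebra "free_nilp k (pverts G)" by (rule lie_algebra_free_nilp)
  show ?thesis
    unfolding graph_lie_gen_def[abs_def]
    by (rule magma_spans_epi[OF bilinear_algebra_axioms graph_epi(1) magma_spans_free_nilp])
qed

lemma eval_magma_graph:
  assumes "letters t \<subseteq> pverts G" and "k < size (multideg t)"
  shows "eval_magma (graph_lie k G :: ('k::field, ('v magma \<Rightarrow> 'k) set set set) module) (graph_lie_gen k G) t = \<zero>\<^bsub>graph_lie k G\<^esub>"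
proof -
  interpret lie_algebra "free_nilp k (pverts G) :: ('k, ('v magma \<Rightarrow> 'k) set set) module" by (rule lie_algebra_free_nilp)
  interpret alg_hom_pair "free_nilp k (pverts G) :: ('k, ('v magma \<Rightarrow> 'k) set set) module" "graph_lie k G" "graph_proj k G"
    by (rule alg_epi_imp_hom[OF bilinear_algebra_axioms graph_epi(1)])
  have gV: "free_nilp_gen k (pverts G) ` pverts G \<subseteq> carrier (free_nilp k (pverts G) :: ('k, ('v magma \<Rightarrow> 'k) set set) module)"
    by (rule magma_spans_gens[OF magma_spans_free_nilp])
  show ?thesis
    using hom_eval_magma(2)[OF gV assms(1)] hom_zero
    by (simp add: graph_lie_gen_def[abs_def] eval_magma_free_nilp[OF assms])
qed

lemma graph_non_edge:
  assumes "(u, v) \<in> non_edges G"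
  shows "graph_lie_gen k G u \<otimes>\<^bsub>graph_lie k G :: ('k::field, ('v magma \<Rightarrow> 'k) set set set) module\<^esub> graph_lie_gen k G v = \<zero>\<^bsub>graph_lie k G\<^esub>"
proof -
  interpret lie_algebra "free_nilp k (pverts G) :: ('k, ('v magma \<Rightarrow> 'k) set set) module" by (rule lie_algebra_free_nilp)
  let ?g = "free_nilp_gen k (pverts G) :: 'v \<Rightarrow> ('v magma \<Rightarrow> 'k) set set" and ?F = "free_nilp k (pverts G) :: ('k, ('v magma \<Rightarrow> 'k) set set) module"
  have c: "?g u \<in> carrier ?F" "?g v \<in> carrier ?F"
    using assms by (auto simp: non_edges_def intro!: magma_spans_gen[OF magma_spans_free_nilp])
  have "?g u \<otimes>\<^bsub>?F\<^esub> ?g v \<in> graph_ideal k G"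
    unfolding graph_ideal_def
    by (rule subsetD[OF alg_ideal_gen(2)[OF graph_relators_closed]]) (use assms in force)
  then have "graph_proj k G (?g u \<otimes>\<^bsub>?F\<^esub> ?g v) = \<zero>\<^bsub>graph_lie k G\<^esub>"
    using graph_epi(2) bracket_closed[OF c] by blast
  then show ?thesis using alg_epiD(5)[OF graph_epi(1) c] by (simp add: graph_lie_gen_def)
qed

lemma graph_universal:
  fixes e :: "'v \<Rightarrow> nat \<Rightarrow> 'k::field"
  assumes "1 \<le> k" and "c \<le> k"
    and ne: "\<And>u v. (u, v) \<in> non_edges G \<Longrightarrow> e u \<otimes>\<^bsub>filiform_alg c\<^esub> e v = \<zero>\<^bsub>filiform_alg c\<^esub>"
  obtains h where "alg_hom (graph_lie k G) (filiform_alg c) h"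
    and "\<And>v. v \<in> pverts G \<Longrightarrow> h (graph_lie_gen k G v) = e v"
proof -
  let ?g = "free_nilp_gen k (pverts G) :: 'v \<Rightarrow> ('v magma \<Rightarrow> 'k) set set" and ?F = "free_nilp k (pverts G) :: ('k, _) module"
  interpret B: lie_algebra "filiform_alg c :: ('k, nat \<Rightarrow> 'k) module" by (rule lie_algebra_filiform)
  interpret F: lie_algebra ?F by (rule lie_algebra_free_nilp)
  obtain h where h: "alg_hom ?F (filiform_alg c) h"
    and hv: "\<And>v. v \<in> pverts G \<Longrightarrow> h (?g v) = e v"
    using free_nilp_universal[OF assms(1,2), of "pverts G" e] by blast
  interpret alg_hom_pair ?F "filiform_alg c" h
    by (intro alg_hom_pairI h B.bilinear_algebra_axioms F.bilinear_algebra_axioms)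
  have gc: "?g v \<in> carrier ?F" if "v \<in> pverts G" for v
    by (rule magma_spans_gen[OF magma_spans_free_nilp that])
  have rel: "h s = \<zero>\<^bsub>filiform_alg c\<^esub>" if s: "s \<in> (\<lambda>(u, v). ?g u \<otimes>\<^bsub>?F\<^esub> ?g v) ` non_edges G" for s
  proof -
    obtain u v where uv: "(u, v) \<in> non_edges G" "s = ?g u \<otimes>\<^bsub>?F\<^esub> ?g v" using s by auto
    then have V: "u \<in> pverts G" "v \<in> pverts G" by (auto simp: non_edges_def)
    show ?thesis unfolding uv(2) hom_simps(3)[OF gc[OF V(1)] gc[OF V(2)]] hv[OF V(1)] hv[OF V(2)] by (rule ne[OF uv(1)])
  qed
  have ker: "h x = \<zero>\<^bsub>filiform_alg c\<^esub>"
    if "x \<in> carrier ?F" "graph_proj k G x = \<zero>\<^bsub>graph_lie k G\<^esub>" for x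
    by (rule hom_vanishes_on_ideal_gen[OF graph_relators_closed rel])
      (use that graph_epi(2) in \<open>auto simp: graph_ideal_def\<close>)
  obtain h' where hom': "alg_hom (graph_lie k G) (filiform_alg c) h'"
    and h': "\<And>x. x \<in> carrier ?F \<Longrightarrow> h' (graph_proj k G x) = h x"
    using hom_lift[OF graph_epi(1) ker] by blast
  show ?thesis by (rule that[OF hom']) (simp add: graph_lie_gen_def h' hv gc)
qed

section \<open>The standard basis spans the chain algebra\<close>

text \<open>The parameter \<open>field_type\<close> only fixes the ground field, which occurs neither in \<open>\<kappa>\<close> nor in
\<open>G\<close>.\<close>

locale chain_algebra =
  fixes \<kappa> :: "'v \<times> 'v \<Rightarrow> nat" and G :: "'v pair_pre_digraph" and field_type :: "'k::field itself"
  assumes chain: "chain_digraph \<kappa> G"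
begin

abbreviation "V \<equiv> pverts G"
abbreviation "E \<equiv> parcs G"
abbreviation "step \<equiv> chain_step \<kappa> G"
abbreviation N :: "('k, ('v magma \<Rightarrow> 'k) set set set) module" where "N \<equiv> graph_lie step G"
abbreviation mon :: "'v magma \<Rightarrow> ('v magma \<Rightarrow> 'k) set set set" where
  "mon t \<equiv> eval_magma N (graph_lie_gen step G) t"
abbreviation mons :: "'v multiset set \<Rightarrow> ('v magma \<Rightarrow> 'k) set set set set" where
  "mons D \<equiv> {mon t | t. letters t \<subseteq> V \<and> multideg t \<in> D}"
abbreviation C :: "('k, ('k, 'v) chain_elt) module" where "C \<equiv> chain_lie \<kappa> G"
abbreviation gen :: "'v \<Rightarrow> ('k, 'v) chain_elt" where "gen \<equiv> chain_gen \<kappa> G"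
abbreviation w :: "'v \<Rightarrow> 'v \<Rightarrow> nat \<Rightarrow> ('k, 'v) chain_elt" where "w \<equiv> chain_w \<kappa> G"

sublocale G: pair_fin_digraph G
  using chain by (simp add: chain_digraph_def oriented_digraph_def)

sublocale N: lie_algebra N
  by (rule lie_algebra_graph)

lemma arc_vertices: "(i, j) \<in> E \<Longrightarrow> i \<in> V \<and> j \<in> V"
  using G.arc_fst_in_verts G.arc_snd_in_verts by fastforce

lemma arc_asym: "(i, j) \<in> E \<Longrightarrow> (j, i) \<notin> E"
  using chain by (simp add: chain_digraph_def oriented_digraph_def)

lemma arc_neq: "(i, j) \<in> E \<Longrightarrow> i \<noteq> j"
  using arc_asym by blast

lemma kappa_bounds: "e \<in> E \<Longrightarrow> 2 \<le> \<kappa> e \<and> \<kappa> e \<le> step"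
  using chain by (auto simp: chain_digraph_def chain_step_def)

lemma step_pos: "1 \<le> step"
proof (cases "E = {}")
  case False
  then obtain e where "e \<in> E" by blast
  then show ?thesis using kappa_bounds[of e] by simp
qed (simp add: chain_step_def)

lemma graph_gens: "graph_lie_gen step G ` V \<subseteq> carrier N"
  by (rule magma_spans_gens[OF magma_spans_graph])

lemma mon_closed: "letters t \<subseteq> V \<Longrightarrow> mon t \<in> carrier N"
  by (rule N.eval_magma_closed[OF graph_gens])

lemma mons_closed: "mons D \<subseteq> carrier N"
  using mon_closed by auto

lemma N_span: "carrier N \<subseteq> lspan N (mons UNIV)"
proof -
  have "magma_spans N V (graph_lie_gen step G)" by (rule magma_spans_graph)
  then show ?thesis by (simp add: magma_spans_def)
qed

lemma sum_comps_eq: "sum_comps step G D = lspan N (mons D)"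
proof -
  have comp: "graph_comp step G \<delta> = lspan N (mons {\<delta>})" for \<delta>
    by (simp add: graph_comp_def)
  have U: "(\<Union>\<delta>\<in>D. graph_comp step G \<delta>) \<subseteq> carrier N"
    unfolding comp using N.span_carrier[OF mons_closed] by blast
  show ?thesis
  proof
    have "graph_comp step G \<delta> \<subseteq> lspan N (mons D)" if "\<delta> \<in> D" for \<delta>
      unfolding comp by (rule N.span_is_monotone) (use that in auto)
    then show "sum_comps step G D \<subseteq> lspan N (mons D)"
      unfolding sum_comps_def by (intro N.span_is_subset N.span_is_submodule mons_closed) blast
    have "mons D \<subseteq> (\<Union>\<delta>\<in>D. graph_comp step G \<delta>)"
      unfolding comp using N.in_own_span[OF mons_closed] by blast
    then show "lspan N (mons D) \<subseteq> sum_comps step G D"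
      unfolding sum_comps_def by (rule N.span_is_monotone)
  qed
qed

lemma alg_ideal_sum_comps:
  assumes "\<And>t s. letters t \<subseteq> V \<Longrightarrow> letters s \<subseteq> V \<Longrightarrow> multideg s \<in> D \<Longrightarrow>
      multideg (Prod t s) \<in> D \<or> mon (Prod t s) = \<zero>\<^bsub>N\<^esub>"
  shows "alg_ideal N (sum_comps step G D)"
  unfolding sum_comps_eq
proof (rule N.span_alg_idealI[OF mons_closed mons_closed N_span])
  note sc = N.span_closed[OF mons_closed]
  have l: "mon t \<otimes>\<^bsub>N\<^esub> mon s \<in> lspan N (mons D)"
    if "letters t \<subseteq> V" "letters s \<subseteq> V" "multideg s \<in> D" for t s
    using assms[OF that]
  proof
    assume "multideg (Prod t s) \<in> D"
    then have "mon (Prod t s) \<in> mons D" using that by fastforce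
    then show ?thesis using N.in_own_span[OF mons_closed] by auto
  next
    assume "mon (Prod t s) = \<zero>\<^bsub>N\<^esub>"
    then show ?thesis using sc(1) by simp
  qed
  show "t \<otimes>\<^bsub>N\<^esub> s \<in> lspan N (mons D)" if "t \<in> mons UNIV" "s \<in> mons D" for t s
    using that l by auto
  show "s \<otimes>\<^bsub>N\<^esub> t \<in> lspan N (mons D)" if ts: "t \<in> mons UNIV" "s \<in> mons D" for t s
  proof -
    obtain t' s' where *: "t = mon t'" "letters t' \<subseteq> V" "s = mon s'" "letters s' \<subseteq> V" "multideg s' \<in> D"
      using ts by auto
    show ?thesis
      unfolding *(1,3) N.bracket_antisym[OF mon_closed[OF *(2)] mon_closed[OF *(4)]]
      by (rule sc(3)[OF l[OF *(2,4,5)]])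
  qed
qed

text \<open>If a product has multidegree \<open>e\<^sub>i + (l - 1) e\<^sub>j\<close>, then one factor has a multidegree
\<open>e\<^sub>i + a e\<^sub>j\<close> with \<open>a < l\<close> and the other one \<open>b e\<^sub>j\<close>.  The former is of chain type, and so is the
latter for \<open>b = 1\<close>; for \<open>b \<ge> 2\<close> the factor is 0.\<close>

lemma alg_ideal_edge:
  assumes "i \<noteq> j"
  shows "alg_ideal N (edge_ideal step G i j c)"
  unfolding edge_ideal_def
proof (rule alg_ideal_sum_comps)
  fix t s :: "'v magma"
  assume V: "letters t \<subseteq> V" "letters s \<subseteq> V" and s: "multideg s \<in> - chain_degs i j c"
  have size: "multideg t + multideg s \<noteq> {#j#}"
  proof
    assume "multideg t + multideg s = {#j#}"
    then have "size (multideg t) + size (multideg s) = 1" by (metis size_single size_union)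
    then show False using size_multideg_pos[of t] size_multideg_pos[of s] by linarith
  qed
  show "multideg (Prod t s) \<in> - chain_degs i j c \<or> mon (Prod t s) = \<zero>\<^bsub>N\<^esub>"
  proof (rule disjCI)
    assume prod: "mon (Prod t s) \<noteq> \<zero>\<^bsub>N\<^esub>"
    have nz: "mon s \<noteq> \<zero>\<^bsub>N\<^esub>"
    proof
      assume "mon s = \<zero>\<^bsub>N\<^esub>"
      then have "mon (Prod t s) = \<zero>\<^bsub>N\<^esub>"
        using N.mult_zero_right[OF mon_closed[OF V(1)]] by (simp only: eval_magma.simps)
      with prod show False by (rule notE)
    qed
    show "multideg (Prod t s) \<in> - chain_degs i j c"
    proof
      assume "multideg (Prod t s) \<in> chain_degs i j c"
      then obtain l where l: "1 \<le> l" "l \<le> c" "multideg t + multideg s = add_mset i (replicate_mset (l - 1) j)"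
        using size by (auto simp: chain_degs_def)
      from l(3) show False
      proof (cases rule: union_eq_add_replicate)
        case (1 a b)
        have "b = 1"
          by (rule ccontr) (rule notE[OF nz N.eval_magma_repeated[OF graph_gens V(2) 1(3)]])
        then show False using s 1(3) by (simp add: chain_degs_def)
      next
        case (2 a b)
        then have "multideg s = {#i#} + replicate_mset (Suc b - 1) j \<and> 1 \<le> Suc b \<and> Suc b \<le> c"
          using l by auto
        then show False using s unfolding chain_degs_def by blast
      qed
    qed
  qed
qed

lemma alg_ideal_chain: "alg_ideal N (chain_ideal \<kappa> G)"
proof -
  let ?S = "sum_comps step G {\<delta>. 3 \<le> size \<delta> \<and> size \<delta> \<le> step} :: ('v magma \<Rightarrow> 'k) set set set set"
  let ?F = "insert ?S ((\<lambda>(i, j). edge_ideal step G i j (\<kappa> (i, j))) ` E)"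
  have S: "alg_ideal N ?S"
  proof (rule alg_ideal_sum_comps)
    fix t s :: "'v magma"
    assume V: "letters t \<subseteq> V" "letters s \<subseteq> V" and s: "multideg s \<in> {\<delta>. 3 \<le> size \<delta> \<and> size \<delta> \<le> step}"
    have "mon (Prod t s) = \<zero>\<^bsub>N\<^esub>" if "step < size (multideg (Prod t s))"
      by (rule eval_magma_graph[OF _ that]) (use V in simp)
    then show "multideg (Prod t s) \<in> {\<delta>. 3 \<le> size \<delta> \<and> size \<delta> \<le> step} \<or> mon (Prod t s) = \<zero>\<^bsub>N\<^esub>"
      using s by (cases "step < size (multideg (Prod t s))") auto
  qed
  have "alg_ideal N (\<Inter>?F)"
    by (rule N.alg_ideal_Inter) (use S alg_ideal_edge arc_neq in auto)
  also have "\<Inter>?F = chain_ideal \<kappa> G"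
    by (auto simp: chain_ideal_def)
  finally show ?thesis .
qed

abbreviation proj :: "('v magma \<Rightarrow> 'k) set set set \<Rightarrow> ('k, 'v) chain_elt" where
  "proj \<equiv> a_r_coset N (chain_ideal \<kappa> G)"

lemma chain_epi:
  "alg_epi N C proj" "x \<in> carrier N \<Longrightarrow> proj x = \<zero>\<^bsub>C\<^esub> \<longleftrightarrow> x \<in> chain_ideal \<kappa> G"
  unfolding chain_lie_def by (rule N.quot_alg_epi[OF alg_ideal_chain])+

sublocale C: lie_algebra C
  by (rule lie_algebra_epi[OF N.lie_algebra_axioms chain_epi(1)])

lemma gen_conv: "gen = (\<lambda>v. proj (graph_lie_gen step G v))"
  by (simp add: chain_gen_def fun_eq_iff)

lemma magma_spans_chain: "magma_spans C V gen"
  unfolding gen_conv by (rule magma_spans_epi[OF N.bilinear_algebra_axioms chain_epi(1) magma_spans_graph])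

lemma gen_closed: "v \<in> V \<Longrightarrow> gen v \<in> carrier C"
  by (rule magma_spans_gen[OF magma_spans_chain])

lemma eval_chain:
  assumes "letters t \<subseteq> V"
  shows "eval_magma C gen t = proj (mon t)"
proof -
  interpret alg_hom_pair N C proj
    by (rule alg_epi_imp_hom[OF N.bilinear_algebra_axioms chain_epi(1)])
  show ?thesis using hom_eval_magma(2)[OF graph_gens assms] by (simp add: gen_conv)
qed

lemma w_simps: "w i j (Suc 0) = gen i" "1 \<le> l \<Longrightarrow> w i j (Suc l) = w i j l \<otimes>\<^bsub>C\<^esub> gen j"
  by (cases l; simp add: chain_w_def)+

lemma w_closed:
  assumes "(i, j) \<in> E" and "1 \<le> l"
  shows "w i j l \<in> carrier C"
  using assms(2)
proof (induction l rule: nat_induct_at_least)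
  case base
  then show ?case using arc_vertices[OF assms(1)] gen_closed by (simp add: w_simps)
next
  case (Suc l)
  then show ?case using arc_vertices[OF assms(1)] gen_closed by (simp add: w_simps C.bracket_closed)
qed

abbreviation basis :: "('k, 'v) chain_elt set" where "basis \<equiv> standard_basis \<kappa> G"

lemma basis_closed: "basis \<subseteq> carrier C"
  using gen_closed w_closed by (auto simp: standard_basis_def)

lemma gen_in_basis: "v \<in> V \<Longrightarrow> gen v \<in> basis"
  by (simp add: standard_basis_def)

lemma w_in_basis: "(i, j) \<in> E \<Longrightarrow> 2 \<le> l \<Longrightarrow> l \<le> \<kappa> (i, j) \<Longrightarrow> w i j l \<in> basis"
  unfolding standard_basis_def by blast

text \<open>The four ways in which a monomial can behave: degree 1 and 2 give vertices and the elements
\<open>w\<^sub>i\<^sub>j\<^sup>2\<close>, degrees above the step vanish by nilpotency, degrees of chain type give multiples of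
\<open>w\<^sub>i\<^sub>j\<^sup>l\<close>, and all other monomials lie in every ideal of which the chain ideal is the
intersection.\<close>

lemma eval_chain_in_span:
  assumes t: "letters t \<subseteq> V"
  shows "eval_magma C gen t \<in> lspan C basis"
proof -
  note sc = C.span_closed[OF basis_closed] and own = subsetD[OF C.in_own_span[OF basis_closed]]
  have gens: "gen ` V \<subseteq> carrier C" using gen_closed by auto
  consider v where "t = Gen v" | u v where "t = Prod (Gen u) (Gen v)" | "3 \<le> size (multideg t)"
  proof (cases t)
    case (Prod r s)
    show ?thesis
    proof (cases "size (multideg r) = 1 \<and> size (multideg s) = 1")
      case True
      then show ?thesis using size_multideg_1[of r] size_multideg_1[of s] that(2) Prod by blast
    next
      case False
      then have "3 \<le> size (multideg r) + size (multideg s)"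
        using size_multideg_pos[of r] size_multideg_pos[of s] by linarith
      then show ?thesis using that(3) Prod by simp
    qed
  qed (use that(1) in blast)
  then show ?thesis
  proof cases
    case (1 v)
    then show ?thesis using t by (auto intro!: own gen_in_basis)
  next
    case (2 u v)
    have V: "u \<in> V" "v \<in> V" using t 2 by auto
    have w2: "w i j 2 = gen i \<otimes>\<^bsub>C\<^esub> gen j" for i j
      using w_simps(1)[of i j] w_simps(2)[where l = 1 and i = i and j = j] by (simp add: numeral_2_eq_2)
    have arc: "gen i \<otimes>\<^bsub>C\<^esub> gen j \<in> lspan C basis" if "(i, j) \<in> E" for i j
      using that kappa_bounds[OF that] unfolding w2[symmetric]
      by (intro own w_in_basis) auto
    consider "(u, v) \<in> E" | "(v, u) \<in> E" | "(u, v) \<in> non_edges G"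
      using V by (auto simp: non_edges_def)
    then show ?thesis
    proof cases
      case 1
      then show ?thesis using arc \<open>t = _\<close> by simp
    next
      case a: 2
      then show ?thesis
        using C.bracket_antisym[OF gen_closed[OF V(2)] gen_closed[OF V(1)]] sc(3)[OF arc[OF a]] \<open>t = _\<close> by simp
    next
      case 3
      have "mon t = \<zero>\<^bsub>N\<^esub>" by (simp add: graph_non_edge[OF 3] \<open>t = _\<close>)
      then show ?thesis
        using eval_chain[OF t] alg_epiD(2)[OF chain_epi(1)] sc(1) by simp
    qed
  next
    case size: 3
    show ?thesis
    proof (cases "step < size (multideg t)")
      case True
      then have "mon t = \<zero>\<^bsub>N\<^esub>" by (rule eval_magma_graph[OF t])
      then show ?thesis
        using eval_chain[OF t] alg_epiD(2)[OF chain_epi(1)] sc(1) by simp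
    next
      case small: False
      show ?thesis
      proof (cases "\<exists>(i, j)\<in>E. multideg t \<in> chain_degs i j (\<kappa> (i, j))")
        case True
        then obtain i j where ij: "(i, j) \<in> E" and "multideg t \<in> chain_degs i j (\<kappa> (i, j))" by auto
        then obtain l where l: "l \<le> \<kappa> (i, j)" and deg: "multideg t = add_mset i (replicate_mset (l - 1) j)"
          using size by (auto simp: chain_degs_def)
        have "3 \<le> l" using size deg by simp
        then have "w i j l \<in> basis" using l ij by (intro w_in_basis) auto
        moreover obtain a where "eval_magma C gen t = a \<odot>\<^bsub>C\<^esub> w i j l"
          using C.eval_magma_chain[OF gens t arc_neq[OF ij] deg] by (auto simp: chain_w_def)
        ultimately show ?thesis using sc(3)[OF own] by simp
      next
        case False
        have "mon t \<in> sum_comps step G D" if "multideg t \<in> D" for D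
          unfolding sum_comps_eq by (rule subsetD[OF N.in_own_span[OF mons_closed]]) (use that t in blast)
        then have "mon t \<in> chain_ideal \<kappa> G"
          unfolding chain_ideal_def edge_ideal_def using size small False by auto
        then have "proj (mon t) = \<zero>\<^bsub>C\<^esub>" using chain_epi(2) mon_closed[OF t] by blast
        then show ?thesis using eval_chain[OF t] sc(1) by simp
      qed
    qed
  qed
qed

lemma basis_spans: "lspan C basis = carrier C"
proof
  show "lspan C basis \<subseteq> carrier C" by (rule C.span_carrier[OF basis_closed])
  have "carrier C \<subseteq> lspan C {eval_magma C gen t | t. letters t \<subseteq> V}"
    using magma_spans_chain by (simp add: magma_spans_def)
  also have "\<dots> \<subseteq> lspan C basis"
    by (rule C.span_is_subset) (use eval_chain_in_span C.span_is_submodule[OF basis_closed] in auto)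
  finally show "carrier C \<subseteq> lspan C basis" .
qed

end

section \<open>Forms that pair off a basis\<close>

lemma dual_spaceD:
  assumes "f \<in> dual_space L"
  shows "x \<in> carrier L \<Longrightarrow> y \<in> carrier L \<Longrightarrow> f (x \<oplus>\<^bsub>L\<^esub> y) = f x + f y"
    and "x \<in> carrier L \<Longrightarrow> f (c \<odot>\<^bsub>L\<^esub> x) = c * f x"
  using assms by (auto simp: dual_space_def)

context bilinear_algebra
begin

lemma dual_zero: "f \<in> dual_space L \<Longrightarrow> f \<zero> = 0"
  using dual_spaceD(2)[of f L "\<zero>" 0] by simp

lemma dual_lincomb:
  assumes f: "f \<in> dual_space L" and "finite A" and "A \<subseteq> carrier L"
  shows "f (lincomb a A) = (\<Sum>v\<in>A. a v * f v)"
  using assms(2,3)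
proof (induction A rule: finite_induct)
  case empty
  then show ?case by (simp add: lincomb_def dual_zero[OF f])
next
  case (insert v A)
  have "lincomb a (insert v A) = a v \<odot>\<^bsub>L\<^esub> v \<oplus> lincomb a A"
    using insert unfolding lincomb_def by (subst M.finsum_insert) auto
  moreover have "lincomb a A \<in> carrier L"
    unfolding lincomb_def by (rule M.finsum_closed) (use insert in auto)
  ultimately show ?case
    using insert by (simp add: dual_spaceD[OF f])
qed

lemma dual_eq_on_carrier:
  assumes "f \<in> dual_space L" and "g \<in> dual_space L" and B: "B \<subseteq> carrier L"
    and "lspan L B = carrier L" and "\<And>b. b \<in> B \<Longrightarrow> f b = g b" and "x \<in> carrier L"
  shows "f x = g x"
proof -
  have "x \<in> lspan L B" using assms by simp
  from this B show ?thesis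
    by (induction rule: span_induct)
      (use assms(5) dual_zero[OF assms(1)] dual_zero[OF assms(2)] dual_spaceD[OF assms(1)] dual_spaceD[OF assms(2)]
        in auto)
qed

lemma basis_of_dual_family:
  assumes fin: "finite B" and B: "B \<subseteq> carrier L" and span: "lspan L B = carrier L"
    and F: "\<And>b. b \<in> B \<Longrightarrow> F b \<in> dual_space L"
    and F_val: "\<And>b b'. b \<in> B \<Longrightarrow> b' \<in> B \<Longrightarrow> F b b' = (if b' = b then 1 else 0)"
  shows "fin_dim" and "dim = card B"
proof -
  show "fin_dim" unfolding fin_dim_def using fin B span by blast
  have "lin_indpt B"
  proof (rule finite_lin_indpt2[OF fin B])
    fix a assume 0: "lincomb a B = \<zero>"
    have "a b = 0" if b: "b \<in> B" for b
    proof -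
      have "0 = F b (lincomb a B)" using 0 dual_zero[OF F[OF b]] by simp
      also have "\<dots> = (\<Sum>v\<in>B. a v * (if v = b then 1 else 0))"
        using F_val[OF b] by (simp add: dual_lincomb[OF F[OF b] fin B])
      also have "\<dots> = a b" using fin b by (simp add: if_distrib[of "(*) _"] cong: if_cong)
      finally show ?thesis by simp
    qed
    then show "\<forall>v\<in>B. a v = \<zero>\<^bsub>class_ring\<^esub>" by simp
  qed
  then have "basis B" unfolding basis_def using B span by simp
  then show "dim = card B" by (rule dim_basis[OF fin])
qed

end

text \<open>The elements \<open>a p\<close> and \<open>b p\<close> form a basis with dual basis \<open>F\<close>, and the form is
\<open>\<Sum> c\<^sub>p (a p)\<^sup>* \<and> (b p)\<^sup>*\<close>.  The top power is evaluated on the sequence in which \<open>a p\<close> and \<open>b p\<close>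
stand next to each other.\<close>

lemma symplectic_form_of_pairing:
  fixes L :: "('k::field_char_0, 'a) module" and F :: "'a \<Rightarrow> 'a \<Rightarrow> 'k" and a b :: "'p \<Rightarrow> 'a" and P :: "'p set"
  defines "B \<equiv> a ` P \<union> b ` P"
  assumes L: "lie_algebra L"
    and P: "finite P" "inj_on a P" "inj_on b P" "a ` P \<inter> b ` P = {}" "P \<noteq> {}"
    and B: "B \<subseteq> carrier L" and span: "lspan L B = carrier L"
    and F: "\<And>u. u \<in> B \<Longrightarrow> F u \<in> dual_space L"
    and F_val: "\<And>u v. u \<in> B \<Longrightarrow> v \<in> B \<Longrightarrow> F u v = (if v = u then 1 else 0)"
    and c: "\<And>p. p \<in> P \<Longrightarrow> c p \<noteq> 0"
    and \<omega>: "\<And>x. \<omega> x = (\<Sum>p\<in>P. c p * (F (a p) (x 0) * F (b p) (x 1) - F (a p) (x 1) * F (b p) (x 0)))"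
    and closed: "\<And>x. range x \<subseteq> carrier L \<Longrightarrow> diff2 L \<omega> x = 0"
  shows "symplectic_form L \<omega>"
proof -
  interpret lie_algebra L by fact
  define Q where "Q u v = (\<Sum>p\<in>P. c p * (F (a p) u * F (b p) v - F (a p) v * F (b p) u))" for u v
  have \<omega>Q: "\<omega> = (\<lambda>x. Q (x 0) (x 1))" by (simp add: fun_eq_iff \<omega> Q_def)
  have skew: "Q v u = - Q u v" for u v
    unfolding Q_def by (simp add: sum_negf[symmetric] algebra_simps)
  have self: "Q u u = 0" for u unfolding Q_def by simp
  have aB: "a p \<in> B" and bB: "b p \<in> B" if "p \<in> P" for p using that by (auto simp: B_def)
  have lin: "(\<lambda>u. Q u v) \<in> dual_space L" for v
    unfolding dual_space_def Q_def
    by (auto simp: dual_spaceD[OF F[OF aB]] dual_spaceD[OF F[OF bB]] sum.distrib[symmetric]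
        sum_distrib_left algebra_simps intro!: sum.cong)
  have lin': "(\<lambda>v. Q u v) \<in> dual_space L" for u
    using lin[of u] unfolding skew[of u] by (auto simp: dual_space_def)
  have fin: "finite B" using P(1) by (simp add: B_def)
  have alt: "\<omega> \<in> alt_forms L 2"
    unfolding alt_forms_def \<omega>Q
  proof (intro CollectI conjI allI impI)
    fix x y :: "nat \<Rightarrow> 'a" assume "\<forall>i<2. x i = y i"
    then show "Q (x 0) (x 1) = Q (y 0) (y 1)" by simp
  next
    fix x :: "nat \<Rightarrow> 'a" and i :: nat
    assume "i < 2"
    then consider "i = 0" | "i = 1" by linarith
    then show "(\<lambda>u. Q ((x(i := u)) 0) ((x(i := u)) 1)) \<in> dual_space L"
      by cases (simp_all add: lin lin')
  next
    fix x :: "nat \<Rightarrow> 'a" and i j :: nat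
    assume "i < 2" "j < 2" "i \<noteq> j \<and> x i = x j"
    then have "x 0 = x 1" by (metis less_2_cases One_nat_def)
    then show "Q (x 0) (x 1) = 0" using self by simp
  qed
  note dim = basis_of_dual_family[OF fin B span F F_val]
  have card: "card B = 2 * card P"
    unfolding B_def using P by (simp add: card_Un_disjoint card_image)
  obtain f where f: "bij_betw f {..<card P} P"
    using ex_bij_betw_nat_finite[OF P(1)] unfolding atLeast0LessThan by blast
  obtain p\<^sub>0 where p0: "p\<^sub>0 \<in> P" using P(5) by blast
  \<comment> \<open>Only the first \<open>2 * card P\<close> arguments matter, but all of them have to lie in the carrier.\<close>
  define x where "x m = (if m < 2 * card P then (if even m then a else b) (f (m div 2)) else a p\<^sub>0)" for m
  have fP: "f i \<in> P" if "i < card P" for i using f that by (auto simp: bij_betw_def)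
  have x_even: "x (2 * i) = a (f i)" and x_odd: "x (2 * i + 1) = b (f i)" if "i < card P" for i
    using that by (auto simp: x_def)
  have xL: "range x \<subseteq> carrier L"
    using B aB bB fP p0 by (auto simp: x_def split: if_splits)
  have ab: "a p \<noteq> b q" if "p \<in> P" "q \<in> P" for p q using P(4) that by auto
  have Qaa: "Q (a p) (a q) = 0" if "p \<in> P" "q \<in> P" for p q
    unfolding Q_def using that ab by (intro sum.neutral) (auto simp: F_val aB bB)
  have Qbb: "Q (b p) (b q) = 0" if "p \<in> P" "q \<in> P" for p q
    unfolding Q_def using that ab by (intro sum.neutral) (auto simp: F_val aB bB dest: sym)
  have Qab: "Q (a p) (b q) = (if p = q then c p else 0)" if pq: "p \<in> P" "q \<in> P" for p q
  proof -
    have "Q (a p) (b q) = (\<Sum>r\<in>P. if r = p then (if p = q then c p else 0) else 0)"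
      unfolding Q_def
    proof (rule sum.cong[OF refl])
      fix r assume r: "r \<in> P"
      have "F (a r) (a p) = (if p = r then 1 else 0)" "F (b r) (b q) = (if q = r then 1 else 0)"
        using F_val[OF aB[OF r] aB[OF pq(1)]] F_val[OF bB[OF r] bB[OF pq(2)]]
          inj_onD[OF P(2) _ pq(1) r] inj_onD[OF P(3) _ pq(2) r] by auto
      moreover have "F (a r) (b q) = 0"
        using F_val[OF aB[OF r] bB[OF pq(2)]] ab[OF r pq(2)] by auto
      ultimately show "c r * (F (a r) (a p) * F (b r) (b q) - F (a r) (b q) * F (b r) (a p)) =
          (if r = p then (if p = q then c p else 0) else 0)" by auto
    qed
    then show ?thesis using P(1) pq(1) by simp
  qed
  have Qba: "Q (b p) (a q) = (if q = p then - c q else 0)" if "p \<in> P" "q \<in> P" for p q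
    unfolding skew[of "b p" "a q"] Qab[OF that(2,1)] by simp
  have "wedge_power \<omega> (card P) x \<noteq> 0"
    unfolding \<omega>Q
  proof (rule wedge_power_symplectic_basis)
    fix m k assume mk: "m < 2 * card P" "k < 2 * card P" "m div 2 \<noteq> k div 2"
    have lt: "m div 2 < card P" "k div 2 < card P" using mk by auto
    have ne: "f (m div 2) \<noteq> f (k div 2)"
      using f lt mk(3) by (auto simp: bij_betw_def inj_on_def)
    show "Q (x m) (x k) = 0"
      using mk(1,2) Qaa Qbb Qab Qba fP[OF lt(1)] fP[OF lt(2)] ne
      by (auto simp: x_def)
  next
    show "Q (x (2 * i + 1)) (x (2 * i)) = - Q (x (2 * i)) (x (2 * i + 1))" for i by (rule skew)
    show "Q (x (2 * i)) (x (2 * i + 1)) \<noteq> 0" if "i < card P" for i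
      unfolding x_even[OF that] x_odd[OF that] using Qab[OF fP[OF that] fP[OF that]] c[OF fP[OF that]] by simp
  qed
  then show ?thesis
    unfolding symplectic_form_def using L dim card alt closed xL by auto
qed

section \<open>Assignments of the generators\<close>

lemma eval_magma_cong:
  "(\<And>v. v \<in> letters t \<Longrightarrow> g v = g' v) \<Longrightarrow> eval_magma L g t = eval_magma L g' t"
  by (induction t) auto

text \<open>In coordinates of the filiform algebra, \<open>v\<^sub>i\<close> goes to \<open>x\<^sub>1\<close> and \<open>v\<^sub>j\<close> to \<open>y\<close>.\<close>

definition edge_gens :: "'v \<Rightarrow> 'v \<Rightarrow> 'v \<Rightarrow> nat \<Rightarrow> 'k::field" where
  "edge_gens i j v l = (if v = i \<and> l = 1 \<or> v = j \<and> l = 0 then 1 else 0)"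

lemma edge_gens_bracket:
  assumes "(u, v) \<noteq> (i, j)" and "(v, u) \<noteq> (i, j)"
  shows "edge_gens i j u \<otimes>\<^bsub>filiform_alg c\<^esub> edge_gens i j v = (\<lambda>_. 0)"
  using assms by (auto simp: edge_gens_def fun_eq_iff)

text \<open>The assignment is graded: \<open>y\<close> has multidegree \<open>e\<^sub>j\<close> and \<open>x\<^sub>l\<close> has multidegree
\<open>e\<^sub>i + (l - 1) e\<^sub>j\<close>.  These are exactly the multidegrees that the ideal of the arc leaves out.\<close>

lemma eval_edge_gens:
  assumes "i \<noteq> j" and "1 \<le> c" and "eval_magma (filiform_alg c) (edge_gens i j) t l \<noteq> (0 :: 'k::field)"
  shows "l = 0 \<and> multideg t = {#j#} \<or> 1 \<le> l \<and> l \<le> c \<and> multideg t = add_mset i (replicate_mset (l - 1) j)"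
  using assms(3)
proof (induction t arbitrary: l)
  case (Gen v)
  then show ?case using assms(1,2) by (auto simp: edge_gens_def split: if_splits)
next
  case (Prod r s)
  let ?e = "eval_magma (filiform_alg c) (edge_gens i j) :: _ \<Rightarrow> nat \<Rightarrow> 'k"
  have l: "2 \<le> l" "l \<le> c" and
    "?e r (l - 1) \<noteq> 0 \<and> ?e s 0 \<noteq> 0 \<or> ?e s (l - 1) \<noteq> 0 \<and> ?e r 0 \<noteq> 0"
    using Prod.prems by (auto split: if_splits)
  moreover have rep: "replicate_mset (l - Suc 0) j = add_mset j (replicate_mset (l - Suc 0 - Suc 0) j)"
    using l(1) by (cases "l - Suc 0") auto
  ultimately have "multideg r + multideg s = add_mset i (replicate_mset (l - 1) j)"
    using Prod.IH(1)[of "l - 1"] Prod.IH(1)[of 0] Prod.IH(2)[of "l - 1"] Prod.IH(2)[of 0]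
    by auto
  then show ?case using l by simp
qed

text \<open>Used with \<open>c = 1\<close>, where the filiform algebra is abelian.  It also covers isolated vertices, on which
no arc gives a coordinate.\<close>

definition vertex_gens :: "'v \<Rightarrow> 'v \<Rightarrow> nat \<Rightarrow> 'k::field" where
  "vertex_gens v u l = (if u = v \<and> l = 1 then 1 else 0)"

section \<open>A closed form on the filiform algebra\<close>

text \<open>In coordinates, \<open>\<sigma>\<^sub>i\<^sub>j\<close> for \<open>\<kappa>\<^sub>i\<^sub>j = 2n\<close>.\<close>

definition chain_form :: "nat \<Rightarrow> (nat \<Rightarrow> 'k::field) \<Rightarrow> (nat \<Rightarrow> 'k) \<Rightarrow> 'k" where
  "chain_form n u v = (\<Sum>l = 1..n. (-1) ^ (l + 1) * (u l * v (2 * n + 1 - l) - v l * u (2 * n + 1 - l)))"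

lemma alternating_telescope:
  "(\<Sum>l = 1..n. (-1) ^ (l + 1) * (U (l - 1) + U l)) = U 0 - (-1) ^ n * (U n :: 'k::field)"
  by (induction n) (auto simp: algebra_simps)

text \<open>With \<open>T a c\<close> the value of \<open>x\<^sub>a\<^sup>* \<and> y\<^sup>* \<and> x\<^sub>c\<^sup>*\<close>, where \<open>x\<^sub>0\<^sup>* = 0\<close>, the rule \<open>d x\<^sub>l\<^sup>* = x\<^sub>l\<^sub>-\<^sub>1\<^sup>* \<and> y\<^sup>*\<close>
turns the \<open>l\<close>-th summand, up to its sign, into \<open>T (l - 1) (2n + 1 - l) + T l (2n - l)\<close>.  The alternating sum telescopes
to \<open>T 0 (2n) = 0\<close> and \<open>T n n = 0\<close>.\<close>

lemma chain_form_closed: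
  fixes x y z :: "nat \<Rightarrow> 'k::field_char_0" and n :: nat
  defines "B \<equiv> filiform_alg (2 * n)"
  shows "chain_form n (x \<otimes>\<^bsub>B\<^esub> y) z + chain_form n (y \<otimes>\<^bsub>B\<^esub> z) x + chain_form n (z \<otimes>\<^bsub>B\<^esub> x) y = 0"
proof -
  \<comment> \<open>The index 0 of a sequence is the coordinate of \<open>y\<close>; \<open>q\<close> replaces it by the convention
    \<open>x\<^sub>0\<^sup>* = 0\<close>, so that the rule for \<open>d\<close> also covers \<open>l = 1\<close>.\<close>
  define q where "q u l = (if l = 0 then 0 else u l)" for u :: "nat \<Rightarrow> 'k" and l
  define T where "T a c = (q x a * y 0 - q y a * x 0) * q z c + (q y a * z 0 - q z a * y 0) * q x c
     + (q z a * x 0 - q x a * z 0) * q y c" for a c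
  define U where "U l = T l (2 * n - l)" for l
  have T_anti: "T a c = - T c a" for a c by (simp add: T_def algebra_simps)
  have T_self: "T a a = 0" for a using T_anti[of a a] by (simp add: eq_neg_iff_add_eq_0)
  have br: "(u \<otimes>\<^bsub>B\<^esub> v) l = q u (l - 1) * v 0 - q v (l - 1) * u 0" if "1 \<le> l" "l \<le> 2 * n" for u v l
    using that by (auto simp: B_def q_def)
  have "chain_form n (x \<otimes>\<^bsub>B\<^esub> y) z + chain_form n (y \<otimes>\<^bsub>B\<^esub> z) x + chain_form n (z \<otimes>\<^bsub>B\<^esub> x) y =
     (\<Sum>l = 1..n. (-1) ^ (l + 1) * (U (l - 1) + U l))"
    unfolding chain_form_def sum.distrib[symmetric]
  proof (rule sum.cong[OF refl])
    fix l assume "l \<in> {1..n}"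
    then have l: "1 \<le> l" "l \<le> 2 * n" "1 \<le> 2 * n + 1 - l" "2 * n + 1 - l \<le> 2 * n"
      "2 * n + 1 - l - 1 = 2 * n - l" "2 * n - (l - 1) = 2 * n + 1 - l" by auto
    have qs: "u l = q u l" "u (2 * n + 1 - l) = q u (2 * n + 1 - l)" for u
      using l by (auto simp: q_def)
    have "U (l - 1) + U l = T (l - 1) (2 * n + 1 - l) - T (2 * n - l) l"
      unfolding U_def l(6) by (subst T_anti[of l]) simp
    also have "\<dots> = ((x \<otimes>\<^bsub>B\<^esub> y) l * z (2 * n + 1 - l) - z l * (x \<otimes>\<^bsub>B\<^esub> y) (2 * n + 1 - l))
      + ((y \<otimes>\<^bsub>B\<^esub> z) l * x (2 * n + 1 - l) - x l * (y \<otimes>\<^bsub>B\<^esub> z) (2 * n + 1 - l))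
      + ((z \<otimes>\<^bsub>B\<^esub> x) l * y (2 * n + 1 - l) - y l * (z \<otimes>\<^bsub>B\<^esub> x) (2 * n + 1 - l))"
      unfolding br[OF l(1,2)] br[OF l(3,4)] l(5) qs[of x] qs[of y] qs[of z] T_def
      by (simp add: algebra_simps)
    finally show "(-1) ^ (l + 1) * ((x \<otimes>\<^bsub>B\<^esub> y) l * z (2 * n + 1 - l) - z l * (x \<otimes>\<^bsub>B\<^esub> y) (2 * n + 1 - l))
      + (-1) ^ (l + 1) * ((y \<otimes>\<^bsub>B\<^esub> z) l * x (2 * n + 1 - l) - x l * (y \<otimes>\<^bsub>B\<^esub> z) (2 * n + 1 - l))
      + (-1) ^ (l + 1) * ((z \<otimes>\<^bsub>B\<^esub> x) l * y (2 * n + 1 - l) - y l * (z \<otimes>\<^bsub>B\<^esub> x) (2 * n + 1 - l)) =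
      (-1) ^ (l + 1) * (U (l - 1) + U l)"
      by (simp only: distrib_left)
  qed
  also have "\<dots> = U 0 - (-1) ^ n * U n" by (rule alternating_telescope)
  also have "U 0 = 0"
    unfolding U_def by (subst T_anti) (simp add: T_def q_def algebra_simps)
  also have "U n = 0" using T_self[of n] by (simp add: U_def mult_2)
  finally show ?thesis by simp
qed

section \<open>The dual basis\<close>

context chain_algebra
begin

text \<open>The homomorphism must vanish on the chain ideal.  Since the chain ideal lies in a sum of homogeneous
components, it suffices to check monomials of the degrees in question.\<close>

lemma chain_universal:
  fixes e :: "'v \<Rightarrow> nat \<Rightarrow> 'k"
  assumes c: "c \<le> step"
    and ne: "\<And>u v. (u, v) \<in> non_edges G \<Longrightarrow> e u \<otimes>\<^bsub>filiform_alg c\<^esub> e v = \<zero>\<^bsub>filiform_alg c\<^esub>"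
    and D: "(chain_ideal \<kappa> G :: ('v magma \<Rightarrow> 'k) set set set set) \<subseteq> sum_comps step G D"
    and van: "\<And>t. letters t \<subseteq> V \<Longrightarrow> multideg t \<in> D \<Longrightarrow> eval_magma (filiform_alg c) e t = \<zero>\<^bsub>filiform_alg c\<^esub>"
  shows "\<exists>h. alg_hom C (filiform_alg c) h \<and> (\<forall>v\<in>V. h (gen v) = e v)"
proof -
  interpret B: lie_algebra "filiform_alg c :: ('k, nat \<Rightarrow> 'k) module" by (rule lie_algebra_filiform)
  obtain h where h: "alg_hom N (filiform_alg c) h"
    and hv: "\<And>v. v \<in> V \<Longrightarrow> h (graph_lie_gen step G v) = e v"
    using graph_universal[of step c G e, OF step_pos c ne] by blast
  interpret H: alg_hom_pair N "filiform_alg c" h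
    by (intro alg_hom_pairI h B.bilinear_algebra_axioms N.bilinear_algebra_axioms)
  have h_mon: "h (mon t) = eval_magma (filiform_alg c) e t" if "letters t \<subseteq> V" for t
    unfolding H.hom_eval_magma(2)[OF graph_gens that]
    by (rule eval_magma_cong) (use that hv in auto)
  have ker: "h x = \<zero>\<^bsub>filiform_alg c\<^esub>" if "x \<in> carrier N" "proj x = \<zero>\<^bsub>C\<^esub>" for x
  proof -
    have "x \<in> lspan N (mons D)" using that chain_epi(2) D unfolding sum_comps_eq by blast
    from this mons_closed show ?thesis
    proof (induction rule: N.span_induct)
      case zero show ?case by (rule H.hom_zero)
    next
      case (gen s)
      then show ?case using h_mon van by auto
    next
      case (add x y)
      then show ?case by (simp add: H.hom_simps)
    next
      case (smult a x)
      then show ?case by (simp add: H.hom_simps)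
    qed
  qed
  obtain h' where hom': "alg_hom C (filiform_alg c) h'"
    and h': "\<And>x. x \<in> carrier N \<Longrightarrow> h' (proj x) = h x"
    using H.hom_lift[OF chain_epi(1) ker] by blast
  have "h' (gen v) = e v" if v: "v \<in> V" for v
  proof -
    have "graph_lie_gen step G v \<in> carrier N" using graph_gens v by auto
    then show ?thesis by (simp add: gen_conv h' hv[OF v])
  qed
  then show ?thesis using hom' by blast
qed

lemma edge_hom_exists:
  assumes ij: "(i, j) \<in> E"
  shows "\<exists>h. alg_hom C (filiform_alg (\<kappa> (i, j))) h \<and> (\<forall>v\<in>V. h (gen v) = edge_gens i j v)"
proof (rule chain_universal)
  show "\<kappa> (i, j) \<le> step" using kappa_bounds[OF ij] by simp
  show "edge_gens i j u \<otimes>\<^bsub>filiform_alg (\<kappa> (i, j))\<^esub> edge_gens i j v = \<zero>\<^bsub>filiform_alg (\<kappa> (i, j))\<^esub>"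
    if "(u, v) \<in> non_edges G" for u v
    using edge_gens_bracket[of u v i j] that ij by (auto simp: non_edges_def simp del: filiform_sel(2))
  show "(chain_ideal \<kappa> G :: ('v magma \<Rightarrow> 'k) set set set set) \<subseteq> sum_comps step G (- chain_degs i j (\<kappa> (i, j)))"
    using ij unfolding chain_ideal_def edge_ideal_def by blast
  show "eval_magma (filiform_alg (\<kappa> (i, j))) (edge_gens i j) t = \<zero>\<^bsub>filiform_alg (\<kappa> (i, j))\<^esub>"
    if t: "multideg t \<in> - chain_degs i j (\<kappa> (i, j))" for t
  proof (rule ext, rule ccontr)
    fix l
    assume "eval_magma (filiform_alg (\<kappa> (i, j))) (edge_gens i j) t l \<noteq> \<zero>\<^bsub>filiform_alg (\<kappa> (i, j))\<^esub> l"
    from eval_edge_gens[OF arc_neq[OF ij] _ this[unfolded filiform_sel]] kappa_bounds[OF ij]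
    have "multideg t \<in> chain_degs i j (\<kappa> (i, j))" by (auto simp: chain_degs_def)
    with t show False by simp
  qed
qed

lemma vertex_hom_exists:
  "\<exists>h. alg_hom C (filiform_alg 1) h \<and> (\<forall>u\<in>V. h (gen u) = vertex_gens v u)"
proof (rule chain_universal)
  show "1 \<le> step" by (rule step_pos)
  show "vertex_gens v u \<otimes>\<^bsub>filiform_alg 1\<^esub> vertex_gens v u' = \<zero>\<^bsub>filiform_alg 1\<^esub>" for u u'
    by (simp add: fun_eq_iff)
  show "(chain_ideal \<kappa> G :: ('v magma \<Rightarrow> 'k) set set set set) \<subseteq>
      sum_comps step G {\<delta>. 3 \<le> size \<delta> \<and> size \<delta> \<le> step}"
    unfolding chain_ideal_def by blast
  show "eval_magma (filiform_alg 1) (vertex_gens v) t = \<zero>\<^bsub>filiform_alg 1\<^esub>"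
    if "multideg t \<in> {\<delta>. 3 \<le> size \<delta> \<and> size \<delta> \<le> step}" for t
    using that by (cases t) (auto simp: fun_eq_iff)
qed

text \<open>The values on the generators determine the homomorphism on the carrier, so the choice only concerns
arguments outside of it.\<close>

definition edge_coord :: "'v \<Rightarrow> 'v \<Rightarrow> ('k, 'v) chain_elt \<Rightarrow> nat \<Rightarrow> 'k" where
  "edge_coord i j = (SOME h. alg_hom C (filiform_alg (\<kappa> (i, j))) h \<and> (\<forall>v\<in>V. h (gen v) = edge_gens i j v))"

definition vertex_coord :: "'v \<Rightarrow> ('k, 'v) chain_elt \<Rightarrow> nat \<Rightarrow> 'k" where
  "vertex_coord v = (SOME h. alg_hom C (filiform_alg 1) h \<and> (\<forall>u\<in>V. h (gen u) = vertex_gens v u))"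

lemma edge_coord:
  assumes "(i, j) \<in> E"
  shows "alg_hom C (filiform_alg (\<kappa> (i, j))) (edge_coord i j)"
    and "v \<in> V \<Longrightarrow> edge_coord i j (gen v) = edge_gens i j v"
  using someI_ex[OF edge_hom_exists[OF assms]] unfolding edge_coord_def by blast+

lemma vertex_coord:
  shows "alg_hom C (filiform_alg 1) (vertex_coord v)"
    and "u \<in> V \<Longrightarrow> vertex_coord v (gen u) = vertex_gens v u"
  using someI_ex[OF vertex_hom_exists[of v]] unfolding vertex_coord_def by blast+

lemma coord_dual:
  assumes "alg_hom C (filiform_alg c) h"
  shows "(\<lambda>x. h x l) \<in> dual_space C"
  using alg_homD[OF assms] by (auto simp: dual_space_def)

lemma edge_coord_w_same:
  assumes ij: "(i, j) \<in> E" and "1 \<le> l" and "l \<le> \<kappa> (i, j)"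
  shows "edge_coord i j (w i j l) = (\<lambda>m. if m = l then 1 else 0)"
  using assms(2,3)
proof (induction l rule: nat_induct_at_least)
  case base
  then show ?case
    using arc_neq[OF ij] arc_vertices[OF ij] by (auto simp: w_simps edge_coord(2)[OF ij] edge_gens_def)
next
  case (Suc l)
  have "edge_coord i j (w i j (Suc l)) =
      edge_coord i j (w i j l) \<otimes>\<^bsub>filiform_alg (\<kappa> (i, j))\<^esub> edge_coord i j (gen j)"
    using alg_homD(3)[OF edge_coord(1)[OF ij] w_closed[OF ij Suc.hyps(1)] gen_closed] arc_vertices[OF ij] Suc.hyps
    by (simp add: w_simps)
  then show ?case
    using Suc arc_vertices[OF ij] arc_neq[OF ij]
    by (auto simp: edge_coord(2)[OF ij] edge_gens_def fun_eq_iff)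
qed

text \<open>The first bracket \<open>[v\<^sub>i', v\<^sub>j']\<close> of another arc is already mapped to 0, because the two arcs have
different sets of end points.\<close>

lemma edge_coord_w_other:
  assumes ij: "(i, j) \<in> E" and ij': "(i', j') \<in> E" "(i', j') \<noteq> (i, j)" and "2 \<le> l"
  shows "edge_coord i j (w i' j' l) = (\<lambda>_. 0)"
  using assms(4)
proof (induction l rule: nat_induct_at_least)
  note V = arc_vertices[OF ij'(1)]
  have ne: "(j', i') \<noteq> (i, j)" using arc_asym[OF ij] ij' by auto
  case base
  have "w i' j' 2 = gen i' \<otimes>\<^bsub>C\<^esub> gen j'"
    using w_simps(1)[of i' j'] w_simps(2)[where l = 1 and i = i' and j = j'] by (simp add: numeral_2_eq_2)
  then have "edge_coord i j (w i' j' 2) = edge_gens i j i' \<otimes>\<^bsub>filiform_alg (\<kappa> (i, j))\<^esub> edge_gens i j j'"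
    using alg_homD(3)[OF edge_coord(1)[OF ij] gen_closed gen_closed] V by (simp add: edge_coord(2)[OF ij] del: filiform_sel(2))
  then show ?case using edge_gens_bracket[OF ij'(2) ne] by simp
next
  case (Suc l)
  then have "edge_coord i j (w i' j' (Suc l)) =
      edge_coord i j (w i' j' l) \<otimes>\<^bsub>filiform_alg (\<kappa> (i, j))\<^esub> edge_coord i j (gen j')"
    using alg_homD(3)[OF edge_coord(1)[OF ij] w_closed[OF ij'(1)] gen_closed] arc_vertices[OF ij'(1)]
    by (simp add: w_simps del: filiform_sel(2))
  then show ?case using Suc.IH by (simp add: fun_eq_iff)
qed

lemma vertex_coord_bracket:
  "x \<in> carrier C \<Longrightarrow> y \<in> carrier C \<Longrightarrow> vertex_coord v (x \<otimes>\<^bsub>C\<^esub> y) = (\<lambda>_. 0)"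
  using alg_homD(3)[OF vertex_coord(1)[of v]] by (simp add: fun_eq_iff)

lemma vertex_coord_w:
  assumes ij: "(i, j) \<in> E" and "2 \<le> l"
  shows "vertex_coord v (w i j l) = (\<lambda>_. 0)"
proof -
  obtain l' where l: "l = Suc l'" "1 \<le> l'" using assms(2) by (cases l) auto
  show ?thesis
    unfolding l(1) w_simps(2)[OF l(2)]
    using vertex_coord_bracket w_closed[OF ij l(2)] gen_closed arc_vertices[OF ij] by blast
qed

lemma basis_cases:
  assumes "b \<in> basis"
  obtains v where "v \<in> V" "b = gen v"
  | i j l where "(i, j) \<in> E" "2 \<le> l" "l \<le> \<kappa> (i, j)" "b = w i j l"
  using assms unfolding standard_basis_def by blast

text \<open>The functional underlying \<^const>\<open>dual_elt\<close>.\<close>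

definition dual_fun :: "('k, 'v) chain_elt \<Rightarrow> ('k, 'v) chain_elt \<Rightarrow> 'k" where
  "dual_fun b = (SOME f. f \<in> dual_space C \<and> (\<forall>b'\<in>basis. f b' = (if b' = b then 1 else 0)))"

lemma chain_dual_conv: "chain_dual \<kappa> G b = one_form (dual_fun b)"
  by (simp add: dual_elt_def dual_fun_def)

text \<open>Exhibiting a functional that separates \<open>b\<close> from the rest of the basis shows both that the dual
basis element exists and that it equals this functional, since the basis spans.\<close>

lemma dual_fun_unique:
  assumes f: "f \<in> dual_space C" and one: "f b = 1" and zero: "\<And>b'. b' \<in> basis \<Longrightarrow> b' \<noteq> b \<Longrightarrow> f b' = 0"
  shows "dual_fun b \<in> dual_space C" and "\<And>b'. b' \<in> basis \<Longrightarrow> dual_fun b b' = (if b' = b then 1 else 0)"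
    and "\<And>x. x \<in> carrier C \<Longrightarrow> dual_fun b x = f x"
proof -
  have "\<exists>f. f \<in> dual_space C \<and> (\<forall>b'\<in>basis. f b' = (if b' = b then 1 else 0))"
    using assms by (intro exI[of _ f]) auto
  from someI_ex[OF this] have F: "dual_fun b \<in> dual_space C"
    "\<And>b'. b' \<in> basis \<Longrightarrow> dual_fun b b' = (if b' = b then 1 else 0)"
    unfolding dual_fun_def by blast+
  show "dual_fun b \<in> dual_space C" "\<And>b'. b' \<in> basis \<Longrightarrow> dual_fun b b' = (if b' = b then 1 else 0)"
    by (fact F)+
  show "dual_fun b x = f x" if x: "x \<in> carrier C" for x
    by (rule C.dual_eq_on_carrier[OF F(1) f basis_closed basis_spans _ x])
      (use F(2) one zero in auto)
qed

lemma edge_coord_separates_w: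
  assumes ij: "(i, j) \<in> E" and l: "1 \<le> l" "l \<le> \<kappa> (i, j)"
  shows "edge_coord i j (w i j l) l = 1"
    and "b \<in> basis \<Longrightarrow> b \<noteq> w i j l \<Longrightarrow> edge_coord i j b l = 0"
proof -
  show "edge_coord i j (w i j l) l = 1" by (simp add: edge_coord_w_same[OF assms])
  assume "b \<in> basis" and ne: "b \<noteq> w i j l"
  then show "edge_coord i j b l = 0"
  proof (cases rule: basis_cases)
    case (1 v)
    then show ?thesis using l ne by (auto simp: edge_coord(2)[OF ij] edge_gens_def w_simps)
  next
    case (2 i' j' l')
    then show ?thesis
      using ne edge_coord_w_same[OF ij, of l'] edge_coord_w_other[OF ij 2(1) _ 2(2)]
      by (cases "(i', j') = (i, j)") auto
  qed
qed

lemma vertex_coord_separates: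
  assumes v: "v \<in> V"
  shows "vertex_coord v (gen v) 1 = 1"
    and "b \<in> basis \<Longrightarrow> b \<noteq> gen v \<Longrightarrow> vertex_coord v b 1 = 0"
proof -
  show "vertex_coord v (gen v) 1 = 1" using v by (simp add: vertex_coord(2) vertex_gens_def)
  assume "b \<in> basis" and ne: "b \<noteq> gen v"
  then show "vertex_coord v b 1 = 0"
    by (cases rule: basis_cases) (auto simp: vertex_coord(2) vertex_gens_def vertex_coord_w)
qed

lemma dual_fun_w:
  assumes "(i, j) \<in> E" and "1 \<le> l" and "l \<le> \<kappa> (i, j)"
  shows "dual_fun (w i j l) \<in> dual_space C"
    and "\<And>b. b \<in> basis \<Longrightarrow> dual_fun (w i j l) b = (if b = w i j l then 1 else 0)"
    and "\<And>x. x \<in> carrier C \<Longrightarrow> dual_fun (w i j l) x = edge_coord i j x l"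
  using dual_fun_unique[OF coord_dual[OF edge_coord(1)[OF assms(1)]] edge_coord_separates_w[OF assms]]
  by auto

lemma dual_fun_gen:
  assumes "v \<in> V"
  shows "dual_fun (gen v) \<in> dual_space C"
    and "\<And>b. b \<in> basis \<Longrightarrow> dual_fun (gen v) b = (if b = gen v then 1 else 0)"
    and "\<And>x. x \<in> carrier C \<Longrightarrow> dual_fun (gen v) x = vertex_coord v x 1"
  using dual_fun_unique[OF coord_dual[OF vertex_coord(1)] vertex_coord_separates[OF assms]]
  by auto

lemma dual_fun_basis:
  assumes "b \<in> basis"
  shows "dual_fun b \<in> dual_space C" and "b' \<in> basis \<Longrightarrow> dual_fun b b' = (if b' = b then 1 else 0)"
proof -
  have "dual_fun b \<in> dual_space C \<and> (\<forall>b'\<in>basis. dual_fun b b' = (if b' = b then 1 else 0))"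
    using assms
  proof (cases rule: basis_cases)
    case (1 v)
    then show ?thesis using dual_fun_gen[OF 1(1)] by simp
  next
    case (2 i j l)
    then have "1 \<le> l" by simp
    then show ?thesis
      unfolding 2(4) using dual_fun_w(1,2)[OF 2(1) \<open>1 \<le> l\<close> 2(3)] by simp
  qed
  then show "dual_fun b \<in> dual_space C" "b' \<in> basis \<Longrightarrow> dual_fun b b' = (if b' = b then 1 else 0)" by auto
qed

end

section \<open>The symplectic form\<close>

context chain_algebra
begin

lemma gen_inj:
  assumes "u \<in> V" and "v \<in> V" and "gen u = gen v"
  shows "u = v"
proof -
  have "vertex_coord u (gen v) 1 = (if v = u then 1 else 0)"
    by (simp add: vertex_coord(2)[OF assms(2)] vertex_gens_def)
  moreover have "vertex_coord u (gen v) 1 = 1"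
    using vertex_coord_separates(1)[OF assms(1)] by (simp only: assms(3))
  ultimately show ?thesis by (simp split: if_splits)
qed

lemma w_neq_gen:
  assumes "(i, j) \<in> E" and "2 \<le> l" and "v \<in> V"
  shows "w i j l \<noteq> gen v"
proof
  assume "w i j l = gen v"
  then have "vertex_coord v (gen v) = (\<lambda>_. 0)" using vertex_coord_w[OF assms(1,2), of v] by (simp only:)
  then show False using vertex_coord_separates(1)[OF assms(3)] by simp
qed

lemma w_inj:
  assumes ij: "(i, j) \<in> E" "2 \<le> l" "l \<le> \<kappa> (i, j)"
    and ij': "(i', j') \<in> E" "2 \<le> l'" "l' \<le> \<kappa> (i', j')" and eq: "w i j l = w i' j' l'"
  shows "(i', j') = (i, j) \<and> l' = l"
proof -
  have l: "1 \<le> l" "1 \<le> l'" using ij ij' by auto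
  have one: "edge_coord i j (w i' j' l') l = 1"
    using edge_coord_separates_w(1)[OF ij(1) l(1) ij(3)] eq by simp
  have same: "(i', j') = (i, j)"
  proof (rule ccontr)
    assume "(i', j') \<noteq> (i, j)"
    from edge_coord_w_other[OF ij(1) ij'(1) this ij'(2)] one show False by simp
  qed
  then have "edge_coord i j (w i' j' l') l = (if l = l' then 1 else 0)"
    using edge_coord_w_same[OF ij(1) l(2)] ij'(3) by simp
  then show ?thesis using one same by (simp split: if_splits)
qed

text \<open>Labels for the standard basis in which \<open>Inr ((i, j), 1)\<close> stands for the vertex \<open>i\<close>.  Then
\<open>w\<^sub>i\<^sub>j\<^sup>l\<close> is treated uniformly for all \<open>1 \<le> l \<le> \<kappa>\<^sub>i\<^sub>j\<close>, and only the vertices without outgoing arc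
need labels of their own.\<close>

definition basis_elt :: "'v + ('v \<times> 'v) \<times> nat \<Rightarrow> ('k, 'v) chain_elt" where
  "basis_elt a = (case a of Inl v \<Rightarrow> gen v | Inr ((i, j), l) \<Rightarrow> w i j l)"

lemma basis_elt_simps [simp]:
  "basis_elt (Inl v) = gen v" "basis_elt (Inr ((i, j), l)) = w i j l"
  by (simp_all add: basis_elt_def)

lemma basis_elt_bij:
  assumes R: "R \<subseteq> V" and inj: "inj_on fst E" and out: "fst ` E = V - R"
  defines "J \<equiv> Inl ` R \<union> Inr ` Sigma E (\<lambda>e. {1..\<kappa> e})"
  shows "inj_on basis_elt J" and "basis_elt ` J = basis"
proof -
  have src: "i \<in> V \<and> i \<notin> R" if "(i, j) \<in> E" for i j
    using out that by force
  have gw: "gen v \<noteq> w i j l" if "v \<in> R" "(i, j) \<in> E" "1 \<le> l" "l \<le> \<kappa> (i, j)" for v i j l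
  proof (cases "l = 1")
    case True
    then show ?thesis using gen_inj[of v i] src[OF that(2)] that(1) R by (auto simp: w_simps)
  next
    case False
    then show ?thesis using w_neq_gen[OF that(2), of l v] that R by auto
  qed
  have ww: "(i', j') = (i, j) \<and> l' = l"
    if ij: "(i, j) \<in> E" "1 \<le> l" "l \<le> \<kappa> (i, j)" and ij': "(i', j') \<in> E" "1 \<le> l'" "l' \<le> \<kappa> (i', j')"
      and eq: "w i j l = w i' j' l'" for i j l i' j' l'
  proof -
    consider "l = 1" "l' = 1" | "l = 1" "2 \<le> l'" | "2 \<le> l" "l' = 1" | "2 \<le> l" "2 \<le> l'"
      using ij(2) ij'(2) by linarith
    then show ?thesis
    proof cases
      case 1
      then have "i = i'" using eq gen_inj[of i i'] src[OF ij(1)] src[OF ij'(1)] by (simp add: w_simps)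
      then show ?thesis using 1 inj_onD[OF inj, of "(i, j)" "(i', j')"] ij(1) ij'(1) by auto
    next
      case 2
      then show ?thesis using eq w_neq_gen[OF ij'(1) 2(2), of i] src[OF ij(1)] by (auto simp: w_simps)
    next
      case 3
      then show ?thesis using eq w_neq_gen[OF ij(1) 3(1), of i'] src[OF ij'(1)] by (auto simp: w_simps)
    next
      case 4
      then show ?thesis using w_inj[OF ij(1) 4(1) ij(3) ij'(1) 4(2) ij'(3) eq] by simp
    qed
  qed
  show "inj_on basis_elt J"
  proof (rule inj_onI)
    fix x y assume xy: "x \<in> J" "y \<in> J" "basis_elt x = basis_elt y"
    have form: "(\<exists>v\<in>R. z = Inl v) \<or> (\<exists>i j l. (i, j) \<in> E \<and> 1 \<le> l \<and> l \<le> \<kappa> (i, j) \<and> z = Inr ((i, j), l))"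
      if "z \<in> J" for z
      using that unfolding J_def by fastforce
    from form[OF xy(1)] form[OF xy(2)] consider
        u v where "u \<in> R" "v \<in> R" "x = Inl u" "y = Inl v"
      | v i j l where "v \<in> R" "(i, j) \<in> E" "1 \<le> l" "l \<le> \<kappa> (i, j)" "x = Inl v" "y = Inr ((i, j), l)"
      | v i j l where "v \<in> R" "(i, j) \<in> E" "1 \<le> l" "l \<le> \<kappa> (i, j)" "x = Inr ((i, j), l)" "y = Inl v"
      | i j l i' j' l' where "(i, j) \<in> E" "1 \<le> l" "l \<le> \<kappa> (i, j)" "(i', j') \<in> E" "1 \<le> l'" "l' \<le> \<kappa> (i', j')"
          "x = Inr ((i, j), l)" "y = Inr ((i', j'), l')"
      by blast
    then show "x = y"
    proof cases
      case (1 u v)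
      have "gen u = gen v" using xy(3) unfolding 1(3,4) by simp
      then have "u = v" using 1(1,2) R by (intro gen_inj) auto
      then show ?thesis using 1(3,4) by simp
    next
      case (2 v i j l)
      have "gen v = w i j l" using xy(3) unfolding 2(5,6) by simp
      then show ?thesis using gw[OF 2(1-4)] by contradiction
    next
      case (3 v i j l)
      have "gen v = w i j l" using xy(3) unfolding 3(5,6) by simp
      then show ?thesis using gw[OF 3(1-4)] by contradiction
    next
      case (4 i j l i' j' l')
      have "w i j l = w i' j' l'" using xy(3) unfolding 4(7,8) by simp
      from ww[OF 4(1-6) this] show ?thesis using 4(7,8) by simp
    qed
  qed
  show "basis_elt ` J = basis"
  proof (intro equalityI subsetI)
    fix b assume "b \<in> basis_elt ` J"
    then consider v where "v \<in> R" "b = gen v"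
      | i j l where "(i, j) \<in> E" "1 \<le> l" "l \<le> \<kappa> (i, j)" "b = w i j l"
      unfolding J_def by fastforce
    then show "b \<in> basis"
    proof cases
      case (1 v)
      then show ?thesis using R gen_in_basis by auto
    next
      case (2 i j l)
      then show ?thesis
        using w_in_basis[OF 2(1), of l] gen_in_basis[of i] src[OF 2(1)] by (cases "l = 1") (auto simp: w_simps)
    qed
  next
    fix b assume "b \<in> basis"
    then show "b \<in> basis_elt ` J"
    proof (cases rule: basis_cases)
      case (1 v)
      show ?thesis
      proof (cases "v \<in> R")
        case True
        then show ?thesis using 1 by (intro image_eqI[of _ _ "Inl v"]) (auto simp: J_def)
      next
        case False
        then have "v \<in> fst ` E" using out 1(1) by simp
        then obtain j where vj: "(v, j) \<in> E" by auto
        then have "Inr ((v, j), 1) \<in> J" using kappa_bounds[OF vj] by (auto simp: J_def)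
        then show ?thesis using 1 by (intro image_eqI[of _ _ "Inr ((v, j), 1)"]) (auto simp: w_simps)
      qed
    next
      case (2 i j l)
      then show ?thesis by (intro image_eqI[of _ _ "Inr ((i, j), l)"]) (auto simp: J_def)
    qed
  qed
qed

end

text \<open>The pairs of \<open>\<sigma>\<^sub>G\<close> are indexed by \<open>None\<close>, for the two roots, and by the arcs together with
\<open>1 \<le> l \<le> \<kappa>\<^sub>i\<^sub>j / 2\<close>; \<open>la\<close> and \<open>lb\<close> give the labels of the two members of a pair.  Both closedness and
the coefficients are read off from the coordinates of the filiform algebras.\<close>

lemma symplectic_sigma:
  fixes \<kappa> :: "'v \<times> 'v \<Rightarrow> nat" and G :: "'v pair_pre_digraph"
  assumes chain: "chain_digraph \<kappa> G" and even: "\<And>e. e \<in> parcs G \<Longrightarrow> even (\<kappa> e)"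
    and trees: "two_rooted_trees G r\<^sub>1 r\<^sub>2"
  shows "symplectic_form (chain_lie \<kappa> G :: ('k::field_char_0, ('k, 'v) chain_elt) module) (sigma \<kappa> G r\<^sub>1 r\<^sub>2)"
proof -
  interpret chain_algebra \<kappa> G "TYPE('k)" by unfold_locales (rule chain)
  note tree = two_rooted_trees_arcs[OF trees]
  note W11 = wedge_1_1[unfolded One_nat_def]
  have finE: "finite E" by (rule G.pair_finite_arcs)
  define S where "S = Sigma E (\<lambda>e. {1..\<kappa> e div 2})"
  define P where "P = insert None (Some ` S)"
  define la :: "(('v \<times> 'v) \<times> nat) option \<Rightarrow> _" where
    "la p = (case p of None \<Rightarrow> Inl r\<^sub>1 | Some (e, l) \<Rightarrow> Inr (e, l))" for p
  define lb :: "(('v \<times> 'v) \<times> nat) option \<Rightarrow> _" where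
    "lb p = (case p of None \<Rightarrow> Inl r\<^sub>2 | Some (e, l) \<Rightarrow> Inr (e, \<kappa> e + 1 - l))" for p
  define c :: "(('v \<times> 'v) \<times> nat) option \<Rightarrow> 'k" where
    "c p = (case p of None \<Rightarrow> 1 | Some (e, l) \<Rightarrow> (-1) ^ (l + 1))" for p
  define J where "J = Inl ` {r\<^sub>1, r\<^sub>2} \<union> Inr ` Sigma E (\<lambda>e. {1..\<kappa> e})"
  have finS: "finite S" unfolding S_def using finE by auto
  have kap: "\<kappa> e = 2 * (\<kappa> e div 2)" if "e \<in> E" for e using even[OF that] by simp
  have SomeP: "Some (e, l) \<in> P" if "e \<in> E" "1 \<le> l" "l \<le> \<kappa> e div 2" for e l
    unfolding P_def S_def by (intro insertI2 imageI) (use that in auto)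
  have la_inj: "inj_on la P"
    by (auto simp: inj_on_def P_def la_def split: option.splits)
  have lb_inj: "inj_on lb P"
    by (auto simp: inj_on_def P_def lb_def S_def split: option.splits)
  have disj: "la ` P \<inter> lb ` P = {}"
    using tree(1) by (auto simp: P_def la_def lb_def S_def)
  have un: "la ` P \<union> lb ` P = J"
  proof (intro equalityI subsetI)
    fix x assume "x \<in> la ` P \<union> lb ` P"
    then obtain p where p: "p \<in> P" "x = la p \<or> x = lb p" by blast
    show "x \<in> J"
    proof (cases p)
      case None
      then show ?thesis using p(2) by (auto simp: la_def lb_def J_def)
    next
      case (Some q)
      obtain e l where q: "q = (e, l)" by (cases q)
      then have "e \<in> E" "1 \<le> l" "l \<le> \<kappa> e div 2" using p(1) Some by (auto simp: P_def S_def)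
      then have "Inr (e, l) \<in> J" "Inr (e, \<kappa> e + 1 - l) \<in> J"
        unfolding J_def by (intro UnI2 imageI; auto)+
      then show ?thesis using p(2) Some q by (auto simp: la_def lb_def)
    qed
  next
    fix x assume "x \<in> J"
    then consider "x = Inl r\<^sub>1" | "x = Inl r\<^sub>2" | e l where "e \<in> E" "1 \<le> l" "l \<le> \<kappa> e" "x = Inr (e, l)"
      by (auto simp: J_def)
    then show "x \<in> la ` P \<union> lb ` P"
    proof cases
      case 1
      then have "x = la None" by (simp add: la_def)
      then show ?thesis by (auto simp: P_def)
    next
      case 2
      then have "x = lb None" by (simp add: lb_def)
      then show ?thesis by (auto simp: P_def)
    next
      case (3 e l)
      show ?thesis
      proof (cases "l \<le> \<kappa> e div 2")
        case True
        then have "x = la (Some (e, l))" "Some (e, l) \<in> P" using 3 SomeP by (auto simp: la_def)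
        then show ?thesis by blast
      next
        case False
        have "\<kappa> e + 1 - l \<le> \<kappa> e div 2" using False kap[OF 3(1)] by linarith
        then have "Some (e, \<kappa> e + 1 - l) \<in> P" using 3 by (intro SomeP) auto
        moreover have "x = lb (Some (e, \<kappa> e + 1 - l))" using 3 by (simp add: lb_def)
        ultimately show ?thesis by blast
      qed
    qed
  qed
  have R: "{r\<^sub>1, r\<^sub>2} \<subseteq> V" using tree(2,3) by simp
  have elt: "inj_on basis_elt J" "basis_elt ` J = basis"
    unfolding J_def by (rule basis_elt_bij[OF R tree(4,5)])+
  let ?a = "\<lambda>p. basis_elt (la p)" and ?b = "\<lambda>p. basis_elt (lb p)"
  have B: "?a ` P \<union> ?b ` P = basis"
    unfolding elt(2)[symmetric] un[symmetric] by (simp add: image_Un image_image)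
  have sub: "la ` P \<subseteq> J" "lb ` P \<subseteq> J" using un by auto
  show ?thesis
  proof (rule symplectic_form_of_pairing[where P = P and a = ?a and b = ?b and F = dual_fun and c = c])
    show "lie_algebra C" by (rule C.lie_algebra_axioms)
    show "finite P" using finS by (simp add: P_def)
    show "inj_on ?a P" using comp_inj_on[OF la_inj inj_on_subset[OF elt(1) sub(1)]] by (simp add: comp_def)
    show "inj_on ?b P" using comp_inj_on[OF lb_inj inj_on_subset[OF elt(1) sub(2)]] by (simp add: comp_def)
    show "?a ` P \<inter> ?b ` P = {}"
      using inj_on_image_Int[OF elt(1) sub] disj by (simp add: image_image)
    show "P \<noteq> {}" by (simp add: P_def)
    show "?a ` P \<union> ?b ` P \<subseteq> carrier C" unfolding B by (rule basis_closed)
    show "lspan C (?a ` P \<union> ?b ` P) = carrier C" unfolding B by (rule basis_spans)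
    show "dual_fun u \<in> dual_space C" if "u \<in> ?a ` P \<union> ?b ` P" for u
      using that unfolding B by (rule dual_fun_basis)
    show "dual_fun u v = (if v = u then 1 else 0)"
      if "u \<in> ?a ` P \<union> ?b ` P" "v \<in> ?a ` P \<union> ?b ` P" for u v
      using that unfolding B by (rule dual_fun_basis)
    show "c p \<noteq> 0" for p by (auto simp: c_def split: option.splits)
    show "sigma \<kappa> G r\<^sub>1 r\<^sub>2 x = (\<Sum>p\<in>P. c p * (dual_fun (?a p) (x 0) * dual_fun (?b p) (x 1) -
        dual_fun (?a p) (x 1) * dual_fun (?b p) (x 0)))" for x
    proof -
      let ?t = "\<lambda>p. c p * (dual_fun (?a p) (x 0) * dual_fun (?b p) (x 1) -
        dual_fun (?a p) (x 1) * dual_fun (?b p) (x 0))"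
      have "(\<Sum>p\<in>P. ?t p) = ?t None + (\<Sum>q\<in>S. ?t (Some q))"
        unfolding P_def using finS by (simp add: sum.reindex comp_def)
      also have "(\<Sum>q\<in>S. ?t (Some q)) = (\<Sum>e\<in>E. \<Sum>l = 1..\<kappa> e div 2. ?t (Some (e, l)))"
        unfolding S_def by (subst sum.Sigma) (use finE in auto)
      also have "\<dots> = (\<Sum>(i, j)\<in>E. sigma_edge \<kappa> G i j x)"
        by (rule sum.cong[OF refl])
          (auto simp: sigma_edge_def W11 chain_dual_conv la_def lb_def c_def)
      finally show ?thesis
        by (simp add: sigma_def W11 chain_dual_conv la_def lb_def c_def)
    qed
    show "diff2 C (sigma \<kappa> G r\<^sub>1 r\<^sub>2) x = 0" if "range x \<subseteq> carrier C" for x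
    proof -
      have xC: "x m \<in> carrier C" for m using that by auto
      define s where "s u v = sigma \<kappa> G r\<^sub>1 r\<^sub>2 (\<lambda>i. if i = (0::nat) then u else v)"
        for u v :: "('k, 'v) chain_elt"
      let ?d = "dual_fun (gen r\<^sub>1)" and ?d' = "dual_fun (gen r\<^sub>2)"
      define \<phi> where "\<phi> i j u v = chain_form (\<kappa> (i, j) div 2) (edge_coord i j u) (edge_coord i j v)" for i j u v
      have edge: "sigma_edge \<kappa> G i j (\<lambda>m. if m = (0::nat) then u else v) = \<phi> i j u v"
        if ij: "(i, j) \<in> E" and uv: "u \<in> carrier C" "v \<in> carrier C" for i j u v
      proof -
        have d: "dual_fun (w i j l) z = edge_coord i j z l" if "1 \<le> l" "l \<le> \<kappa> (i, j)" "z \<in> carrier C" for l z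
          by (rule dual_fun_w(3)[OF ij that])
        show ?thesis
          unfolding sigma_edge_def \<phi>_def chain_form_def kap[OF ij, symmetric]
          by (rule sum.cong[OF refl]) (use uv in \<open>auto simp: W11 chain_dual_conv one_form_def d\<close>)
      qed
      have s: "s u v = (?d u * ?d' v - ?d v * ?d' u) + (\<Sum>(i, j)\<in>E. \<phi> i j u v)"
        if "u \<in> carrier C" "v \<in> carrier C" for u v
        unfolding s_def sigma_def wedge_1_1 chain_dual_conv
        using edge that by (auto intro!: sum.cong)
      have d0: "dual_fun (gen r) (u \<otimes>\<^bsub>C\<^esub> v) = 0" if "r \<in> V" "u \<in> carrier C" "v \<in> carrier C" for r u v
        using dual_fun_gen(3)[OF that(1) C.bracket_closed[OF that(2,3)]] vertex_coord_bracket[OF that(2,3)]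
        by simp
      have \<phi>0: "\<phi> i j (x 0 \<otimes>\<^bsub>C\<^esub> x 1) (x 2) + \<phi> i j (x 1 \<otimes>\<^bsub>C\<^esub> x 2) (x 0) + \<phi> i j (x 2 \<otimes>\<^bsub>C\<^esub> x 0) (x 1) = 0"
        if ij: "(i, j) \<in> E" for i j
        using chain_form_closed[of "\<kappa> (i, j) div 2" "edge_coord i j (x 0)" "edge_coord i j (x 1)" "edge_coord i j (x 2)"]
        unfolding \<phi>_def kap[OF ij, symmetric] alg_homD(3)[OF edge_coord(1)[OF ij] xC xC] .
      have "diff2 C (sigma \<kappa> G r\<^sub>1 r\<^sub>2) x =
          s (x 0 \<otimes>\<^bsub>C\<^esub> x 1) (x 2) + s (x 1 \<otimes>\<^bsub>C\<^esub> x 2) (x 0) + s (x 2 \<otimes>\<^bsub>C\<^esub> x 0) (x 1)"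
        by (simp add: diff2_def s_def Let_def)
      also have "\<dots> = (\<Sum>(i, j)\<in>E. \<phi> i j (x 0 \<otimes>\<^bsub>C\<^esub> x 1) (x 2)) + (\<Sum>(i, j)\<in>E. \<phi> i j (x 1 \<otimes>\<^bsub>C\<^esub> x 2) (x 0))
          + (\<Sum>(i, j)\<in>E. \<phi> i j (x 2 \<otimes>\<^bsub>C\<^esub> x 0) (x 1))"
        using tree(2,3) by (simp only: s d0 xC C.bracket_closed mult_zero_left mult_zero_right diff_self add_0)
      also have "\<dots> = (\<Sum>(i, j)\<in>E. \<phi> i j (x 0 \<otimes>\<^bsub>C\<^esub> x 1) (x 2) + \<phi> i j (x 1 \<otimes>\<^bsub>C\<^esub> x 2) (x 0)
          + \<phi> i j (x 2 \<otimes>\<^bsub>C\<^esub> x 0) (x 1))"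
        by (simp add: sum.distrib case_prod_unfold)
      also have "\<dots> = 0" using \<phi>0 by (intro sum.neutral) auto
      finally show ?thesis .
    qed
  qed
qed

theorem theorem4p6:
  fixes \<kappa> :: "'v \<times> 'v \<Rightarrow> nat" and G :: "'v pair_pre_digraph"
  assumes "family_F1 \<kappa> G"
  shows "symplectic (chain_lie \<kappa> G :: ('k::field_char_0, ('k, 'v) chain_elt) module) \<and>
    (\<forall>v\<^sub>1 v\<^sub>2. two_rooted_trees G v\<^sub>1 v\<^sub>2 \<longrightarrow>
      symplectic_form (chain_lie \<kappa> G :: ('k, ('k, 'v) chain_elt) module) (sigma \<kappa> G v\<^sub>1 v\<^sub>2))"
proof -
  have "symplectic_form (chain_lie \<kappa> G :: ('k, ('k, 'v) chain_elt) module) (sigma \<kappa> G v\<^sub>1 v\<^sub>2)"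
    if "two_rooted_trees G v\<^sub>1 v\<^sub>2" for v\<^sub>1 v\<^sub>2
    using assms that by (intro symplectic_sigma) (auto simp: family_F1_def)
  moreover from this have "symplectic (chain_lie \<kappa> G :: ('k, ('k, 'v) chain_elt) module)"
    using assms unfolding family_F1_def symplectic_def by blast
  ultimately show ?thesis by blast
qed

end
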